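(* The thick Fourier transforms extend the Fourier transform of tempered distributions: for every $f\in\mathcal{S}'_\ast(\mathbb{R}^n)$ and every $F\in\mathcal{W}'(\mathbb{R}^n_{\mathrm c})$, $$\Pi_{\mathcal{W}^{\prime},\mathcal{S}^{\prime}}\mathcal{F}_{\ast}(f)=\mathcal{F}\left(\Pi_{\mathcal{S}_{\ast}^{\prime},\mathcal{S}^{\prime}}f\right),\qquad \Pi_{\mathcal{S}_{\ast}^{\prime},\mathcal{S}^{\prime}}\mathcal{F}^{\ast}(F)=\mathcal{F}\left(\Pi_{\mathcal{W}^{\prime},\mathcal{S}^{\prime}}F\right).$$
   Context: Let $n\geq 2$, $\mathbb{N}=\{0,1,2,\ldots\}$, $\mathbb{S}$ the unit sphere of $\mathbb{R}^n$, $\mathcal{D}(\mathbb{S})=C^\infty(\mathbb{S})$. Polar coordinates are $\mathbf{x}=r\mathbf{w}$ and $\mathbf{u}=s\mathbf{v}$ with $\mathbf{w},\mathbf{v}\in\mathbb{S}$. The Fourier transform is $\mathcal{F}\{f;\mathbf{u}\}=\int_{\mathbb{R}^n}f(\mathbf{x})e^{i\mathbf{x}\cdot\mathbf{u}}\,d\mathbf{x}$ on $\mathcal{S}(\mathbb{R}^n)$, extended to $\mathcal{S}'(\mathbb{R}^n)$ by duality. An asymptotic expansion is called strong if it may be differentiated termwise any number of times. Sphere spaces. $\mathcal{H}_k$ is the space of spherical harmonics of degree $k$ on $\mathbb{S}$; for $q\in\mathbb{N}$, $\mathcal{P}_q=\mathcal{H}_q\oplus\mathcal{H}_{q-2}\oplus\cdots$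 is the space of restrictions to $\mathbb{S}$ of homogeneous polynomials of degree $q$. For $q\in\mathbb{Z}$, $\mathcal{D}_q\subset\mathcal{D}(\mathbb{S})$ is: $\mathcal{D}(\mathbb{S})$ if $1-n\le q\le -1$; if $q\geq 0$, the functions whose spherical harmonic components of degrees $q,q-2,q-4,\ldots$ all vanish; if $q\leq -n$, $\mathcal{D}_q=\mathcal{D}_{-n-q}$. Thick test functions. $\mathcal{S}_\ast(\mathbb{R}^n)$ consists of the smooth functions $\phi$ on $\mathbb{R}^n\setminus\{\mathbf{0}\}$ that, with all derivatives, decay rapidly at infinity as Schwartz functions do, and that admit a strong expansion $\phi(r\mathbf{w})\sim\sum_{j=m}^\infty a_j(\mathbf{w})r^j$ as $r\to0^+$, for some $m\in\mathbb{Z}$, with $a_j\in\mathcal{D}(\mathbb{S})$. Topology: for fixed $m$, let $\mathcal{S}_\ast^{[m]}$ be those $\phi$ whose expansion starts at $r^m$; write $\partial^p\phi\sim\sum_{j\ge m-|p|}a_{j,p}(\mathbf{w})r^j$; the seminorms are $\sup_{|\mathbf{x}|\geq1}(1+|\mathbf{x}|)^k|\partial^p\phi(\mathbf{x})|$ and $\sup_{0<|\mathbf{x}|\le1}r^{-q}\big|\partial^p\phi(\mathbf{x})-\sum_{j=m-|p|}^{q-1}a_{j,p}(\mathbf{w})r^j\big|$ for $k\in\mathbb{N}$, multi-indices $p$ and integers $q\ge m$; $\mathcal{S}_\ast(\mathbb{R}^n)$ is the locally convex inductive limit of the $\mathcal{S}_\ast^{[m]}$ as $m\to-\infty$. The spaces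 $\mathcal{W}_{\mathrm{pre}}$ and $\mathcal{W}$. $\mathcal{W}_{\mathrm{pre}}(\mathbb{R}^n)$ consists of the smooth functions $\Phi$ on $\mathbb{R}^n$ with a strong expansion as $s\to\infty$, $$\Phi(s\mathbf{v})\sim\sum_{q=0}^{Q}\left(A_q(\mathbf{v})+P_q(\mathbf{v})\ln s\right)s^q+\sum_{q=1}^\infty A_{-q}(\mathbf{v})s^{-q},$$ for some $Q\in\mathbb{N}$, where $P_q\in\mathcal{P}_q$, $A_q\in\mathcal{D}(\mathbb{S})$ for $q>-n$ and $A_q\in\mathcal{D}_q$ for $q\leq-n$. The polynomial part $\Pi_{\mathrm{pol}}(\Phi)$ is the polynomial $\sum_{q=0}^Q s^q E_q(\mathbf{v})$, where $E_q$ is the sum of the spherical harmonic components of $A_q$ of degrees $q,q-2,q-4,\ldots$. $\mathcal{W}(\mathbb{R}^n)$ is the subspace of those $\Phi\in\mathcal{W}_{\mathrm{pre}}(\mathbb{R}^n)$ with $\Pi_{\mathrm{pol}}(\Phi)=0$, equivalently with $A_q\in\mathcal{D}_q$ for all $q\in\mathbb{Z}$. $\Pi_{\mathcal{W}_{\mathrm{pre}},\mathcal{W}}(\Phi)=\Phi-\Pi_{\mathrm{pol}}(\Phi)$. Topology: for fixed $Q$, writing $\partial^p\Phi\sim\sum_{j\le Q}(A_{j,p}(\mathbf{v})+B_{j,p}(\mathbf{v})\ln s)s^j$, use the seminorms $\sup_{|\mathbf{u}|\le2}|\partial^p\Phi|$ and $\sup_{|\mathbf{u}|\ge2}s^{-N}(1+\ln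 s)^{-1}\big|\partial^p\Phi-\sum_{N<j\le Q}(A_{j,p}+B_{j,p}\ln s)s^j\big|$ for multi-indices $p$ and integers $N\le Q$; $\mathcal{W}_{\mathrm{pre}}(\mathbb{R}^n)$ is the locally convex inductive limit as $Q\to\infty$, and $\mathcal{W}(\mathbb{R}^n)$ has the subspace topology. $\mathcal{S}_\ast'(\mathbb{R}^n)$ and $\mathcal{W}'(\mathbb{R}_{\mathrm c}^n)=\mathcal{W}'(\mathbb{R}^n)$ are the dual spaces. Transforms. For $\phi\in\mathcal{S}_\ast(\mathbb{R}^n)$, $\mathcal{P}f(\phi)\in\mathcal{S}'(\mathbb{R}^n)$ is $\langle\mathcal{P}f(\phi),\psi\rangle=\mathrm{F.p.}\lim_{\varepsilon\to0^+}\int_{|\mathbf{x}|>\varepsilon}\phi\psi\,d\mathbf{x}$, where the Hadamard finite part is the constant term left after discarding the terms $\varepsilon^{-\alpha}|\ln\varepsilon|^\beta$ ($\alpha>0,\beta\ge0$ or $\alpha=0,\beta>0$). Then $\mathcal{F}(\mathcal{P}f(\phi))\in\mathcal{W}_{\mathrm{pre}}(\mathbb{R}^n)$ and $\mathcal{F}_{\ast,\mathrm t}(\phi)=\Pi_{\mathcal{W}_{\mathrm{pre}},\mathcal{W}}(\mathcal{F}(\mathcal{P}f(\phi)))$. The operator $\mathcal{F}_{\ast,\mathrm t}:\mathcal{S}_\ast(\mathbb{R}^n)\to\mathcal{W}(\mathbb{R}^n)$ is a topological isomorphism, and $\mathcal{F}^\ast_{\mathrm t}:\mathcal{W}(\mathbb{R}^n)\to\mathcal{S}_\ast(\mathbb{R}^n)$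 is $\mathcal{F}_{\mathrm t}^\ast\{\Phi(\mathbf{u});\mathbf{x}\}=(2\pi)^n\mathcal{F}_{\ast,\mathrm t}^{-1}\{\Phi(\mathbf{u});-\mathbf{x}\}$. On the duals, $\mathcal{F}_\ast:\mathcal{S}_\ast'\to\mathcal{W}'$ is $\langle\mathcal{F}_\ast(f),\Phi\rangle=\langle f,\mathcal{F}_{\mathrm t}^\ast(\Phi)\rangle$ and $\mathcal{F}^\ast:\mathcal{W}'\to\mathcal{S}_\ast'$ is $\langle\mathcal{F}^\ast(G),\phi\rangle=\langle G,\mathcal{F}_{\ast,\mathrm t}(\phi)\rangle$. Projections. $\mathcal{S}(\mathbb{R}^n)$ is contained in both $\mathcal{S}_\ast(\mathbb{R}^n)$ and $\mathcal{W}(\mathbb{R}^n)$ (continuously); $\Pi_{\mathcal{S}_\ast',\mathcal{S}'}:\mathcal{S}_\ast'(\mathbb{R}^n)\to\mathcal{S}'(\mathbb{R}^n)$ and $\Pi_{\mathcal{W}',\mathcal{S}'}:\mathcal{W}'(\mathbb{R}^n_{\mathrm c})\to\mathcal{S}'(\mathbb{R}^n)$ are the duals of these inclusions (restriction of functionals to $\mathcal{S}(\mathbb{R}^n)$). *)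

theory Defs
  imports "HOL-Analysis.Analysis" "HOL-Library.Landau_Symbols"
begin

section \<open>Derivatives and smooth functions\<close>

definition pderiv1 :: "'n::finite \<Rightarrow> (real^'n \<Rightarrow> complex) \<Rightarrow> real^'n \<Rightarrow> complex" where
  "pderiv1 i f x = frechet_derivative f (at x) (axis i 1)"

text \<open>A multi-index \<open>p\<close> is encoded by a list of coordinate directions in which \<open>i\<close> occurs
  \<open>p i\<close> times, so \<open>|p|\<close> is the length of the list. For smooth functions the order of the
  list does not matter.\<close>

definition pderivs :: "'n::finite list \<Rightarrow> (real^'n \<Rightarrow> complex) \<Rightarrow> real^'n \<Rightarrow> complex" where
  "pderivs ds f = foldr pderiv1 ds f"

definition smooth_on :: "(real^'n) set \<Rightarrow> (real^'n::finite \<Rightarrow> complex) \<Rightarrow> bool" where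
  "smooth_on U f \<longleftrightarrow> open U \<and> (\<forall>ds. \<forall>x\<in>U. pderivs ds f differentiable (at x))"


section \<open>Locally convex topologies on spaces of functions\<close>

definition seminorm_on :: "('a \<Rightarrow> complex) set \<Rightarrow> (('a \<Rightarrow> complex) \<Rightarrow> real) \<Rightarrow> bool" where
  "seminorm_on V p \<longleftrightarrow>
     (\<forall>x\<in>V. 0 \<le> p x) \<and>
     (\<forall>x\<in>V. \<forall>y\<in>V. p (\<lambda>t. x t + y t) \<le> p x + p y) \<and>
     (\<forall>c. \<forall>x\<in>V. p (\<lambda>t. c * x t) = cmod c * p x)"

definition seminorm_topology ::
    "('a \<Rightarrow> complex) set \<Rightarrow> (('a \<Rightarrow> complex) \<Rightarrow> real) set \<Rightarrow> ('a \<Rightarrow> complex) topology" where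
  "seminorm_topology V S =
     topology_generated_by
       {{y \<in> V. p (\<lambda>t. y t - x t) < e} | p x e. p \<in> S \<and> x \<in> V \<and> 0 < e}"

text \<open>The finest topology on the union that is given by a family of seminorms and makes the
  inclusions of all the steps continuous.\<close>

definition lc_inductive_limit ::
    "('i \<Rightarrow> ('a \<Rightarrow> complex) set) \<Rightarrow> ('i \<Rightarrow> ('a \<Rightarrow> complex) topology) \<Rightarrow> ('a \<Rightarrow> complex) topology" where
  "lc_inductive_limit E \<tau> =
     topology_generated_by
       {U. \<exists>S. S \<noteq> {} \<and> (\<forall>p\<in>S. seminorm_on (\<Union>i. E i) p) \<and>
               (\<forall>i. continuous_map (\<tau> i) (seminorm_topology (\<Union>i. E i) S) id) \<and>
               openin (seminorm_topology (\<Union>i. E i) S) U}"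

text \<open>Functionals on \<open>V\<close> are extensional, so that equality of functionals is equality on \<open>V\<close>.\<close>

definition dual_space ::
    "('a \<Rightarrow> complex) set \<Rightarrow> ('a \<Rightarrow> complex) topology \<Rightarrow> (('a \<Rightarrow> complex) \<Rightarrow> complex) set" where
  "dual_space V T =
     {f \<in> extensional V.
        (\<forall>x\<in>V. \<forall>y\<in>V. f (\<lambda>t. x t + y t) = f x + f y) \<and>
        (\<forall>c. \<forall>x\<in>V. f (\<lambda>t. c * x t) = c * f x) \<and>
        continuous_map T euclidean f}"


section \<open>Functions on the unit sphere\<close>

text \<open>A function on the unit sphere is represented by any function on the whole space that has
  the given values on the sphere. It is smooth iff its extension
  that is homogeneous of degree 0 is smooth away from the origin; \<open>sgn x\<close> is \<open>x / |x|\<close>.\<close>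

definition sphere_smooth :: "(real^'n::finite \<Rightarrow> complex) set" where
  "sphere_smooth = {a. smooth_on (- {0}) (\<lambda>x. a (sgn x))}"

text \<open>By polar coordinates, \<open>n\<close> times the integral over the unit ball of the extension
  homogeneous of degree 0 is the integral with respect to surface measure.\<close>

definition sphere_integral :: "(real^'n::finite \<Rightarrow> complex) \<Rightarrow> complex" where
  "sphere_integral g = of_nat CARD('n) * (LINT x:ball 0 1|lborel. g (sgn x))"

definition hom_poly :: "nat \<Rightarrow> (real^'n::finite \<Rightarrow> complex) set" where
  "hom_poly k = {p. polynomial_function p \<and> (\<forall>c x. p (c *\<^sub>R x) = of_real (c ^ k) * p x)}"

definition harmonic :: "(real^'n::finite \<Rightarrow> complex) \<Rightarrow> bool" where
  "harmonic p \<longleftrightarrow> (\<forall>x. (\<Sum>i\<in>UNIV. pderivs [i, i] p x) = 0)"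

definition spherical_harmonics :: "nat \<Rightarrow> (real^'n::finite \<Rightarrow> complex) set" where
  "spherical_harmonics k = {restrict p (sphere 0 1) | p. p \<in> hom_poly k \<and> harmonic p}"

definition sphere_poly :: "nat \<Rightarrow> (real^'n::finite \<Rightarrow> complex) set" where
  "sphere_poly q = {P. \<exists>p\<in>hom_poly q. \<forall>v\<in>sphere 0 1. P v = p v}"

text \<open>The spherical harmonic component of degree \<open>k\<close> is the orthogonal projection to the
  spherical harmonics of degree \<open>k\<close>.\<close>

definition sph_component ::
    "nat \<Rightarrow> (real^'n::finite \<Rightarrow> complex) \<Rightarrow> real^'n \<Rightarrow> complex" where
  "sph_component k A =
     (THE Y. Y \<in> spherical_harmonics k \<and>
        (\<forall>Z\<in>spherical_harmonics k. sphere_integral (\<lambda>v. (A v - Y v) * cnj (Z v)) = 0))"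

definition sphere_smooth_wo :: "nat \<Rightarrow> (real^'n::finite \<Rightarrow> complex) set" where
  "sphere_smooth_wo q =
     {A \<in> sphere_smooth. \<forall>k\<le>q. even (q - k) \<longrightarrow> (\<forall>v\<in>sphere 0 1. sph_component k A v = 0)}"

definition D_sph :: "int \<Rightarrow> (real^'n::finite \<Rightarrow> complex) set" where
  "D_sph q =
     (if 0 \<le> q then sphere_smooth_wo (nat q)
      else if q \<le> - int CARD('n) then sphere_smooth_wo (nat (- int CARD('n) - q))
      else sphere_smooth)"


section \<open>The Schwartz space and tempered distributions\<close>

definition schwartz :: "(real^'n::finite \<Rightarrow> complex) set" where
  "schwartz =
     {\<psi>. smooth_on UNIV \<psi> \<and>
         (\<forall>k::nat. \<forall>ds. bounded ((\<lambda>x. (1 + norm x) ^ k * norm (pderivs ds \<psi> x)) ` UNIV))}"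

definition fourier :: "(real^'n::finite \<Rightarrow> complex) \<Rightarrow> real^'n \<Rightarrow> complex" where
  "fourier f u = (LINT x|lborel. f x * exp (\<i> * of_real (x \<bullet> u)))"

definition fourier_tempered ::
    "((real^'n::finite \<Rightarrow> complex) \<Rightarrow> complex) \<Rightarrow> (real^'n \<Rightarrow> complex) \<Rightarrow> complex" where
  "fourier_tempered T = (\<lambda>\<psi>\<in>schwartz. T (fourier \<psi>))"

definition regular_dist ::
    "(real^'n::finite \<Rightarrow> complex) \<Rightarrow> (real^'n \<Rightarrow> complex) \<Rightarrow> complex" where
  "regular_dist \<Phi> = (\<lambda>\<psi>\<in>schwartz. LINT x|lborel. \<Phi> x * \<psi> x)"


section \<open>Thick test functions\<close>

text \<open>A function on the complement of the origin is represented by its extension with value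
  \<open>0\<close> at the origin.\<close>

definition thick_term ::
    "(int \<Rightarrow> real^'n::finite \<Rightarrow> complex) \<Rightarrow> int \<Rightarrow> real^'n \<Rightarrow> complex" where
  "thick_term a j x = a j (sgn x) * of_real (norm x powi j)"

text \<open>A strong expansion is an asymptotic expansion, uniform in the direction \<open>sgn x\<close>, that
  remains one after applying \<open>pderivs ds\<close> to every term; the derivative of the term of
  index \<open>j\<close> is homogeneous of degree \<open>j - |p|\<close>.\<close>

definition thick_expansion ::
    "int \<Rightarrow> (int \<Rightarrow> real^'n::finite \<Rightarrow> complex) \<Rightarrow> (real^'n \<Rightarrow> complex) \<Rightarrow> bool" where
  "thick_expansion m a \<phi> \<longleftrightarrow>
     (\<forall>j\<ge>m. a j \<in> sphere_smooth) \<and>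
     (\<forall>ds. \<forall>N::int.
        (\<lambda>x. norm (pderivs ds \<phi> x - (\<Sum>j\<in>{m..<N}. pderivs ds (thick_term a j) x)))
          \<in> O[at 0](\<lambda>x. norm x powi (N - int (length ds))))"

definition thick_step :: "int \<Rightarrow> (real^'n::finite \<Rightarrow> complex) set" where
  "thick_step m =
     {\<phi>. \<phi> 0 = 0 \<and> smooth_on (- {0}) \<phi> \<and>
         (\<forall>k::nat. \<forall>ds. bounded ((\<lambda>x. (1 + norm x) ^ k * norm (pderivs ds \<phi> x)) ` {x. 1 \<le> norm x})) \<and>
         (\<exists>a. thick_expansion m a \<phi>)}"

definition thick_test :: "(real^'n::finite \<Rightarrow> complex) set" where
  "thick_test = (\<Union>m. thick_step m)"

text \<open>The values of the coefficients on the sphere are determined by \<open>\<phi>\<close>.\<close>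

definition thick_coeffs ::
    "int \<Rightarrow> (real^'n::finite \<Rightarrow> complex) \<Rightarrow> int \<Rightarrow> real^'n \<Rightarrow> complex" where
  "thick_coeffs m \<phi> = (SOME a. thick_expansion m a \<phi>)"

text \<open>The term of degree \<open>j\<close> in the expansion of \<open>pderivs ds \<phi>\<close> is the derivative of the term
  of index \<open>j + |p|\<close> in the expansion of \<open>\<phi>\<close>; the sum runs over the latter indices.\<close>

definition thick_seminorms :: "int \<Rightarrow> ((real^'n::finite \<Rightarrow> complex) \<Rightarrow> real) set" where
  "thick_seminorms m =
     {(\<lambda>\<phi>. SUP x\<in>{x. 1 \<le> norm x}. (1 + norm x) ^ k * norm (pderivs ds \<phi> x)) |
        (k::nat) ds. True} \<union>
     {(\<lambda>\<phi>. SUP x\<in>cball 0 1 - {0}.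
          norm x powi (- q) *
          norm (pderivs ds \<phi> x -
                (\<Sum>j\<in>{m..<q + int (length ds)}. pderivs ds (thick_term (thick_coeffs m \<phi>) j) x))) |
        ds q. m \<le> q}"

definition thick_topology :: "(real^'n::finite \<Rightarrow> complex) topology" where
  "thick_topology =
     lc_inductive_limit thick_step (\<lambda>m. seminorm_topology (thick_step m) (thick_seminorms m))"

definition thick_dual :: "((real^'n::finite \<Rightarrow> complex) \<Rightarrow> complex) set" where
  "thick_dual = dual_space thick_test thick_topology"


section \<open>The spaces W_pre and W\<close>

definition W_term ::
    "(int \<Rightarrow> real^'n::finite \<Rightarrow> complex) \<Rightarrow> (int \<Rightarrow> real^'n \<Rightarrow> complex) \<Rightarrow>
     int \<Rightarrow> real^'n \<Rightarrow> complex" where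
  "W_term A P q u =
     (A q (sgn u) + (if 0 \<le> q then P q (sgn u) * of_real (ln (norm u)) else 0)) *
     of_real (norm u powi q)"

definition W_expansion ::
    "nat \<Rightarrow> (int \<Rightarrow> real^'n::finite \<Rightarrow> complex) \<Rightarrow> (int \<Rightarrow> real^'n \<Rightarrow> complex) \<Rightarrow>
     (real^'n \<Rightarrow> complex) \<Rightarrow> bool" where
  "W_expansion Q A P \<Phi> \<longleftrightarrow>
     (\<forall>q\<in>{0..int Q}. P q \<in> sphere_poly (nat q)) \<and>
     (\<forall>q\<le>int Q. if q > - int CARD('n) then A q \<in> sphere_smooth else A q \<in> D_sph q) \<and>
     (\<forall>ds. \<forall>N::int.
        (\<lambda>u. norm (pderivs ds \<Phi> u - (\<Sum>q\<in>{N<..int Q}. pderivs ds (W_term A P q) u)))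
          \<in> O[at_infinity](\<lambda>u. norm u powi (N - int (length ds)) * (1 + ln (norm u))))"

definition W_pre_step :: "nat \<Rightarrow> (real^'n::finite \<Rightarrow> complex) set" where
  "W_pre_step Q = {\<Phi>. smooth_on UNIV \<Phi> \<and> (\<exists>A P. W_expansion Q A P \<Phi>)}"

definition W_pre :: "(real^'n::finite \<Rightarrow> complex) set" where
  "W_pre = (\<Union>Q. W_pre_step Q)"

definition W_coeffs ::
    "nat \<Rightarrow> (real^'n::finite \<Rightarrow> complex) \<Rightarrow>
     (int \<Rightarrow> real^'n \<Rightarrow> complex) \<times> (int \<Rightarrow> real^'n \<Rightarrow> complex)" where
  "W_coeffs Q \<Phi> = (SOME (A, P). W_expansion Q A P \<Phi>)"

text \<open>As for the thick test functions, the sum runs over the indices before differentiation.\<close>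

definition W_pre_seminorms :: "nat \<Rightarrow> ((real^'n::finite \<Rightarrow> complex) \<Rightarrow> real) set" where
  "W_pre_seminorms Q =
     {(\<lambda>\<Phi>. SUP u\<in>cball 0 2. norm (pderivs ds \<Phi> u)) | ds. True} \<union>
     {(\<lambda>\<Phi>. SUP u\<in>{u. 2 \<le> norm u}.
          norm u powi (- N) * inverse (1 + ln (norm u)) *
          norm (pderivs ds \<Phi> u -
                (\<Sum>q\<in>{N + int (length ds)<..int Q}.
                   pderivs ds (W_term (fst (W_coeffs Q \<Phi>)) (snd (W_coeffs Q \<Phi>)) q) u))) |
        ds N. N \<le> int Q}"

definition W_pre_topology :: "(real^'n::finite \<Rightarrow> complex) topology" where
  "W_pre_topology =
     lc_inductive_limit W_pre_step (\<lambda>Q. seminorm_topology (W_pre_step Q) (W_pre_seminorms Q))"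

definition pol_coeff :: "nat \<Rightarrow> (real^'n::finite \<Rightarrow> complex) \<Rightarrow> real^'n \<Rightarrow> complex" where
  "pol_coeff q A v = (\<Sum>k | k \<le> q \<and> even (q - k). sph_component k A v)"

text \<open>The polar formula determines the polynomial away from the origin, hence everywhere.\<close>

definition pol_part :: "(real^'n::finite \<Rightarrow> complex) \<Rightarrow> real^'n \<Rightarrow> complex" where
  "pol_part \<Phi> =
     (THE p. polynomial_function p \<and>
        (\<exists>Q A P. W_expansion Q A P \<Phi> \<and>
           (\<forall>s>0. \<forall>v\<in>sphere 0 1.
              p (s *\<^sub>R v) = (\<Sum>q\<le>Q. of_real (s ^ q) * pol_coeff q (A (int q)) v))))"

definition proj_W :: "(real^'n::finite \<Rightarrow> complex) \<Rightarrow> real^'n \<Rightarrow> complex" where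
  "proj_W \<Phi> = (\<lambda>u. \<Phi> u - pol_part \<Phi> u)"

definition W_space :: "(real^'n::finite \<Rightarrow> complex) set" where
  "W_space = {\<Phi> \<in> W_pre. pol_part \<Phi> = (\<lambda>u. 0)}"

definition W_dual :: "((real^'n::finite \<Rightarrow> complex) \<Rightarrow> complex) set" where
  "W_dual = dual_space W_space (subtopology W_pre_topology W_space)"


section \<open>Thick Fourier transforms\<close>

definition has_finite_part :: "(real \<Rightarrow> complex) \<Rightarrow> complex \<Rightarrow> bool" where
  "has_finite_part g c \<longleftrightarrow>
     (\<exists>I (\<kappa> :: real \<times> real \<Rightarrow> complex). finite I \<and>
        (\<forall>(\<alpha>, \<beta>)\<in>I. (\<alpha> > 0 \<and> \<beta> \<ge> 0) \<or> (\<alpha> = 0 \<and> \<beta> > 0)) \<and>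
        ((\<lambda>\<epsilon>. g \<epsilon> - (\<Sum>(\<alpha>, \<beta>)\<in>I. \<kappa> (\<alpha>, \<beta>) * of_real (\<epsilon> powr (- \<alpha>) * \<bar>ln \<epsilon>\<bar> powr \<beta>))) \<longlongrightarrow> c)
          (at_right 0))"

definition Pf :: "(real^'n::finite \<Rightarrow> complex) \<Rightarrow> (real^'n \<Rightarrow> complex) \<Rightarrow> complex" where
  "Pf \<phi> =
     (\<lambda>\<psi>\<in>schwartz.
        THE c. has_finite_part (\<lambda>\<epsilon>. LINT x:{x. \<epsilon> < norm x}|lborel. \<phi> x * \<psi> x) c)"

text \<open>The operator \<open>\<F>\<^bsub>*,t\<^esub>\<close>, introduced through its graph: \<open>\<Phi>\<close> is the element of
  \<open>W_pre\<close> that the tempered distribution \<open>\<F>(Pf \<phi>)\<close> is given by. That the graph is the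
  graph of a bijection from \<open>thick_test\<close> onto \<open>W_space\<close> is a theorem, not part of the definition.\<close>

definition thick_fourier_graph :: "((real^'n::finite \<Rightarrow> complex) \<times> (real^'n \<Rightarrow> complex)) set" where
  "thick_fourier_graph =
     {(\<phi>, proj_W \<Phi>) | \<phi> \<Phi>.
        \<phi> \<in> thick_test \<and> \<Phi> \<in> W_pre \<and> fourier_tempered (Pf \<phi>) = regular_dist \<Phi>}"

definition thick_fourier_test :: "(real^'n::finite \<Rightarrow> complex) \<Rightarrow> real^'n \<Rightarrow> complex" where
  "thick_fourier_test \<phi> = (THE \<Psi>. (\<phi>, \<Psi>) \<in> thick_fourier_graph)"

definition thick_fourier_test_inv :: "(real^'n::finite \<Rightarrow> complex) \<Rightarrow> real^'n \<Rightarrow> complex" where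
  "thick_fourier_test_inv \<Psi> = (THE \<phi>. (\<phi>, \<Psi>) \<in> thick_fourier_graph)"

definition W_fourier_test :: "(real^'n::finite \<Rightarrow> complex) \<Rightarrow> real^'n \<Rightarrow> complex" where
  "W_fourier_test \<Phi> x = of_real ((2 * pi) ^ CARD('n)) * thick_fourier_test_inv \<Phi> (- x)"

text \<open>The transforms \<open>\<F>\<^sub>*\<close> and \<open>\<F>\<^sup>*\<close> of functionals.\<close>

definition thick_fourier ::
    "((real^'n::finite \<Rightarrow> complex) \<Rightarrow> complex) \<Rightarrow> (real^'n \<Rightarrow> complex) \<Rightarrow> complex" where
  "thick_fourier f = (\<lambda>\<Phi>\<in>W_space. f (W_fourier_test \<Phi>))"

definition W_fourier ::
    "((real^'n::finite \<Rightarrow> complex) \<Rightarrow> complex) \<Rightarrow> (real^'n \<Rightarrow> complex) \<Rightarrow> complex" where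
  "W_fourier G = (\<lambda>\<phi>\<in>thick_test. G (thick_fourier_test \<phi>))"


section \<open>Projections to tempered distributions\<close>

text \<open>\<open>\<psi>(0 := 0)\<close> represents the restriction of \<open>\<psi>\<close> to the complement of the origin.\<close>

definition proj_thick_tempered ::
    "((real^'n::finite \<Rightarrow> complex) \<Rightarrow> complex) \<Rightarrow> (real^'n \<Rightarrow> complex) \<Rightarrow> complex" where
  "proj_thick_tempered f = (\<lambda>\<psi>\<in>schwartz. f (\<psi>(0 := 0)))"

definition proj_W_tempered ::
    "((real^'n::finite \<Rightarrow> complex) \<Rightarrow> complex) \<Rightarrow> (real^'n \<Rightarrow> complex) \<Rightarrow> complex" where
  "proj_W_tempered G = (\<lambda>\<psi>\<in>schwartz. G \<psi>)"

end

(*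
  Everything reduces to Schwartz functions psi: the pairs (psi, F psi) and (F^{-1} psi, psi) lie in
  the graph of the thick Fourier transform, and nothing else in the graph has such a psi as first
  or second component. Both sides of each identity then evaluate f or F at the same test function.

  Writing psi = F g by Fourier inversion, the expansion of psi at the origin is obtained by
  expanding the exponential under the integral sign, which makes it termwise differentiable.
  For the uniqueness of phi with F(Pf phi) = psi + polynomial, test with functions that vanish near
  the origin: there Pf phi acts by integration, and the polynomial, whose inverse Fourier
  transform is supported at the origin, contributes nothing. This needs that the polynomial part of
  every element of W_pre is indeed a polynomial, i.e. that asymptotic expansions are unique and
  that the projections to spherical harmonics exist.
*)
theory Submission
  imports Defs "HOL-Probability.Probability" "HOL-Real_Asymp.Real_Asymp"
begin

section \<open>Iterated partial derivatives\<close>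

text \<open>Finite parts, spherical harmonic components, polynomial parts and the transforms of test
  functions are all definite descriptions, so none has a usable value before a witness is shown to
  be the only one. This makes the linear independence of the functions
  \<open>s powr \<alpha> * ln s powr \<beta>\<close> at infinity a central tool: it yields the
  uniqueness of Hadamard finite parts, through s = 1/\<epsilon>, and that of the coefficients of
  expansions in \<open>W_pre\<close>. Values at the origin need care as well: thick test functions
  carry the dummy value 0 there, so a Schwartz function enters as \<open>\<psi>(0 := 0)\<close>, and
  functions are compared on the complement of the origin. Smoothness is proved by choosing a class
  of functions closed under first partial derivatives: polynomials times a power of 1/|x|,
  polynomials times flat exponentials, transforms of Schwartz functions. The inversion formula rests
  on one characteristic function on the line, that of the standard normal distribution, because the
  Gaussian is a product over the coordinates.\<close>

lemma pderivs_Nil [simp]: "pderivs [] f = f"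
  by (simp add: pderivs_def)

lemma pderivs_Cons [simp]: "pderivs (d # ds) f = pderiv1 d (pderivs ds f)"
  by (simp add: pderivs_def)

lemma pderivs_append: "pderivs (ds @ es) f = pderivs ds (pderivs es f)"
  by (simp add: pderivs_def)

lemma pderiv1_eqI:
  assumes "(f has_derivative D) (at x)" "D (axis i 1) = c"
  shows "pderiv1 i f x = c"
  using frechet_derivative_at[OF assms(1)] assms(2) by (simp add: pderiv1_def)

text \<open>Functions that agree near \<open>x\<close> have the same Frechet derivatives at
  \<open>x\<close>, so the choice made by \<open>frechet_derivative\<close> is the same for both;
  this covers points where no derivative exists.\<close>

lemma pderiv1_cong_open:
  assumes "open U" "x \<in> U" "\<And>y. y \<in> U \<Longrightarrow> f y = g y"
  shows "pderiv1 i f x = pderiv1 i g x"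
proof -
  have "(f has_derivative D) (at x) \<longleftrightarrow> (g has_derivative D) (at x)" for D
    using assms has_derivative_transform_within_open[of f D x UNIV U g]
      has_derivative_transform_within_open[of g D x UNIV U f] by auto
  thus ?thesis by (simp add: pderiv1_def frechet_derivative_def)
qed

lemma pderivs_cong_open:
  assumes "open U" "x \<in> U" "\<And>y. y \<in> U \<Longrightarrow> f y = g y"
  shows "pderivs ds f x = pderivs ds g x"
  using assms(2)
proof (induction ds arbitrary: x)
  case (Cons d ds)
  thus ?case using pderiv1_cong_open[OF assms(1), of x "pderivs ds f" "pderivs ds g"] by simp
qed (use assms in auto)

lemma differentiable_cong_open:
  assumes "open U" "x \<in> U" "\<And>y. y \<in> U \<Longrightarrow> f y = g y" "g differentiable at x"
  shows "f differentiable at x"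
proof -
  obtain D where "(g has_derivative D) (at x)" using assms(4) by (auto simp: differentiable_def)
  hence "(f has_derivative D) (at x)"
    using has_derivative_transform_within_open[of g D x UNIV U f] assms by auto
  thus ?thesis by (auto simp: differentiable_def)
qed

section \<open>Smoothness by coinduction\<close>

lemma pderivs_closed:
  assumes "open U" "f \<in> C" "\<And>f i. f \<in> C \<Longrightarrow> \<exists>g\<in>C. \<forall>x\<in>U. pderiv1 i f x = g x"
  shows "\<exists>g\<in>C. \<forall>x\<in>U. pderivs ds f x = g x"
proof (induction ds)
  case (Cons d ds)
  then obtain g where g: "g \<in> C" "\<And>x. x \<in> U \<Longrightarrow> pderivs ds f x = g x" by blast
  obtain h where "h \<in> C" "\<And>x. x \<in> U \<Longrightarrow> pderiv1 d g x = h x" using assms(3)[OF g(1)] by blast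
  thus ?case using pderiv1_cong_open[OF assms(1) _ g(2)] by auto
qed (use assms in auto)

text \<open>By \<open>pderivs_closed\<close> every iterated derivative agrees on the open set
  \<open>U\<close> with a member of \<open>C\<close>, and differentiability depends only on values
  near a point. Closure up to equality on \<open>U\<close> admits formulas that break down
  elsewhere, such as those with powers of 1/|x| at the origin.\<close>

lemma smooth_on_coinduct:
  assumes "open U" "f \<in> C" "\<And>f x. f \<in> C \<Longrightarrow> x \<in> U \<Longrightarrow> f differentiable at x"
    "\<And>f i. f \<in> C \<Longrightarrow> \<exists>g\<in>C. \<forall>x\<in>U. pderiv1 i f x = g x"
  shows "smooth_on U f"
  unfolding smooth_on_def
proof (intro conjI allI ballI)
  fix ds x assume x: "x \<in> U"
  obtain g where g: "g \<in> C" "\<And>x. x \<in> U \<Longrightarrow> pderivs ds f x = g x"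
    using pderivs_closed[of U f C ds, OF assms(1,2,4)] by blast
  show "pderivs ds f differentiable at x"
    by (rule differentiable_cong_open[OF assms(1) x g(2)]) (use g assms(3) x in auto)
qed fact

lemma smooth_on_differentiable: "smooth_on U f \<Longrightarrow> x \<in> U \<Longrightarrow> f differentiable at x"
  unfolding smooth_on_def using pderivs_Nil by metis

lemma smooth_on_continuous: "smooth_on U f \<Longrightarrow> continuous_on U f"
  by (meson continuous_at_imp_continuous_on differentiable_imp_continuous_within smooth_on_differentiable)

lemma smooth_on_cong:
  assumes "smooth_on U f" "\<And>x. x \<in> U \<Longrightarrow> f x = g x"
  shows "smooth_on U g"
  unfolding smooth_on_def
proof (intro conjI allI ballI)
  show "open U" using assms(1) by (simp add: smooth_on_def)
  fix ds x assume x: "x \<in> U"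
  show "pderivs ds g differentiable at x"
    by (rule differentiable_cong_open[OF \<open>open U\<close> x, of _ "pderivs ds f"])
      (use assms x pderivs_cong_open[OF \<open>open U\<close>, of _ f g] in \<open>auto simp: smooth_on_def\<close>)
qed

lemma smooth_on_subset: "smooth_on U f \<Longrightarrow> open V \<Longrightarrow> V \<subseteq> U \<Longrightarrow> smooth_on V f"
  by (auto simp: smooth_on_def)

section \<open>Partial derivatives versus the total derivative, and rules of calculus\<close>

lemma has_derivative_pderiv1:
  assumes "f differentiable at x"
  shows "(f has_derivative (\<lambda>h. \<Sum>k\<in>UNIV. h $ k *\<^sub>R pderiv1 k f x)) (at x)"
proof -
  let ?D = "frechet_derivative f (at x)"
  have D: "(f has_derivative ?D) (at x)" using assms frechet_derivative_works by blast
  have "?D h = (\<Sum>k\<in>UNIV. h $ k *\<^sub>R pderiv1 k f x)" for h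
  proof -
    have "?D h = ?D (\<Sum>k\<in>UNIV. h $ k *\<^sub>R axis k 1)"
      by (simp add: basis_expansion flip: scalar_mult_eq_scaleR)
    also have "\<dots> = (\<Sum>k\<in>UNIV. h $ k *\<^sub>R ?D (axis k 1))"
      using linear_frechet_derivative[OF assms] by (simp add: linear_sum linear_scale)
    finally show ?thesis by (simp add: pderiv1_def)
  qed
  thus ?thesis using D by (metis (no_types, lifting) ext)
qed

lemma sum_axis_scaleR:
  fixes g :: "'n::finite \<Rightarrow> 'a::real_vector"
  shows "(\<Sum>k\<in>UNIV. (axis j 1 :: real^'n) $ k *\<^sub>R g k) = g j"
proof -
  have "(\<Sum>k\<in>UNIV. (axis j 1 :: real^'n) $ k *\<^sub>R g k) = (\<Sum>k\<in>UNIV. if k = j then g k else 0)"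
    by (rule sum.cong) (auto simp: axis_def)
  thus ?thesis by simp
qed

lemma has_vector_derivative_along_axis:
  fixes f :: "real^'n::finite \<Rightarrow> complex"
  assumes "f differentiable at (x + s *\<^sub>R axis j 1)"
  shows "((\<lambda>s. f (x + s *\<^sub>R axis j 1)) has_vector_derivative pderiv1 j f (x + s *\<^sub>R axis j 1)) (at s within T)"
proof -
  have "((\<lambda>s. x + s *\<^sub>R axis j 1) has_derivative (\<lambda>h. h *\<^sub>R axis j 1)) (at s within T)"
    by (auto intro!: derivative_eq_intros)
  from has_derivative_compose[OF this has_derivative_pderiv1[OF assms]]
  show ?thesis
    by (simp only: vector_scaleR_component scaleR_scaleR[symmetric] real_scaleR_def
        scaleR_right.sum[symmetric] sum_axis_scaleR has_vector_derivative_def)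
qed

lemma pderiv1_add:
  assumes "f differentiable at x" "g differentiable at x"
  shows "pderiv1 i (\<lambda>x. f x + g x) x = pderiv1 i f x + pderiv1 i g x"
  by (rule pderiv1_eqI[OF has_derivative_add[OF assms[unfolded frechet_derivative_works]]])
    (simp add: pderiv1_def)

lemma pderiv1_cmult:
  assumes "f differentiable at x"
  shows "pderiv1 i (\<lambda>x. c * f x) x = c * pderiv1 i f x"
  by (rule pderiv1_eqI[OF has_derivative_mult_right[OF assms[unfolded frechet_derivative_works]]])
    (simp add: pderiv1_def)

lemma pderiv1_mult:
  assumes "f differentiable at x" "g differentiable at x"
  shows "pderiv1 i (\<lambda>x. f x * g x) x = f x * pderiv1 i g x + pderiv1 i f x * g x"
  by (rule pderiv1_eqI[OF has_derivative_mult[OF assms[unfolded frechet_derivative_works]]])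
    (simp add: pderiv1_def)

lemma pderiv1_const: "pderiv1 i (\<lambda>x. c) x = 0"
  by (rule pderiv1_eqI[OF has_derivative_const]) simp

lemma pderiv1_const_fun: "pderiv1 i (\<lambda>x. c) = (\<lambda>x. 0)"
  by (rule ext) (rule pderiv1_const)

lemma pderivs_zero: "pderivs ds (\<lambda>x. 0) = (\<lambda>x. 0)"
proof (induction ds)
  case (Cons d ds)
  thus ?case by (metis pderiv1_const pderivs_Cons ext)
qed simp

lemma has_derivative_coord: "((\<lambda>x. of_real (x $ j) :: complex) has_derivative (\<lambda>h. of_real (h $ j))) (at x)"
  by (intro has_derivative_of_real bounded_linear_imp_has_derivative bounded_linear_vec_nth)

lemma differentiable_coord: "(\<lambda>x::real^'n::finite. of_real (x $ j) :: complex) differentiable at x"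
  using has_derivative_coord differentiable_def by blast

lemma pderiv1_coord: "pderiv1 i (\<lambda>x. of_real (x $ j)) x = (if i = j then 1 else 0)"
  by (rule pderiv1_eqI[OF has_derivative_coord]) (simp add: axis_def)


section \<open>The Schwartz space\<close>

definition rapid :: "(real^'n::finite \<Rightarrow> complex) \<Rightarrow> bool" where
  "rapid f \<longleftrightarrow> (\<forall>k. \<exists>B. \<forall>x. (1 + norm x) ^ k * norm (f x) \<le> B)"

lemma rapidD:
  assumes "rapid f"
  obtains B where "B > 0" "\<And>x. (1 + norm x) ^ k * norm (f x) \<le> B"
proof -
  obtain B where "\<And>x. (1 + norm x) ^ k * norm (f x) \<le> B" using assms rapid_def by blast
  hence "(1 + norm x) ^ k * norm (f x) \<le> \<bar>B\<bar> + 1" for x by (smt (verit))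
  thus thesis using that[of "\<bar>B\<bar> + 1"] by simp
qed

lemma schwartz_iff_rapid:
  fixes f :: "real^'n::finite \<Rightarrow> complex"
  shows "f \<in> schwartz \<longleftrightarrow> smooth_on UNIV f \<and> (\<forall>ds. rapid (pderivs ds f))"
proof -
  have "bounded ((\<lambda>x::real^'n. (1 + norm x) ^ k * norm (g x)) ` UNIV) \<longleftrightarrow>
        (\<exists>B. \<forall>x. (1 + norm x) ^ k * norm (g x) \<le> B)" for g :: "real^'n \<Rightarrow> complex" and k
    unfolding bounded_iff by (simp add: norm_mult norm_power)
  thus ?thesis unfolding schwartz_def rapid_def by auto
qed

text \<open>Closure is here equality of functions on the whole space, so every
  \<open>pderivs ds f\<close> is itself a member of \<open>C\<close>, and a single decay condition
  on \<open>C\<close> covers all derivatives at once.\<close>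

lemma schwartz_coinduct:
  assumes "f \<in> C" "\<And>f x. f \<in> C \<Longrightarrow> f differentiable at x" "\<And>f i. f \<in> C \<Longrightarrow> pderiv1 i f \<in> C"
    "\<And>f. f \<in> C \<Longrightarrow> rapid f"
  shows "f \<in> schwartz"
  unfolding schwartz_iff_rapid
proof (intro conjI allI)
  have e: "\<And>f i. f \<in> C \<Longrightarrow> \<exists>g\<in>C. \<forall>x\<in>UNIV. pderiv1 i f x = g x" using assms(3) by blast
  show "smooth_on UNIV f" by (rule smooth_on_coinduct[of _ _ C]) (use assms e in auto)
  fix ds
  have "pderivs ds f \<in> C" by (induction ds) (use assms in auto)
  thus "rapid (pderivs ds f)" by (rule assms(4))
qed

lemma schwartz_pderiv1: "f \<in> schwartz \<Longrightarrow> pderiv1 i f \<in> schwartz"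
  unfolding schwartz_iff_rapid smooth_on_def using pderivs_append[of _ "[i]" f] by simp metis

lemma schwartz_pderivs: "f \<in> schwartz \<Longrightarrow> pderivs ds f \<in> schwartz"
  by (induction ds) (auto simp: schwartz_pderiv1)

lemma schwartz_rapid: "f \<in> schwartz \<Longrightarrow> rapid f"
  unfolding schwartz_iff_rapid by (metis pderivs_Nil)

lemma schwartz_differentiable: "f \<in> schwartz \<Longrightarrow> f differentiable at x"
  unfolding schwartz_iff_rapid using smooth_on_differentiable by blast

lemma schwartz_continuous: "f \<in> schwartz \<Longrightarrow> continuous_on A f"
  by (meson continuous_at_imp_continuous_on differentiable_imp_continuous_within schwartz_differentiable)

lemma schwartz_measurable [measurable_dest]: "f \<in> schwartz \<Longrightarrow> f \<in> borel_measurable borel"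
  using schwartz_continuous borel_measurable_continuous_onI by blast

section \<open>Closure properties of rapid decay and of the Schwartz space\<close>

lemma rapid_add: "rapid f \<Longrightarrow> rapid g \<Longrightarrow> rapid (\<lambda>x. f x + g x)"
  unfolding rapid_def
proof
  fix k assume f: "\<forall>k. \<exists>B. \<forall>x. (1 + norm x) ^ k * norm (f x) \<le> B"
    and g: "\<forall>k. \<exists>B. \<forall>x. (1 + norm x) ^ k * norm (g x) \<le> B"
  from f g obtain B C where B: "\<And>x. (1 + norm x) ^ k * norm (f x) \<le> B"
    and C: "\<And>x. (1 + norm x) ^ k * norm (g x) \<le> C" by meson
  have "(1 + norm x) ^ k * norm (f x + g x) \<le> B + C" for x
  proof -
    have "(1 + norm x) ^ k * norm (f x + g x) \<le> (1 + norm x) ^ k * (norm (f x) + norm (g x))"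
      by (intro mult_left_mono norm_triangle_ineq) auto
    thus ?thesis using B[of x] C[of x] by (simp add: algebra_simps)
  qed
  thus "\<exists>B. \<forall>x. (1 + norm x) ^ k * norm (f x + g x) \<le> B" by blast
qed

lemma rapid_le:
  assumes "rapid f" "\<And>x. norm (g x) \<le> M * (1 + norm x) ^ l * norm (f x)" "M \<ge> 0"
  shows "rapid g"
  unfolding rapid_def
proof
  fix k
  obtain B where B: "\<And>x. (1 + norm x) ^ (k + l) * norm (f x) \<le> B" using assms(1) rapid_def by blast
  have "(1 + norm x) ^ k * norm (g x) \<le> M * B" for x
  proof -
    have "(1 + norm x) ^ k * norm (g x) \<le> (1 + norm x) ^ k * (M * (1 + norm x) ^ l * norm (f x))"
      by (intro mult_left_mono assms) auto
    also have "\<dots> = M * ((1 + norm x) ^ (k + l) * norm (f x))" by (simp add: power_add)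
    also have "\<dots> \<le> M * B" by (intro mult_left_mono B assms)
    finally show ?thesis .
  qed
  thus "\<exists>B. \<forall>x. (1 + norm x) ^ k * norm (g x) \<le> B" by blast
qed

lemma rapid_cmult: "rapid f \<Longrightarrow> rapid (\<lambda>x. c * f x)"
  by (rule rapid_le[of f _ "norm c" 0]) (auto simp: norm_mult)

lemma rapid_coord:
  fixes f :: "real^'n::finite \<Rightarrow> complex"
  shows "rapid f \<Longrightarrow> rapid (\<lambda>x. of_real (x $ j) * f x)"
proof (rule rapid_le[of f _ 1 1])
  fix x :: "real^'n"
  have "\<bar>x $ j\<bar> \<le> 1 + norm x" using component_le_norm_cart[of x j] by linarith
  thus "norm (of_real (x $ j) * f x) \<le> 1 * (1 + norm x) ^ 1 * norm (f x)"
    by (simp add: norm_mult mult_right_mono)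
qed auto

lemma schwartz_lincomb:
  fixes f g :: "real^'n::finite \<Rightarrow> complex"
  assumes "f \<in> schwartz" "g \<in> schwartz"
  shows "(\<lambda>x. c * f x + d * g x) \<in> schwartz"
proof -
  let ?C = "{\<lambda>x. c * f x + d * g x | f g. f \<in> schwartz \<and> g \<in> (schwartz :: (real^'n \<Rightarrow> complex) set)}"
  show ?thesis
  proof (rule schwartz_coinduct[of _ ?C])
    fix h assume "h \<in> ?C"
    then obtain f g where h: "h = (\<lambda>x. c * f x + d * g x)" "f \<in> schwartz" "g \<in> schwartz" by blast
    have diff: "(\<lambda>x. c * f x) differentiable at x" if "f \<in> schwartz" for c x and f :: "real^'n \<Rightarrow> complex"
      by (intro differentiable_mult differentiable_const schwartz_differentiable that)
    show "h differentiable at x" for x unfolding h by (intro differentiable_add diff h)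
    show "rapid h" unfolding h by (rule rapid_add; rule rapid_cmult) (intro schwartz_rapid h)+
    have "pderiv1 i h = (\<lambda>x. c * pderiv1 i f x + d * pderiv1 i g x)" for i
      unfolding h using h by (simp add: fun_eq_iff pderiv1_add diff pderiv1_cmult schwartz_differentiable)
    thus "pderiv1 i h \<in> ?C" for i using h schwartz_pderiv1 by blast
  qed (use assms in blast)
qed

lemma schwartz_add: "f \<in> schwartz \<Longrightarrow> g \<in> schwartz \<Longrightarrow> (\<lambda>x. f x + g x) \<in> schwartz"
  using schwartz_lincomb[of f g 1 1] by simp

lemma schwartz_cmult: "f \<in> schwartz \<Longrightarrow> (\<lambda>x. c * f x) \<in> schwartz"
  using schwartz_lincomb[of f f c 0] by simp

lemma schwartz_coord:
  fixes f :: "real^'n::finite \<Rightarrow> complex"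
  assumes "f \<in> schwartz"
  shows "(\<lambda>x. of_real (x $ j) * f x) \<in> schwartz"
proof -
  \<comment> \<open>Differentiating the coordinate produces an extra term without it, so the members
    of the class carry a free Schwartz summand \<open>g\<close>; the function at hand fits with
    \<open>g\<close> equal to \<open>0 * f\<close>.\<close>
  let ?C = "{\<lambda>x. of_real (x $ j) * f x + g x | f g. f \<in> schwartz \<and> g \<in> (schwartz :: (real^'n \<Rightarrow> complex) set)}"
  have "(\<lambda>x. of_real (x $ j) * f x + 0 * f x) \<in> schwartz"
  proof (rule schwartz_coinduct[of _ ?C])
    show "(\<lambda>x. of_real (x $ j) * f x + 0 * f x) \<in> ?C"
      using assms schwartz_cmult[OF assms, of 0] by (intro CollectI exI conjI) (rule refl)
  next
    fix h i assume "h \<in> ?C"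
    then obtain f g where h: "h = (\<lambda>x. of_real (x $ j) * f x + g x)" "f \<in> schwartz" "g \<in> schwartz" by blast
    have "pderiv1 i h x = of_real (x $ j) * pderiv1 i f x + ((if i = j then 1 else 0) * f x + pderiv1 i g x)" for x
      unfolding h(1)
      using pderiv1_add[OF differentiable_mult[OF differentiable_coord schwartz_differentiable[OF h(2)]]
          schwartz_differentiable[OF h(3)], where i = i and x = x]
        pderiv1_mult[OF differentiable_coord schwartz_differentiable[OF h(2)], where i = i and x = x]
      by (simp add: pderiv1_coord)
    hence "pderiv1 i h = (\<lambda>x. of_real (x $ j) * pderiv1 i f x + ((if i = j then 1 else 0) * f x + pderiv1 i g x))"
      by blast
    thus "pderiv1 i h \<in> ?C"
      by (intro CollectI exI[of _ "pderiv1 i f"] exI[of _ "\<lambda>x. (if i = j then 1 else 0) * f x + pderiv1 i g x"]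
        conjI schwartz_add schwartz_cmult schwartz_pderiv1 h)
  next
    fix h assume "h \<in> ?C"
    then obtain f g where h: "h = (\<lambda>x. of_real (x $ j) * f x + g x)" "f \<in> schwartz" "g \<in> schwartz" by blast
    show "h differentiable at x" for x
      unfolding h by (intro differentiable_add differentiable_mult differentiable_coord schwartz_differentiable h)
    show "rapid h" unfolding h by (rule rapid_add, rule rapid_coord) (intro schwartz_rapid h)+
  qed
  thus ?thesis by simp
qed

text \<open>Peetre's inequality 1 + |x| <= (1 + |a|) (1 + |a + c x|) absorbs the shift. The two
  signs of \<open>c\<close> cover translations and the reflection at the origin together.\<close>

lemma rapid_affine:
  assumes "rapid f" and c: "\<bar>c\<bar> = 1"
  shows "rapid (\<lambda>x. f (a + c *\<^sub>R x))"
  unfolding rapid_def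
proof
  fix k
  obtain B where B: "\<And>x. (1 + norm x) ^ k * norm (f x) \<le> B" using assms(1) rapid_def by blast
  have "(1 + norm x) ^ k * norm (f (a + c *\<^sub>R x)) \<le> (1 + norm a) ^ k * B" for x
  proof -
    have "norm x = norm ((a + c *\<^sub>R x) - a)" using c by simp
    also have "\<dots> \<le> norm (a + c *\<^sub>R x) + norm a" by (rule norm_triangle_ineq4)
    finally have "1 + norm x \<le> (1 + norm a) * (1 + norm (a + c *\<^sub>R x))"
      using mult_nonneg_nonneg[OF norm_ge_zero[of a] norm_ge_zero[of "a + c *\<^sub>R x"]]
      by (simp only: distrib_left distrib_right)
    hence "(1 + norm x) ^ k \<le> (1 + norm a) ^ k * (1 + norm (a + c *\<^sub>R x)) ^ k"
      by (metis power_mono power_mult_distrib add_nonneg_nonneg norm_ge_zero zero_le_one)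
    hence "(1 + norm x) ^ k * norm (f (a + c *\<^sub>R x)) \<le>
      (1 + norm a) ^ k * (1 + norm (a + c *\<^sub>R x)) ^ k * norm (f (a + c *\<^sub>R x))"
      by (rule mult_right_mono) auto
    also have "\<dots> \<le> (1 + norm a) ^ k * B"
      using mult_left_mono[OF B[of "a + c *\<^sub>R x"], of "(1 + norm a) ^ k"] by (simp add: mult.assoc)
    finally show ?thesis .
  qed
  thus "\<exists>B. \<forall>x. (1 + norm x) ^ k * norm (f (a + c *\<^sub>R x)) \<le> B" by blast
qed

lemma has_derivative_affine_comp:
  fixes f :: "real^'n::finite \<Rightarrow> complex"
  assumes "f differentiable at (a + c *\<^sub>R x)"
  shows "((\<lambda>x. f (a + c *\<^sub>R x)) has_derivative (\<lambda>h. frechet_derivative f (at (a + c *\<^sub>R x)) (c *\<^sub>R h))) (at x)"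
proof -
  have "((\<lambda>x. a + c *\<^sub>R x) has_derivative (\<lambda>h. c *\<^sub>R h)) (at x)"
    by (auto intro!: derivative_eq_intros)
  from has_derivative_compose[OF this] show ?thesis
    using assms frechet_derivative_works by blast
qed

lemma schwartz_affine:
  fixes f :: "real^'n::finite \<Rightarrow> complex"
  assumes "f \<in> schwartz" and c: "\<bar>c\<bar> = 1"
  shows "(\<lambda>x. f (a + c *\<^sub>R x)) \<in> schwartz"
proof -
  let ?C = "{\<lambda>x. f (a + c *\<^sub>R x) | f. f \<in> (schwartz :: (real^'n \<Rightarrow> complex) set)}"
  show ?thesis
  proof (rule schwartz_coinduct[of _ ?C])
    fix h i assume "h \<in> ?C"
    then obtain f where h: "h = (\<lambda>x. f (a + c *\<^sub>R x))" "f \<in> schwartz" by blast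
    note d = schwartz_differentiable[OF h(2)]
    have "pderiv1 i h x = c *\<^sub>R pderiv1 i f (a + c *\<^sub>R x)" for x
      unfolding h by (rule pderiv1_eqI[OF has_derivative_affine_comp[OF d]])
        (simp add: pderiv1_def linear_frechet_derivative[OF d] linear_scale)
    hence "pderiv1 i h = (\<lambda>x. (\<lambda>y. of_real c * pderiv1 i f y) (a + c *\<^sub>R x))"
      by (simp add: fun_eq_iff scaleR_conv_of_real)
    moreover have "(\<lambda>y. of_real c * pderiv1 i f y) \<in> schwartz"
      by (intro schwartz_cmult schwartz_pderiv1 h)
    ultimately show "pderiv1 i h \<in> ?C" by (intro CollectI exI conjI)
  next
    fix h x assume "h \<in> ?C"
    then obtain f where h: "h = (\<lambda>x. f (a + c *\<^sub>R x))" "f \<in> schwartz" by blast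
    show "h differentiable at x"
      unfolding h using has_derivative_affine_comp[OF schwartz_differentiable[OF h(2)]]
        differentiable_def by blast
    show "rapid h" unfolding h by (intro rapid_affine schwartz_rapid h c)
  qed (use assms in auto)
qed

lemma schwartz_uminus: "f \<in> schwartz \<Longrightarrow> (\<lambda>x. f (- x)) \<in> schwartz"
  using schwartz_affine[of f "-1" 0] by simp

lemma schwartz_translate: "f \<in> schwartz \<Longrightarrow> (\<lambda>x. f (x + a)) \<in> schwartz"
  using schwartz_affine[of f 1 a] by (simp add: add.commute)

section \<open>Integration on Cartesian powers of the line\<close>

text \<open>\<open>lborel\<close> on \<open>real^'n\<close> is the image of a product of lines
  indexed by \<open>Basis\<close>. The bijection sending i to \<open>axis i 1\<close> carries the
  index type to \<open>Basis\<close>, after which the product rule for finite product measures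
  applies; \<open>g\<close> is the family \<open>f\<close> re-indexed.\<close>

lemma
  fixes f :: "'n::finite \<Rightarrow> real \<Rightarrow> complex"
  assumes int: "\<And>i. integrable lborel (f i)"
  shows integrable_prod_cart: "integrable lborel (\<lambda>x::real^'n. \<Prod>i\<in>UNIV. f i (x $ i))"
    and integral_prod_cart:
      "(LINT x|lborel. (\<Prod>i\<in>UNIV. f i ((x::real^'n) $ i))) = (\<Prod>i\<in>UNIV. LINT t|lborel. f i t)"
proof -
  interpret product_sigma_finite "\<lambda>_::real^'n. lborel :: real measure" ..
  let ?ax = "\<lambda>i::'n. axis i (1::real)"
  let ?P = "\<Pi>\<^sub>M b\<in>(Basis :: (real^'n) set). (lborel :: real measure)"
  let ?h = "\<lambda>f. \<Sum>b\<in>(Basis :: (real^'n) set). (f b :: real) *\<^sub>R b"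
  define g where "g b = f (inv ?ax b)" for b
  have inj: "inj ?ax" by (auto simp: inj_def axis_eq_axis)
  have B: "(Basis :: (real^'n) set) = range ?ax" by (auto simp: Basis_vec_def)
  have g: "g (?ax i) = f i" for i by (simp add: g_def inv_f_f[OF inj])
  have prod_B: "(\<Prod>b\<in>Basis. F b) = (\<Prod>i\<in>UNIV. F (?ax i))" for F :: "real^'n \<Rightarrow> complex"
    unfolding B by (subst prod.reindex[OF inj]) simp
  have h: "?h y $ i = y (?ax i)" for y i
    unfolding B by (subst sum.reindex[OF inj]) (simp add: axis_def if_distrib cong: if_cong)
  have fm [measurable]: "f i \<in> borel_measurable borel" for i
    using borel_measurable_integrable[OF int, of i] by simp
  have gi: "integrable lborel (g b)" for b unfolding g_def by (rule int)
  have m1: "?h \<in> measurable ?P borel" by measurable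
  have m2: "(\<lambda>x::real^'n. \<Prod>i\<in>UNIV. f i (x $ i)) \<in> borel_measurable borel" by measurable
  have e: "(\<Prod>i\<in>UNIV. f i (?h y $ i)) = (\<Prod>b\<in>Basis. g b (y b))" for y
    by (simp only: h prod_B g)
  have "integrable ?P (\<lambda>y. \<Prod>b\<in>Basis. g b (y b))"
    by (intro product_integrable_prod gi finite_Basis)
  thus "integrable lborel (\<lambda>x::real^'n. \<Prod>i\<in>UNIV. f i (x $ i))"
    by (subst lborel_eq, subst integrable_distr_eq[OF m1 m2]) (simp only: e)
  have "(LINT x|lborel. (\<Prod>i\<in>UNIV. f i ((x::real^'n) $ i))) = (LINT y|?P. (\<Prod>b\<in>Basis. g b (y b)))"
    by (subst lborel_eq, subst integral_distr[OF m1 m2]) (simp only: e)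
  also have "\<dots> = (\<Prod>b\<in>Basis. LINT t|lborel. g b t)"
    by (intro product_integral_prod gi finite_Basis)
  finally show "(LINT x|lborel. (\<Prod>i\<in>UNIV. f i ((x::real^'n) $ i))) = (\<Prod>i\<in>UNIV. LINT t|lborel. f i t)"
    by (simp add: prod_B g)
qed

text \<open>The comparison function is the product of the integrable functions 1 / (1 + t^2) over
  the coordinates. Each factor satisfies 1 + x_i^2 <= (1 + |x|)^2, which explains the exponent,
  twice the dimension.\<close>

lemma integrable_decay:
  fixes f :: "real^'n::finite \<Rightarrow> complex"
  assumes bound: "\<And>x. (1 + norm x) ^ (2 * CARD('n)) * norm (f x) \<le> B" and [measurable]: "f \<in> borel_measurable borel"
  shows "integrable lborel f"
proof -
  let ?w = "\<lambda>x::real^'n. \<Prod>i\<in>UNIV. inverse (1 + (x $ i)\<^sup>2)"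
  have i1: "integrable lborel (\<lambda>t::real. complex_of_real (inverse (1 + t\<^sup>2)))"
    using integrable_inverse_1_plus_square
    by (simp add: set_integrable_def einterval_def del: of_real_inverse)
  have "integrable lborel (\<lambda>x::real^'n. \<Prod>i\<in>UNIV. complex_of_real (inverse (1 + (x $ i)\<^sup>2)))"
    by (rule integrable_prod_cart[OF i1])
  hence "integrable lborel (\<lambda>x. of_real B * complex_of_real (?w x))" by (simp del: of_real_inverse)
  thus ?thesis
  proof (rule Bochner_Integration.integrable_bound)
    show "AE x in lborel. norm (f x) \<le> norm (of_real B * complex_of_real (?w x))"
    proof (rule AE_I2)
      fix x :: "real^'n"
      have "1 + (x $ i)\<^sup>2 \<le> (1 + norm x)\<^sup>2" for i
      proof -
        have "(x $ i)\<^sup>2 \<le> (norm x)\<^sup>2" using component_le_norm_cart[of x i] by (simp flip: abs_le_square_iff)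
        thus ?thesis using norm_ge_zero[of x] by (simp add: power2_eq_square algebra_simps del: norm_ge_zero)
      qed
      hence "(\<Prod>i\<in>UNIV. 1 + (x $ i)\<^sup>2) \<le> (\<Prod>i\<in>(UNIV::'n set). (1 + norm x)\<^sup>2)"
        by (intro prod_mono) auto
      hence le: "(\<Prod>i\<in>UNIV. 1 + (x $ i)\<^sup>2) \<le> (1 + norm x) ^ (2 * CARD('n))" by (simp add: power_mult)
      have pos: "(\<Prod>i\<in>UNIV. 1 + (x $ i)\<^sup>2) > 0" by (intro prod_pos) (auto intro: add_pos_nonneg)
      have "(\<Prod>i\<in>UNIV. 1 + (x $ i)\<^sup>2) * norm (f x) \<le> B"
        using mult_right_mono[OF le, of "norm (f x)"] bound[of x] by simp
      hence "norm (f x) \<le> B / (\<Prod>i\<in>UNIV. 1 + (x $ i)\<^sup>2)"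
        using pos by (simp add: field_simps)
      also have "\<dots> = B * ?w x" by (simp add: prod_inversef[symmetric] divide_inverse o_def)
      also have "\<dots> \<le> norm (of_real B * complex_of_real (?w x))"
        by (simp only: norm_of_real abs_ge_self flip: of_real_mult)
      finally show "norm (f x) \<le> norm (of_real B * complex_of_real (?w x))" .
    qed
  qed simp
qed

lemma integrable_rapid:
  fixes f :: "real^'n::finite \<Rightarrow> complex"
  assumes "rapid f" "f \<in> borel_measurable borel"
  shows "integrable lborel f"
  using assms integrable_decay rapidD by metis

lemma integrable_schwartz: "f \<in> schwartz \<Longrightarrow> integrable lborel f"
  by (rule integrable_rapid) (auto intro: schwartz_rapid schwartz_measurable)

lemma
  fixes f :: "real^'n::finite \<Rightarrow> complex"
  assumes c: "c \<noteq> 0" and f [measurable]: "f \<in> borel_measurable borel"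
  shows integral_lborel_affine:
      "(LINT x|lborel. f x) = \<bar>c\<bar> ^ CARD('n) *\<^sub>R (LINT x|lborel. f (a + c *\<^sub>R x))"
    and integrable_lborel_affine:
      "integrable lborel (\<lambda>x. f (a + c *\<^sub>R x)) \<longleftrightarrow> integrable lborel f"
proof -
  have m: "(\<lambda>x::real^'n. a + c *\<^sub>R x) \<in> measurable lborel borel" by measurable
  show "(LINT x|lborel. f x) = \<bar>c\<bar> ^ CARD('n) *\<^sub>R (LINT x|lborel. f (a + c *\<^sub>R x))"
    by (subst lborel_affine[OF c, of a]) (simp add: integral_density integral_distr[OF m])
  have sc: "integrable lborel (\<lambda>x. \<bar>c\<bar> ^ CARD('n) *\<^sub>R g x) \<longleftrightarrow> integrable lborel g"
    for g :: "real^'n \<Rightarrow> complex"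
    using integrable_scaleR_right[of "inverse (\<bar>c\<bar> ^ CARD('n))" lborel "\<lambda>x. \<bar>c\<bar> ^ CARD('n) *\<^sub>R g x"] c by auto
  show "integrable lborel (\<lambda>x. f (a + c *\<^sub>R x)) \<longleftrightarrow> integrable lborel f"
    by (subst (2) lborel_affine[OF c, of a]) (simp add: integrable_density integrable_distr_eq[OF m] sc)
qed

lemma integral_lborel_translate:
  fixes f :: "real^'n::finite \<Rightarrow> complex"
  assumes "f \<in> borel_measurable borel"
  shows "(LINT x|lborel. f (x + a)) = (LINT x|lborel. f x)"
  using integral_lborel_affine[of 1 f a] assms by (simp add: add.commute)

lemma integral_lborel_uminus:
  fixes f :: "real^'n::finite \<Rightarrow> complex"
  assumes "f \<in> borel_measurable borel"
  shows "(LINT x|lborel. f (- x)) = (LINT x|lborel. f x)"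
  using integral_lborel_affine[of "-1" f 0] assms by simp


section \<open>The Fourier transform on the Schwartz space\<close>

lemma integrable_iexp_mult:
  fixes f :: "real^'n::finite \<Rightarrow> complex"
  assumes "integrable lborel f"
  shows "integrable lborel (\<lambda>x. f x * iexp (x \<bullet> u))"
  using assms
proof (rule Bochner_Integration.integrable_bound)
  have [measurable]: "f \<in> borel_measurable borel" using borel_measurable_integrable[OF assms] by simp
  show "(\<lambda>x. f x * iexp (x \<bullet> u)) \<in> borel_measurable lborel" by measurable
qed (simp add: norm_mult)

lemma norm_fourier_le:
  fixes f :: "real^'n::finite \<Rightarrow> complex"
  shows "norm (fourier f u) \<le> (LINT x|lborel. norm (f x))"
  unfolding fourier_def by (rule integral_norm_bound[THEN order_trans]) (simp add: norm_mult)

lemma fourier_add: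
  assumes "integrable lborel f" "integrable lborel g"
  shows "fourier (\<lambda>x. f x + g x) u = fourier f u + fourier g u"
  using integrable_iexp_mult[OF assms(1)] integrable_iexp_mult[OF assms(2)]
  by (simp add: fourier_def distrib_right)

lemma fourier_cmult: "fourier (\<lambda>x. c * f x) u = c * fourier f u"
  by (simp add: fourier_def mult.assoc)

lemma rapid_power_norm: "rapid f \<Longrightarrow> rapid (\<lambda>x. of_real (norm x ^ m) * f x)"
  by (rule rapid_le[of f _ 1 m])
    (auto simp: norm_mult norm_power intro!: mult_right_mono power_mono)

lemma integrable_schwartz_power_norm:
  fixes f :: "real^'n::finite \<Rightarrow> complex"
  assumes f: "f \<in> schwartz"
  shows "integrable lborel (\<lambda>x. norm x ^ m * norm (f x))"
proof -
  have [measurable]: "f \<in> borel_measurable borel" by (rule schwartz_measurable[OF f])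
  have "integrable lborel (\<lambda>x. of_real (norm x ^ m) * f x)"
    by (intro integrable_rapid rapid_power_norm schwartz_rapid[OF f]) measurable
  thus ?thesis by (drule_tac integrable_norm) (simp add: norm_mult norm_power)
qed

text \<open>The first-order Taylor remainder of the exponential gives a pointwise error of at most
  |x|^2 |f x| |y - u|^2 / 2. Since the second moment of a Schwartz function is finite, the total
  error is at most \<open>?M\<close> |y - u|^2, which is o(|y - u|).\<close>

lemma fourier_has_derivative:
  fixes f :: "real^'n::finite \<Rightarrow> complex"
  assumes f: "f \<in> schwartz"
  shows "(fourier f has_derivative (\<lambda>h. \<Sum>k\<in>UNIV. h $ k *\<^sub>R fourier (\<lambda>x. \<i> * (of_real (x $ k) * f x)) u)) (at u)"
proof -
  let ?D = "\<lambda>h::real^'n. \<Sum>k\<in>UNIV. h $ k *\<^sub>R fourier (\<lambda>x. \<i> * (of_real (x $ k) * f x)) u"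
  let ?M = "(LINT x|lborel. norm x ^ 2 * norm (f x)) / 2"
  have fi: "integrable lborel f" by (rule integrable_schwartz[OF f])
  note i1 = integrable_iexp_mult[OF fi]
  have gi: "integrable lborel (\<lambda>x. \<i> * (of_real (x $ k) * f x))" for k
    by (intro integrable_schwartz schwartz_cmult schwartz_coord f)
  \<comment> \<open>Collecting the partial derivatives into one integral with the factor x \<bullet>
    h lets the remainder be estimated under a single integral sign.\<close>
  have D: "?D h = (LINT x|lborel. \<i> * of_real (x \<bullet> h) * f x * iexp (x \<bullet> u))" for h
  proof -
    have "?D h = (LINT x|lborel. (\<Sum>k\<in>UNIV. h $ k *\<^sub>R (\<i> * (of_real (x $ k) * f x) * iexp (x \<bullet> u))))"
      unfolding fourier_def by (subst Bochner_Integration.integral_sum)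
        (auto intro!: integrable_iexp_mult[OF gi])
    also have "\<dots> = (LINT x|lborel. \<i> * of_real (x \<bullet> h) * f x * iexp (x \<bullet> u))"
    proof (rule arg_cong[where f = "integral\<^sup>L lborel"], rule ext)
      fix x :: "real^'n"
      have "complex_of_real (x \<bullet> h) = (\<Sum>k\<in>UNIV. of_real (x $ k) * of_real (h $ k))"
        by (simp add: inner_vec_def)
      thus "(\<Sum>k\<in>UNIV. h $ k *\<^sub>R (\<i> * (of_real (x $ k) * f x) * iexp (x \<bullet> u))) =
        \<i> * of_real (x \<bullet> h) * f x * iexp (x \<bullet> u)"
        by (simp add: sum_distrib_left sum_distrib_right scaleR_conv_of_real mult_ac)
    qed
    finally show ?thesis .
  qed
  have Di: "integrable lborel (\<lambda>x. \<i> * of_real (x \<bullet> h) * f x * iexp (x \<bullet> u))" for h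
  proof -
    have "integrable lborel (\<lambda>x. (\<Sum>k\<in>UNIV. of_real (h $ k) * (\<i> * (of_real (x $ k) * f x))) * iexp (x \<bullet> u))"
      by (intro integrable_iexp_mult Bochner_Integration.integrable_sum integrable_mult_right gi)
    thus ?thesis
      by (simp add: inner_vec_def sum_distrib_left sum_distrib_right mult_ac)
  qed
  show ?thesis
  proof (rule has_derivativeI_sandwich[where e = 1])
    show "bounded_linear ?D"
      by (intro bounded_linear_sum bounded_linear_scaleR_const bounded_linear_vec_nth)
    show "((\<lambda>y. ?M * norm (y - u)) \<longlongrightarrow> 0) (at u)"
    proof -
      have "((\<lambda>y. ?M * norm (y - u)) \<longlongrightarrow> ?M * norm (u - u)) (at u)" by (intro tendsto_intros)
      thus ?thesis by simp
    qed
    fix y :: "real^'n" assume y: "y \<noteq> u"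
    let ?r = "\<lambda>x. f x * iexp (x \<bullet> y) - f x * iexp (x \<bullet> u) - \<i> * of_real (x \<bullet> (y - u)) * f x * iexp (x \<bullet> u)"
    have "norm (?r x) \<le> norm x ^ 2 * norm (f x) * ((norm (y - u))\<^sup>2 / 2)" for x
    proof -
      have "?r x = f x * iexp (x \<bullet> u) * (iexp (x \<bullet> (y - u)) - (\<Sum>k\<le>1. (\<i> * of_real (x \<bullet> (y - u))) ^ k / fact k))"
      proof -
        have "iexp (x \<bullet> u) * iexp (x \<bullet> (y - u)) = iexp (x \<bullet> y)"
          by (simp add: exp_add[symmetric] inner_diff_right algebra_simps)
        thus ?thesis by (simp add: algebra_simps)
      qed
      hence "norm (?r x) \<le> norm (f x) * (\<bar>x \<bullet> (y - u)\<bar> ^ Suc 1 / fact (Suc 1))"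
        by (simp only: norm_mult norm_exp_i_times mult_1_right)
          (intro mult_left_mono iexp_approx1 norm_ge_zero)
      also have "\<dots> \<le> norm (f x) * ((norm x * norm (y - u)) ^ Suc 1 / fact (Suc 1))"
        by (intro mult_left_mono divide_right_mono power_mono Cauchy_Schwarz_ineq2) auto
      finally show ?thesis by (simp add: power_mult_distrib mult_ac power2_eq_square)
    qed note le = this
    have "fourier f y - fourier f u - ?D (y - u) = (LINT x|lborel. ?r x)"
      unfolding D unfolding fourier_def
      by (simp only: Bochner_Integration.integral_diff[OF Bochner_Integration.integrable_diff[OF i1 i1] Di]
        Bochner_Integration.integral_diff[OF i1 i1])
    hence "norm (fourier f y - fourier f u - ?D (y - u)) \<le> (LINT x|lborel. norm (?r x))"
      by (simp only: integral_norm_bound)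
    also have "\<dots> \<le> (LINT x|lborel. norm x ^ 2 * norm (f x) * ((norm (y - u))\<^sup>2 / 2))"
      by (rule integral_mono)
        (auto intro!: integrable_norm Bochner_Integration.integrable_diff integrable_iexp_mult[OF fi] Di
          integrable_schwartz_power_norm f le simp del: times_divide_eq_right)
    also have "\<dots> = ?M * (norm (y - u))\<^sup>2" by simp
    finally show "norm (fourier f y - fourier f u - ?D (y - u)) / norm (y - u) \<le> ?M * norm (y - u)"
      using y by (simp add: divide_le_eq power2_eq_square mult_ac)
  qed simp
qed

lemma fourier_differentiable: "f \<in> schwartz \<Longrightarrow> fourier f differentiable at u"
  using fourier_has_derivative differentiable_def by blast

lemma pderiv1_fourier:
  assumes f: "f \<in> schwartz"
  shows "pderiv1 k (fourier f) = fourier (\<lambda>x. \<i> * (of_real (x $ k) * f x))"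
proof
  fix u
  show "pderiv1 k (fourier f) u = fourier (\<lambda>x. \<i> * (of_real (x $ k) * f x)) u"
    by (rule pderiv1_eqI[OF fourier_has_derivative[OF f]]) (rule sum_axis_scaleR)
qed

section \<open>Translations and derivatives under the Fourier transform\<close>

lemma fourier_translate:
  fixes f :: "real^'n::finite \<Rightarrow> complex"
  assumes [measurable]: "f \<in> borel_measurable borel"
  shows "fourier (\<lambda>x. f (x + a)) u = iexp (- (a \<bullet> u)) * fourier f u"
proof -
  have "fourier (\<lambda>x. f (x + a)) u = (LINT x|lborel. (\<lambda>x. iexp (- (a \<bullet> u)) * (f x * iexp (x \<bullet> u))) (x + a))"
    unfolding fourier_def
    by (rule arg_cong[where f = "integral\<^sup>L lborel"])
      (simp add: fun_eq_iff inner_add_left algebra_simps flip: exp_add)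
  also have "\<dots> = (LINT x|lborel. iexp (- (a \<bullet> u)) * (f x * iexp (x \<bullet> u)))"
    by (rule integral_lborel_translate) measurable
  finally show ?thesis by (simp add: fourier_def)
qed

text \<open>This is the dominating function for difference quotients. By the mean value inequality
  it suffices to bound the derivative on a segment of length at most 1, where 1 + |x| is at most
  twice 1 + |y|; hence the factor \<open>2 ^ k\<close>. The choice of \<open>k\<close> as twice the
  dimension makes \<open>g\<close> integrable.\<close>

lemma schwartz_difference_bound:
  fixes f :: "real^'n::finite \<Rightarrow> complex"
  assumes f: "f \<in> schwartz"
  obtains g where "integrable lborel g"
    "\<And>x t. 0 < t \<Longrightarrow> t \<le> 1 \<Longrightarrow> norm (f (x + t *\<^sub>R axis j 1) - f x) \<le> t * g x"
proof -
  define k where "k = 2 * CARD('n)"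
  obtain B where B: "B > 0" "\<And>x. (1 + norm x) ^ k * norm (pderiv1 j f x) \<le> B"
    using rapidD[OF schwartz_rapid[OF schwartz_pderiv1[OF f]]] by blast
  define g where "g x = B * 2 ^ k * inverse ((1 + norm x) ^ k)" for x :: "real^'n"
  have w1: "(1 + norm x) ^ k * norm (complex_of_real (inverse ((1 + norm x) ^ k))) \<le> 1" for x :: "real^'n"
  proof -
    have "(1 + norm x) ^ k > 0" by (intro zero_less_power) (simp add: add_pos_nonneg)
    thus ?thesis by (simp only: norm_of_real abs_inverse abs_of_pos right_inverse less_imp_neq[symmetric] simp_thms)
  qed
  have "integrable lborel (\<lambda>x::real^'n. complex_of_real (inverse ((1 + norm x) ^ k)))"
    by (rule integrable_decay[OF w1[unfolded k_def], folded k_def]) measurable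
  hence gi: "integrable lborel g" unfolding g_def
    by (intro integrable_mult_right) (simp only: complex_of_real_integrable_eq)
  have "norm (f (x + t *\<^sub>R axis j 1) - f x) \<le> t * g x" if t: "0 < t" "t \<le> 1" for x t
  proof -
    have d: "((\<lambda>s. f (x + s *\<^sub>R axis j 1)) has_derivative (\<lambda>h. h *\<^sub>R pderiv1 j f (x + s *\<^sub>R axis j 1))) (at s within {0..t})" for s
      using has_vector_derivative_along_axis[OF schwartz_differentiable[OF f]]
      by (simp add: has_vector_derivative_def)
    have "norm (f (x + t *\<^sub>R axis j 1) - f (x + 0 *\<^sub>R axis j 1)) \<le> g x * norm (t - 0)"
    proof (rule differentiable_bound[OF _ d])
      fix s assume s: "s \<in> {0..t}"
      let ?y = "x + s *\<^sub>R axis j 1"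
      have "norm x \<le> norm ?y + norm (s *\<^sub>R (axis j 1 :: real^'n))"
        by (metis add_diff_cancel_right' norm_triangle_ineq4)
      moreover have "norm (s *\<^sub>R (axis j 1 :: real^'n)) \<le> 1" using s t by (simp add: norm_axis_1)
      ultimately have "1 + norm x \<le> 2 * (1 + norm ?y)" using norm_ge_zero[of ?y] by argo
      hence "(1 + norm x) ^ k \<le> 2 ^ k * (1 + norm ?y) ^ k"
        using power_mono[of "1 + norm x" "2 * (1 + norm ?y)" k] by (simp only: power_mult_distrib) simp
      hence "(1 + norm x) ^ k * norm (pderiv1 j f ?y) \<le> 2 ^ k * (1 + norm ?y) ^ k * norm (pderiv1 j f ?y)"
        by (rule mult_right_mono) simp
      also have "\<dots> \<le> 2 ^ k * B" using mult_left_mono[OF B(2)[of ?y], of "2 ^ k"] by (simp add: mult.assoc)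
      finally have "norm (pderiv1 j f ?y) * (1 + norm x) ^ k \<le> B * 2 ^ k" by (simp add: mult.commute)
      moreover have "(1 + norm x) ^ k > 0" by (simp add: add_pos_nonneg)
      ultimately have "norm (pderiv1 j f ?y) \<le> g x" unfolding g_def by (simp add: field_simps)
      thus "onorm (\<lambda>h. h *\<^sub>R pderiv1 j f ?y) \<le> g x"
        by (subst onorm_scaleR_left) (auto simp: onorm_id)
    qed (use t in auto)
    thus ?thesis using t by (simp add: mult.commute)
  qed
  with gi show thesis using that by blast
qed

lemma has_vector_derivative_quotient:
  assumes "(f has_vector_derivative D) (at x)"
  shows "((\<lambda>s. inverse s *\<^sub>R (f (x + s) - f x)) \<longlongrightarrow> D) (at 0)"
proof -
  have "((\<lambda>s. norm (f (x + s) - f x - s *\<^sub>R D) / norm s) \<longlongrightarrow> 0) (at 0)"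
    using assms unfolding has_vector_derivative_def has_derivative_at by blast
  moreover have "\<forall>\<^sub>F s in at 0. norm (f (x + s) - f x - s *\<^sub>R D) / norm s = norm (inverse s *\<^sub>R (f (x + s) - f x) - D)"
  proof (rule eventually_at_filter[THEN iffD2], rule always_eventually, intro allI impI)
    fix s :: real assume "s \<noteq> 0"
    hence "inverse s *\<^sub>R (f (x + s) - f x) - D = inverse s *\<^sub>R (f (x + s) - f x - s *\<^sub>R D)"
      by (simp add: algebra_simps)
    thus "norm (f (x + s) - f x - s *\<^sub>R D) / norm s = norm (inverse s *\<^sub>R (f (x + s) - f x) - D)"
      by (simp add: divide_inverse mult.commute)
  qed
  ultimately have "((\<lambda>s. norm (inverse s *\<^sub>R (f (x + s) - f x) - D)) \<longlongrightarrow> 0) (at 0)"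
    by (rule Lim_transform_eventually)
  from LIM_zero_cancel[OF tendsto_norm_zero_cancel[OF this]] show ?thesis .
qed

text \<open>Difference quotients replace integration by parts. Translating by t along axis j
  multiplies the transform by exp(-i t u_j), so the transformed quotient tends to the derivative of
  this exponential at t = 0 times the transform of f; dominated convergence identifies the same
  limit with the transform of the derivative.\<close>

lemma fourier_pderiv1:
  fixes f :: "real^'n::finite \<Rightarrow> complex"
  assumes f: "f \<in> schwartz"
  shows "fourier (pderiv1 j f) u = - (\<i> * of_real (u $ j)) * fourier f u"
proof -
  have [measurable]: "f \<in> borel_measurable borel" "pderiv1 j f \<in> borel_measurable borel"
    by (intro schwartz_measurable schwartz_pderiv1 f)+
  obtain g where g: "integrable lborel g"
    "\<And>x t. 0 < t \<Longrightarrow> t \<le> 1 \<Longrightarrow> norm (f (x + t *\<^sub>R axis j 1) - f x) \<le> t * g x"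
    using schwartz_difference_bound[OF f] by blast
  \<comment> \<open>The steps stay in the interval (0, 1], where the bound by \<open>g\<close> is
    available.\<close>
  define t where "t m = inverse (real (Suc m))" for m
  have t: "0 < t m" "t m \<le> 1" for m by (auto simp: t_def field_simps)
  have t0: "filterlim t (at 0) sequentially"
    unfolding filterlim_at using t LIMSEQ_inverse_real_of_nat by (auto simp: t_def[abs_def])
  let ?q = "\<lambda>m x. inverse (t m) *\<^sub>R (f (x + t m *\<^sub>R axis j 1) - f x)"
  have "(\<lambda>m. LINT x|lborel. ?q m x * iexp (x \<bullet> u)) \<longlonglongrightarrow> (LINT x|lborel. pderiv1 j f x * iexp (x \<bullet> u))"
  proof (rule integral_dominated_convergence[of _ _ _ g])
    show "AE x in lborel. (\<lambda>m. ?q m x * iexp (x \<bullet> u)) \<longlonglongrightarrow> pderiv1 j f x * iexp (x \<bullet> u)"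
    proof (rule AE_I2, rule tendsto_mult_right)
      fix x
      have "((\<lambda>s. f (x + s *\<^sub>R axis j 1)) has_vector_derivative pderiv1 j f x) (at 0)"
        using has_vector_derivative_along_axis[OF schwartz_differentiable[OF f], where x = x and s = 0 and j = j] by simp
      hence "((\<lambda>s. inverse s *\<^sub>R (f (x + s *\<^sub>R axis j 1) - f x)) \<longlongrightarrow> pderiv1 j f x) (at 0)"
        by (drule_tac has_vector_derivative_quotient) simp
      thus "(\<lambda>m. ?q m x) \<longlonglongrightarrow> pderiv1 j f x"
        by (rule filterlim_compose[OF _ t0])
    qed
    show "AE x in lborel. norm (?q m x * iexp (x \<bullet> u)) \<le> g x" for m
    proof (rule AE_I2)
      fix x
      have "inverse (t m) * norm (f (x + t m *\<^sub>R axis j 1) - f x) \<le> inverse (t m) * (t m * g x)"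
        by (intro mult_left_mono g t less_imp_le positive_imp_inverse_positive)
      also have "\<dots> = g x" using t(1)[of m] by simp
      finally show "norm (?q m x * iexp (x \<bullet> u)) \<le> g x" using t(1)[of m] by (simp add: norm_mult)
    qed
    show "integrable lborel g" by fact
  qed measurable
  moreover have "(LINT x|lborel. ?q m x * iexp (x \<bullet> u)) =
      inverse (t m) *\<^sub>R (iexp (- (t m * u $ j)) - 1) * fourier f u" for m
  proof -
    have "integrable lborel (\<lambda>x. f (x + t m *\<^sub>R axis j 1))"
      by (intro integrable_schwartz schwartz_translate f)
    hence "(LINT x|lborel. ?q m x * iexp (x \<bullet> u)) =
        inverse (t m) *\<^sub>R (fourier (\<lambda>x. f (x + t m *\<^sub>R axis j 1)) u - fourier f u)"
      using integrable_schwartz[OF f]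
      by (simp add: fourier_def left_diff_distrib integrable_iexp_mult flip: integral_diff)
    also have "fourier (\<lambda>x. f (x + t m *\<^sub>R axis j 1)) u = iexp (- (t m * u $ j)) * fourier f u"
      by (subst fourier_translate) (auto simp: inner_axis')
    finally show ?thesis by (simp add: algebra_simps)
  qed
  moreover have "(\<lambda>m. inverse (t m) *\<^sub>R (iexp (- (t m * u $ j)) - 1) * fourier f u) \<longlonglongrightarrow>
      - (\<i> * of_real (u $ j)) * fourier f u"
  proof (rule tendsto_mult_right)
    have "((\<lambda>s. iexp (- (s * u $ j))) has_vector_derivative - (\<i> * of_real (u $ j))) (at 0)"
      by (auto intro!: derivative_eq_intros has_vector_derivative_real_field)
    hence "((\<lambda>s. inverse s *\<^sub>R (iexp (- (s * u $ j)) - 1)) \<longlongrightarrow> - (\<i> * of_real (u $ j))) (at 0)"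
      by (drule_tac has_vector_derivative_quotient) simp
    thus "(\<lambda>m. inverse (t m) *\<^sub>R (iexp (- (t m * u $ j)) - 1)) \<longlonglongrightarrow> - (\<i> * of_real (u $ j))"
      by (rule filterlim_compose[OF _ t0])
  qed
  ultimately show ?thesis
    unfolding fourier_def[of "pderiv1 j f"] by (simp only: LIMSEQ_unique)
qed

text \<open>One more power of 1 + |u| is dominated by 1 plus the sum of the |u_j|, and |u_j| times
  the transform of f is in modulus the transform of a derivative of f. The induction therefore has
  to run over all Schwartz functions simultaneously.\<close>

lemma fourier_rapid:
  fixes f :: "real^'n::finite \<Rightarrow> complex"
  assumes "f \<in> schwartz"
  shows "rapid (fourier f)"
  unfolding rapid_def
proof
  fix k
  show "\<exists>B. \<forall>u. (1 + norm u) ^ k * norm (fourier f u) \<le> B"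
    using assms
  proof (induction k arbitrary: f)
    case 0
    show ?case using norm_fourier_le[of f] by auto
  next
    case (Suc k)
    obtain B where B: "\<And>u. (1 + norm u) ^ k * norm (fourier f u) \<le> B" using Suc by blast
    have "\<exists>C. \<forall>u. (1 + norm u) ^ k * norm (fourier (pderiv1 j f) u) \<le> C" for j
      using Suc.IH[OF schwartz_pderiv1[OF Suc.prems]] .
    then obtain C where C: "\<And>j u. (1 + norm u) ^ k * norm (fourier (pderiv1 j f) u) \<le> C j" by metis
    have "(1 + norm u) ^ Suc k * norm (fourier f u) \<le> B + (\<Sum>j\<in>UNIV. C j)" for u
    proof -
      have "(1 + norm u) * norm (fourier f u) \<le> (1 + (\<Sum>j\<in>UNIV. \<bar>u $ j\<bar>)) * norm (fourier f u)"
        by (intro mult_right_mono add_left_mono norm_le_l1_cart norm_ge_zero)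
      also have "\<dots> = norm (fourier f u) + (\<Sum>j\<in>UNIV. norm (fourier (pderiv1 j f) u))"
        by (simp add: fourier_pderiv1[OF Suc.prems] norm_mult distrib_right sum_distrib_right)
      finally have "(1 + norm u) ^ k * ((1 + norm u) * norm (fourier f u)) \<le>
          (1 + norm u) ^ k * (norm (fourier f u) + (\<Sum>j\<in>UNIV. norm (fourier (pderiv1 j f) u)))"
        by (intro mult_left_mono) auto
      also have "\<dots> \<le> B + (\<Sum>j\<in>UNIV. C j)"
        unfolding distrib_left sum_distrib_left by (intro add_mono sum_mono B C)
      finally show ?thesis by (simp add: mult_ac)
    qed
    thus ?case by blast
  qed
qed

lemma schwartz_fourier:
  fixes f :: "real^'n::finite \<Rightarrow> complex"
  assumes "f \<in> schwartz"
  shows "fourier f \<in> schwartz"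
proof (rule schwartz_coinduct[of _ "fourier ` schwartz"])
  fix h i assume "h \<in> fourier ` (schwartz :: (real^'n \<Rightarrow> complex) set)"
  then obtain f where h: "h = fourier f" "f \<in> schwartz" by blast
  show "pderiv1 i h \<in> fourier ` schwartz"
    unfolding h pderiv1_fourier[OF h(2)] by (intro imageI schwartz_cmult schwartz_coord h)
qed (use assms in \<open>auto intro: fourier_differentiable fourier_rapid\<close>)

lemma fourier_measurable [measurable]:
  fixes f :: "real^'n::finite \<Rightarrow> complex"
  assumes [measurable]: "f \<in> borel_measurable borel"
  shows "fourier f \<in> borel_measurable borel"
  unfolding fourier_def by measurable

text \<open>Fubini's theorem for f(x) g(u) exp(i x \<bullet> u). The kernel is symmetric, so the
  transform is its own transpose; this is what makes its extension to distributions by duality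
  consistent.\<close>

lemma fourier_multiplication:
  fixes f g :: "real^'n::finite \<Rightarrow> complex"
  assumes f: "integrable lborel f" and g: "integrable lborel g"
  shows "(LINT u|lborel. fourier f u * g u) = (LINT x|lborel. f x * fourier g x)"
proof -
  have [measurable]: "f \<in> borel_measurable borel" "g \<in> borel_measurable borel"
    using f g borel_measurable_integrable by force+
  let ?F = "\<lambda>x u. f x * g u * iexp (x \<bullet> u)"
  have m: "case_prod ?F \<in> borel_measurable (lborel \<Otimes>\<^sub>M lborel)"
  proof -
    have "(\<lambda>p :: (real^'n) \<times> (real^'n). f (fst p) * g (snd p) * iexp (fst p \<bullet> snd p)) \<in> borel_measurable (borel \<Otimes>\<^sub>M borel)"
      by measurable
    moreover have "sets (lborel \<Otimes>\<^sub>M lborel) = sets ((borel :: (real^'n) measure) \<Otimes>\<^sub>M (borel :: (real^'n) measure))"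
      by (intro sets_pair_measure_cong) auto
    ultimately show ?thesis by (simp add: case_prod_beta' cong: measurable_cong_sets)
  qed
  have "integrable (lborel \<Otimes>\<^sub>M lborel) (case_prod ?F)"
  proof (rule lborel_pair.Fubini_integrable[OF m])
    show "integrable lborel (\<lambda>x. LINT u|lborel. norm (case_prod ?F (x, u)))"
      using f g by (simp add: norm_mult)
    have "integrable lborel (\<lambda>u. ?F x u)" for x
      using integrable_mult_right[OF integrable_iexp_mult[OF g, of x], of "f x"]
      by (simp add: inner_commute mult.assoc)
    thus "AE x in lborel. integrable lborel (\<lambda>u. case_prod ?F (x, u))" by simp
  qed
  from lborel_pair.Fubini_integral[OF this]
  have "(LINT u|lborel. LINT x|lborel. ?F x u) = (LINT x|lborel. LINT u|lborel. ?F x u)" .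
  moreover have "(LINT x|lborel. ?F x u) = fourier f u * g u" for u
    unfolding fourier_def integral_mult_left_zero[symmetric] by (simp add: mult_ac)
  moreover have "(LINT u|lborel. ?F x u) = f x * fourier g x" for x
    unfolding fourier_def integral_mult_right_zero[symmetric] by (simp add: inner_commute mult_ac)
  ultimately show ?thesis by simp
qed

subsection \<open>The Gaussian and the inversion formula\<close>

definition gaussian :: "real^'n::finite \<Rightarrow> complex" where
  "gaussian x = of_real (exp (- (norm x)\<^sup>2 / 2))"

lemma gaussian_eq_prod: "gaussian x = (\<Prod>i\<in>UNIV. of_real (exp (- (x $ i)\<^sup>2 / 2)))"
proof -
  have "(norm x)\<^sup>2 = (\<Sum>i\<in>UNIV. (x $ i)\<^sup>2)"
    unfolding power2_norm_eq_inner inner_vec_def by (simp add: power2_eq_square)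
  hence "- (norm x)\<^sup>2 / 2 = (\<Sum>i\<in>UNIV. - (x $ i)\<^sup>2 / 2)" by (simp add: sum_negf sum_divide_distrib)
  thus ?thesis by (simp only: gaussian_def exp_sum[OF finite] of_real_prod)
qed

lemma gaussian_measurable [measurable]: "gaussian \<in> borel_measurable borel"
  unfolding gaussian_def[abs_def] by measurable

text \<open>Up to the normalising factor sqrt(2 pi), the integrand is the standard normal density
  and the integral its characteristic function.\<close>

lemma
  shows integrable_gaussian_line: "integrable lborel (\<lambda>t. complex_of_real (exp (- t\<^sup>2 / 2)))"
    and fourier_gaussian_line:
      "(LINT t|lborel. complex_of_real (exp (- t\<^sup>2 / 2)) * iexp (t * s)) =
        of_real (sqrt (2 * pi) * exp (- s\<^sup>2 / 2))"
proof -
  have e: "complex_of_real (exp (- t\<^sup>2 / 2)) = of_real (sqrt (2 * pi)) * of_real (std_normal_density t)" for t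
    by (simp only: std_normal_density_def of_real_mult[symmetric]) simp
  have "integrable lborel std_normal_density" by simp
  thus "integrable lborel (\<lambda>t. complex_of_real (exp (- t\<^sup>2 / 2)))"
    unfolding e by (intro integrable_mult_right) (simp only: complex_of_real_integrable_eq)
  have "(LINT t|lborel. std_normal_density t *\<^sub>R iexp (s * t)) = char std_normal_distribution s"
    unfolding char_def by (subst integral_density) auto
  also have "\<dots> = of_real (exp (- s\<^sup>2 / 2))" by (simp only: char_std_normal_distribution)
  finally have *: "(LINT t|lborel. std_normal_density t *\<^sub>R iexp (s * t)) = of_real (exp (- s\<^sup>2 / 2))" .
  have "(LINT t|lborel. complex_of_real (exp (- t\<^sup>2 / 2)) * iexp (t * s)) =
      (LINT t|lborel. of_real (sqrt (2 * pi)) * (std_normal_density t *\<^sub>R iexp (s * t)))"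
    unfolding e by (simp add: scaleR_conv_of_real mult_ac)
  also have "\<dots> = of_real (sqrt (2 * pi)) * of_real (exp (- s\<^sup>2 / 2))"
    by (simp only: integral_mult_right_zero *)
  finally show "(LINT t|lborel. complex_of_real (exp (- t\<^sup>2 / 2)) * iexp (t * s)) =
        of_real (sqrt (2 * pi) * exp (- s\<^sup>2 / 2))" by (simp only: of_real_mult)
qed

lemma integrable_gaussian: "integrable lborel (gaussian :: real^'n::finite \<Rightarrow> complex)"
  unfolding gaussian_eq_prod[abs_def] by (rule integrable_prod_cart[OF integrable_gaussian_line])

lemma fourier_gaussian:
  "fourier gaussian (u :: real^'n::finite) = of_real (sqrt (2 * pi) ^ CARD('n)) * gaussian u"
proof -
  have "gaussian x * iexp (x \<bullet> u) = (\<Prod>i\<in>UNIV. of_real (exp (- (x $ i)\<^sup>2 / 2)) * iexp (x $ i * u $ i))" for x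
    by (simp add: gaussian_eq_prod prod.distrib inner_vec_def sum_distrib_left exp_sum)
  hence "fourier gaussian u = (LINT x|lborel. (\<Prod>i\<in>UNIV. of_real (exp (- (x $ i)\<^sup>2 / 2)) * iexp (x $ i * u $ i)))"
    by (simp only: fourier_def)
  also have "\<dots> = (\<Prod>i\<in>UNIV. LINT t|lborel. of_real (exp (- t\<^sup>2 / 2)) * iexp (t * u $ i))"
  proof (rule integral_prod_cart)
    fix i
    show "integrable lborel (\<lambda>t. complex_of_real (exp (- t\<^sup>2 / 2)) * iexp (t * u $ i))"
      using integrable_gaussian_line
      by (rule Bochner_Integration.integrable_bound) (auto simp: norm_mult)
  qed
  also have "\<dots> = (\<Prod>i\<in>UNIV. of_real (sqrt (2 * pi) * exp (- (u $ i)\<^sup>2 / 2)))"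
    by (simp only: fourier_gaussian_line)
  finally show ?thesis
    by (simp only: gaussian_eq_prod of_real_mult prod.distrib prod_constant of_real_power)
qed

text \<open>The integral of the Gaussian is its transform at 0, which gives one factor sqrt(2 pi)^n;
  transforming gives another. Their product is the constant of the inversion formula.\<close>

lemma integral_fourier_gaussian:
  "(LINT u|lborel. fourier gaussian (u :: real^'n::finite)) = of_real ((2 * pi) ^ CARD('n))"
proof -
  have "fourier (gaussian :: real^'n \<Rightarrow> complex) 0 = of_real (sqrt (2 * pi) ^ CARD('n))"
    by (simp add: fourier_gaussian) (simp add: gaussian_def)
  hence "(LINT u|lborel. gaussian (u :: real^'n)) = of_real (sqrt (2 * pi) ^ CARD('n))"
    by (simp add: fourier_def)
  hence "(LINT u|lborel. fourier gaussian (u :: real^'n)) =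
      of_real (sqrt (2 * pi) ^ CARD('n) * sqrt (2 * pi) ^ CARD('n))"
    by (simp only: fourier_gaussian integral_mult_right_zero of_real_mult)
  also have "sqrt (2 * pi) ^ CARD('n) * sqrt (2 * pi) ^ CARD('n) = (2 * pi) ^ CARD('n)"
    by (simp only: power_mult_distrib[symmetric] real_sqrt_mult_self) simp
  finally show ?thesis .
qed

text \<open>Inversion at the origin by Gaussian regularisation. The transform of f is damped by the
  dilated Gaussian G(e u); the multiplication formula moves the transform onto the Gaussian, and the
  substitution x = e y turns the result into the integral of f(e y) times the transform of G.
  Letting e tend to 0 in both expressions gives the claim.\<close>

lemma integral_fourier:
  fixes f :: "real^'n::finite \<Rightarrow> complex"
  assumes f: "f \<in> schwartz"
  shows "(LINT u|lborel. fourier f u) = of_real ((2 * pi) ^ CARD('n)) * f 0"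
proof -
  let ?n = "CARD('n)"
  let ?G = "gaussian :: real^'n \<Rightarrow> complex"
  have [measurable]: "f \<in> borel_measurable borel" by (rule schwartz_measurable[OF f])
  have fi: "integrable lborel f" by (rule integrable_schwartz[OF f])
  have Fi: "integrable lborel (fourier f)" by (intro integrable_schwartz schwartz_fourier f)
  obtain M where M: "M > 0" "\<And>x. (1 + norm x) ^ 0 * norm (f x) \<le> M"
    using rapidD[OF schwartz_rapid[OF f]] by blast
  define e where "e m = inverse (real (Suc m))" for m
  have e: "e m > 0" for m by (simp add: e_def)
  have e0: "e \<longlonglongrightarrow> 0" using LIMSEQ_inverse_real_of_nat by (simp add: e_def[abs_def])
  have FG: "integrable lborel (fourier ?G)"
    unfolding fourier_gaussian[abs_def] by (intro integrable_mult_right integrable_gaussian)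
  have scale: "(LINT u|lborel. fourier f u * ?G (e m *\<^sub>R u)) = (LINT y|lborel. f (e m *\<^sub>R y) * fourier ?G y)" for m
  proof -
    let ?Ge = "\<lambda>u. ?G (e m *\<^sub>R u)"
    have Ge: "integrable lborel ?Ge"
      using integrable_lborel_affine[of "e m" ?G 0] e[of m] integrable_gaussian by simp
    \<comment> \<open>Dilating the Gaussian by e dilates its transform by 1/e and divides it by e^n,
      which cancels the Jacobian of the substitution x = e y.\<close>
    have F: "(e m) ^ ?n *\<^sub>R fourier ?Ge (e m *\<^sub>R y) = fourier ?G y" for y
    proof -
      have "fourier ?G y = \<bar>e m\<bar> ^ ?n *\<^sub>R (LINT u|lborel. ?G (0 + e m *\<^sub>R u) * iexp ((0 + e m *\<^sub>R u) \<bullet> y))"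
        unfolding fourier_def
        using integral_lborel_affine[of "e m" "\<lambda>u. ?G u * iexp (u \<bullet> y)" 0] e[of m] by simp
      thus ?thesis using e[of m] by (simp add: fourier_def)
    qed
    have "(LINT u|lborel. fourier f u * ?Ge u) = (LINT x|lborel. f x * fourier ?Ge x)"
      by (rule fourier_multiplication[OF fi Ge])
    also have "\<dots> = \<bar>e m\<bar> ^ ?n *\<^sub>R (LINT y|lborel. f (0 + e m *\<^sub>R y) * fourier ?Ge (0 + e m *\<^sub>R y))"
      by (rule integral_lborel_affine) (use e[of m] in \<open>auto intro!: borel_measurable_times fourier_measurable\<close>)
    also have "\<dots> = (LINT y|lborel. f (e m *\<^sub>R y) * (e m ^ ?n *\<^sub>R fourier ?Ge (e m *\<^sub>R y)))"
      using e[of m] by simp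
    finally show ?thesis unfolding F .
  qed
  have "(\<lambda>m. LINT u|lborel. fourier f u * ?G (e m *\<^sub>R u)) \<longlonglongrightarrow> (LINT u|lborel. fourier f u)"
  proof (rule integral_dominated_convergence[of _ _ _ "\<lambda>u. norm (fourier f u)"])
    show "AE u in lborel. (\<lambda>m. fourier f u * ?G (e m *\<^sub>R u)) \<longlonglongrightarrow> fourier f u"
    proof (rule AE_I2)
      fix u
      have "(\<lambda>m. fourier f u * ?G (e m *\<^sub>R u)) \<longlonglongrightarrow> fourier f u * of_real (exp (- (norm (0 *\<^sub>R u))\<^sup>2 / 2))"
        unfolding gaussian_def by (intro tendsto_intros e0) auto
      thus "(\<lambda>m. fourier f u * ?G (e m *\<^sub>R u)) \<longlonglongrightarrow> fourier f u" by simp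
    qed
    show "AE u in lborel. norm (fourier f u * ?G (e m *\<^sub>R u)) \<le> norm (fourier f u)" for m
      by (rule AE_I2) (simp add: norm_mult gaussian_def mult_left_le)
    show "integrable lborel (\<lambda>u. norm (fourier f u))" using Fi by simp
  qed measurable
  moreover have "(\<lambda>m. LINT y|lborel. f (e m *\<^sub>R y) * fourier ?G y) \<longlonglongrightarrow> (LINT y|lborel. f 0 * fourier ?G y)"
  proof (rule integral_dominated_convergence[of _ _ _ "\<lambda>y. M * norm (fourier ?G y)"])
    show "AE y in lborel. (\<lambda>m. f (e m *\<^sub>R y) * fourier ?G y) \<longlonglongrightarrow> f 0 * fourier ?G y"
    proof (rule AE_I2, rule tendsto_mult_right)
      fix y :: "real^'n"
      have "(\<lambda>m. e m *\<^sub>R y) \<longlonglongrightarrow> 0 *\<^sub>R y" by (rule tendsto_scaleR[OF e0 tendsto_const])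
      thus "(\<lambda>m. f (e m *\<^sub>R y)) \<longlonglongrightarrow> f 0"
        using isCont_tendsto_compose[OF differentiable_imp_continuous_within[OF schwartz_differentiable[OF f]]]
        by simp
    qed
    show "AE y in lborel. norm (f (e m *\<^sub>R y) * fourier ?G y) \<le> M * norm (fourier ?G y)" for m
      by (rule AE_I2) (use M(2) in \<open>auto simp: norm_mult intro!: mult_right_mono\<close>)
    show "integrable lborel (\<lambda>y. M * norm (fourier ?G y))" using FG by simp
  qed measurable
  ultimately have "(LINT u|lborel. fourier f u) = (LINT y|lborel. f 0 * fourier ?G y)"
    unfolding scale by (rule LIMSEQ_unique)
  also have "\<dots> = f 0 * of_real ((2 * pi) ^ ?n)"
    by (simp only: integral_mult_right_zero integral_fourier_gaussian)
  finally show ?thesis by (simp only: mult.commute)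
qed

text \<open>Multiplying a transform by exp(i x \<bullet> u) corresponds to translating the function
  by -x, so the formula at the origin suffices. The reflection appears because both transforms carry
  the same sign in the exponent.\<close>

theorem fourier_inversion:
  fixes f :: "real^'n::finite \<Rightarrow> complex"
  assumes f: "f \<in> schwartz"
  shows "fourier (fourier f) x = of_real ((2 * pi) ^ CARD('n)) * f (- x)"
proof -
  have "fourier (fourier f) x = (LINT u|lborel. fourier (\<lambda>y. f (y + (- x))) u)"
    by (subst fourier_translate[OF schwartz_measurable[OF f]]) (simp add: fourier_def inner_commute mult.commute)
  also have "\<dots> = of_real ((2 * pi) ^ CARD('n)) * f (- x)"
    by (subst integral_fourier[OF schwartz_translate[OF f]]) simp
  finally show ?thesis .
qed

text \<open>The last conclusion has the shape of \<open>W_fourier_test\<close>: the transform is the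
  constant times the reflected inverse transform.\<close>

corollary fourier_surj:
  fixes f :: "real^'n::finite \<Rightarrow> complex"
  assumes f: "f \<in> schwartz"
  obtains g where "g \<in> schwartz" "fourier g = f" "\<And>x. fourier f x = of_real ((2 * pi) ^ CARD('n)) * g (- x)"
proof -
  let ?c = "complex_of_real ((2 * pi) ^ CARD('n))"
  let ?g = "\<lambda>x. inverse ?c * fourier f (- x)"
  have c: "?c \<noteq> 0" by simp
  have F: "fourier f \<in> schwartz" by (rule schwartz_fourier[OF f])
  have g: "?g \<in> schwartz" by (intro schwartz_cmult schwartz_uminus F)
  have m: "(\<lambda>x. fourier f x * iexp (x \<bullet> u)) \<in> borel_measurable borel" for u
    using schwartz_measurable[OF F] by measurable
  have "fourier ?g u = f u" for u
  proof -
    have "fourier ?g u = inverse ?c * (LINT x|lborel. (\<lambda>x. fourier f x * iexp (x \<bullet> (- u))) (- x))"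
      by (simp add: fourier_cmult) (simp add: fourier_def)
    also have "\<dots> = inverse ?c * fourier (fourier f) (- u)"
      by (subst integral_lborel_uminus[OF m]) (simp add: fourier_def)
    also have "\<dots> = inverse ?c * (?c * f u)" unfolding fourier_inversion[OF f] by simp
    also have "\<dots> = f u" using c by (simp only: mult.assoc[symmetric] left_inverse mult_1_left simp_thms)
    finally show ?thesis .
  qed
  moreover have "fourier f x = ?c * ?g (- x)" for x
    using c by (simp only: mult.assoc[symmetric] right_inverse mult_1_left minus_minus simp_thms)
  ultimately show thesis using that[OF g] by blast
qed

section \<open>Polynomial functions\<close>

text \<open>Splitting into real and imaginary parts makes the inductive description of real
  polynomials available, from which closure under products and derivatives is read off.\<close>

lemma polynomial_function_complex_iff:
  fixes p :: "real^'n::finite \<Rightarrow> complex"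
  shows "polynomial_function p \<longleftrightarrow>
    real_polynomial_function (\<lambda>x. Re (p x)) \<and> real_polynomial_function (\<lambda>x. Im (p x))"
proof
  assume "polynomial_function p"
  thus "real_polynomial_function (\<lambda>x. Re (p x)) \<and> real_polynomial_function (\<lambda>x. Im (p x))"
    unfolding polynomial_function_def using bounded_linear_Re bounded_linear_Im by (auto simp: o_def)
next
  assume *: "real_polynomial_function (\<lambda>x. Re (p x)) \<and> real_polynomial_function (\<lambda>x. Im (p x))"
  have "polynomial_function (\<lambda>x. Re (p x) *\<^sub>R 1 + Im (p x) *\<^sub>R \<i>)"
    using * by (intro polynomial_function_add polynomial_function_mult) (auto simp flip: real_polynomial_function_eq)
  moreover have "(\<lambda>x. Re (p x) *\<^sub>R 1 + Im (p x) *\<^sub>R \<i>) = p"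
    by (simp add: fun_eq_iff complex_eq_iff)
  ultimately show "polynomial_function p" by simp
qed

lemma polynomial_function_times:
  fixes p q :: "real^'n::finite \<Rightarrow> complex"
  assumes "polynomial_function p" "polynomial_function q"
  shows "polynomial_function (\<lambda>x. p x * q x)"
  using assms unfolding polynomial_function_complex_iff
  by (auto intro!: real_polynomial_function.intros(3) real_polynomial_function.intros(4) real_polynomial_function_diff)

lemma polynomial_function_of_real:
  fixes p :: "real^'n::finite \<Rightarrow> real"
  shows "real_polynomial_function p \<Longrightarrow> polynomial_function (\<lambda>x. complex_of_real (p x))"
  unfolding polynomial_function_complex_iff by (simp add: real_polynomial_function.intros(2))

lemma real_polynomial_function_coord: "real_polynomial_function (\<lambda>x::real^'n::finite. x $ j)"
  by (rule real_polynomial_function.intros(1)) (rule bounded_linear_vec_nth)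

lemma polynomial_function_coord: "polynomial_function (\<lambda>x::real^'n::finite. complex_of_real (x $ j))"
  by (intro polynomial_function_of_real real_polynomial_function_coord)

lemma real_polynomial_function_norm_square: "real_polynomial_function (\<lambda>x::real^'n::finite. (norm x)\<^sup>2)"
proof -
  have "real_polynomial_function (\<lambda>x::real^'n. \<Sum>i\<in>UNIV. x $ i * x $ i)"
    by (intro real_polynomial_function_sum real_polynomial_function.intros(4) real_polynomial_function_coord) simp
  thus ?thesis by (simp add: power2_norm_eq_inner inner_vec_def)
qed

lemma real_polynomial_function_has_derivative:
  assumes "real_polynomial_function p"
  shows "\<exists>p'. (\<forall>x. (p has_derivative p' x) (at x)) \<and> (\<forall>h. real_polynomial_function (\<lambda>x. p' x h))"
  using assms
proof induction
  case (linear f)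
  thus ?case
    by (intro exI[of _ "\<lambda>x. f"]) (auto intro: bounded_linear_imp_has_derivative real_polynomial_function.intros(2))
next
  case (const c)
  show ?case by (intro exI[of _ "\<lambda>x h. 0"]) (auto intro: real_polynomial_function.intros(2))
next
  case (add f g)
  then obtain f' g' where "\<And>x. (f has_derivative f' x) (at x)" "\<And>h. real_polynomial_function (\<lambda>x. f' x h)"
    "\<And>x. (g has_derivative g' x) (at x)" "\<And>h. real_polynomial_function (\<lambda>x. g' x h)" by blast
  thus ?case
    by (intro exI[of _ "\<lambda>x h. f' x h + g' x h"]) (auto intro!: has_derivative_add real_polynomial_function.intros(3))
next
  case (mult f g)
  then obtain f' g' where *: "\<And>x. (f has_derivative f' x) (at x)" "\<And>h. real_polynomial_function (\<lambda>x. f' x h)"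
    "\<And>x. (g has_derivative g' x) (at x)" "\<And>h. real_polynomial_function (\<lambda>x. g' x h)" by blast
  have "real_polynomial_function (\<lambda>x. f x * g' x h + f' x h * g x)" for h
    by (intro real_polynomial_function.intros(3) real_polynomial_function.intros(4) * mult.hyps)
  thus ?case using * has_derivative_mult
    by (intro exI[of _ "\<lambda>x h. f x * g' x h + f' x h * g x"]) blast
qed

lemma polynomial_function_pderiv1:
  fixes p :: "real^'n::finite \<Rightarrow> complex"
  assumes "polynomial_function p"
  shows "polynomial_function (pderiv1 i p)"
proof -
  note rp = assms[unfolded polynomial_function_complex_iff]
  obtain P where P: "\<And>x. ((\<lambda>x. Re (p x)) has_derivative P x) (at x)" "\<And>h. real_polynomial_function (\<lambda>x. P x h)"
    using real_polynomial_function_has_derivative[OF rp[THEN conjunct1]] by blast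
  obtain Q where Q: "\<And>x. ((\<lambda>x. Im (p x)) has_derivative Q x) (at x)" "\<And>h. real_polynomial_function (\<lambda>x. Q x h)"
    using real_polynomial_function_has_derivative[OF rp[THEN conjunct2]] by blast
  have "pderiv1 i p x = Complex (P x (axis i 1)) (Q x (axis i 1))" for x
  proof (rule pderiv1_eqI)
    have "((\<lambda>x. of_real (Re (p x)) + \<i> * of_real (Im (p x))) has_derivative
        (\<lambda>h. of_real (P x h) + \<i> * of_real (Q x h))) (at x)"
      by (intro has_derivative_add has_derivative_mult_right has_derivative_of_real P Q)
    thus "(p has_derivative (\<lambda>h. of_real (P x h) + \<i> * of_real (Q x h))) (at x)"
      by (simp only: complex_eq[symmetric])
  qed (simp add: complex_eq_iff)
  hence "pderiv1 i p = (\<lambda>x. Complex (P x (axis i 1)) (Q x (axis i 1)))" by blast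
  thus ?thesis using P Q by (simp add: polynomial_function_complex_iff)
qed

section \<open>Quotients of polynomials by powers of the norm\<close>

lemma has_derivative_inverse_norm_power:
  fixes x :: "real^'n::finite"
  assumes "x \<noteq> 0"
  shows "((\<lambda>x. inverse (norm x) ^ m) has_derivative
    (\<lambda>h. - (real m * (x \<bullet> h)) * inverse (norm x) ^ (m + 2))) (at x)"
proof -
  have "((\<lambda>t. inverse t ^ m) has_real_derivative
      real m * (- inverse (norm x ^ 2) * inverse (norm x) ^ (m - 1))) (at (norm x))"
    using assms by (auto intro!: derivative_eq_intros simp: power2_eq_square)
  moreover have "real m * (- inverse (norm x ^ 2) * inverse (norm x) ^ (m - 1)) =
      - (real m * inverse (norm x) ^ (m + 1))"
    by (cases m) (auto simp: power2_eq_square)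
  ultimately have "((\<lambda>t. inverse t ^ m) has_real_derivative - (real m * inverse (norm x) ^ (m + 1))) (at (norm x))"
    by (simp only:)
  hence 1: "((\<lambda>t. inverse t ^ m) has_derivative (\<lambda>t. - (real m * inverse (norm x) ^ (m + 1)) * t)) (at (norm x))"
    by (simp only: has_field_derivative_def)
  from has_derivative_compose[OF has_derivative_norm[OF assms] this]
  have "((\<lambda>x. inverse (norm x) ^ m) has_derivative
    (\<lambda>h. - (real m * inverse (norm x) ^ (m + 1)) * (h \<bullet> sgn x))) (at x)" by simp
  moreover have "- (real m * inverse (norm x) ^ (m + 1)) * (h \<bullet> sgn x) =
      - (real m * (x \<bullet> h)) * inverse (norm x) ^ (m + 2)" for h
    by (simp add: sgn_div_norm inner_commute)
  ultimately show ?thesis by (simp only:)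
qed

text \<open>Over the common denominator |x|^(m+2) the derivative has numerator |x|^2 times the
  derivative of p, minus m x_i p, so the class of such quotients is closed away from the origin. For
  p homogeneous of degree m the quotient is the degree 0 extension by which smoothness on the sphere
  is defined.\<close>

lemma smooth_on_polynomial_over_norm_power:
  fixes p :: "real^'n::finite \<Rightarrow> complex"
  assumes p: "polynomial_function p"
  shows "smooth_on (- {0}) (\<lambda>x. p x * of_real (inverse (norm x) ^ m))"
proof -
  let ?h = "\<lambda>(p :: real^'n \<Rightarrow> complex) m x. p x * of_real (inverse (norm x) ^ m)"
  have d: "((\<lambda>x. of_real (inverse (norm x) ^ m) :: complex) has_derivative
      (\<lambda>h. of_real (- (real m * (x \<bullet> h)) * inverse (norm x) ^ (m + 2)))) (at x)" if "x \<noteq> 0" for x :: "real^'n" and m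
    by (intro has_derivative_of_real has_derivative_inverse_norm_power that)
  have nd: "(\<lambda>x::real^'n. of_real (inverse (norm x) ^ m) :: complex) differentiable at x" if "x \<noteq> 0" for x m
    using d[OF that] differentiable_def by blast
  let ?C = "{?h p m | p m. polynomial_function p}"
  show ?thesis
  proof (rule smooth_on_coinduct[of _ _ ?C])
    fix f i assume "f \<in> ?C"
    then obtain p m where f: "f = ?h p m" "polynomial_function p" by blast
    let ?q = "\<lambda>x. pderiv1 i p x * of_real ((norm x)\<^sup>2) + - of_nat m * of_real (x $ i) * p x"
    have "pderiv1 i f x = ?h ?q (m + 2) x" if "x \<noteq> 0" for x
    proof -
      have "pderiv1 i f x = p x * pderiv1 i (\<lambda>x. of_real (inverse (norm x) ^ m)) x
          + pderiv1 i p x * of_real (inverse (norm x) ^ m)"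
        unfolding f(1) by (rule pderiv1_mult[OF differentiable_at_polynomial_function[OF f(2)] nd[OF that]])
      also have "pderiv1 i (\<lambda>x. of_real (inverse (norm x) ^ m) :: complex) x =
          of_real (- (real m * x $ i) * inverse (norm x) ^ (m + 2))"
        by (rule pderiv1_eqI[OF d[OF that]]) (simp add: inner_axis)
      also have "inverse (norm x) ^ m = (norm x)\<^sup>2 * inverse (norm x) ^ (m + 2)"
        using that by (simp add: field_simps power2_eq_square)
      finally show ?thesis by (simp add: algebra_simps)
    qed
    moreover have "polynomial_function ?q"
      by (intro polynomial_function_add polynomial_function_times polynomial_function_pderiv1 f
        polynomial_function_of_real real_polynomial_function_norm_square polynomial_function_coord
        polynomial_function_const)
    ultimately show "\<exists>g\<in>?C. \<forall>x\<in>-{0}. pderiv1 i f x = g x"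
      by (intro bexI[of _ "?h ?q (m + 2)"] CollectI exI[of _ ?q] exI[of _ "m + 2"] conjI refl ballI) auto
  next
    fix f x assume "f \<in> ?C" "x \<in> - {0 :: real^'n}"
    then obtain p m where f: "f = ?h p m" "polynomial_function p" "x \<noteq> 0" by blast
    show "f differentiable at x"
      unfolding f(1) by (intro differentiable_mult differentiable_at_polynomial_function f nd)
  qed (use p in auto)
qed


section \<open>Bump functions\<close>

text \<open>The index 0 gives the classical function exp(-1/t) that is flat at 0. The extra powers
  of 1/t make the family closed under differentiation up to polynomial factors.\<close>

definition flat_exp :: "nat \<Rightarrow> real \<Rightarrow> real" where
  "flat_exp k t = (if t > 0 then exp (- inverse t) * inverse t ^ k else 0)"

lemma flat_exp_Suc: "flat_exp k t = t * flat_exp (Suc k) t"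
  by (simp add: flat_exp_def)

lemma flat_exp_tendsto_0: "(flat_exp k \<longlongrightarrow> 0) (at 0)"
proof -
  have "(flat_exp k \<longlongrightarrow> 0) (at_right 0)"
  proof -
    have "((\<lambda>t::real. (inverse t) ^ k / exp (inverse t)) \<longlongrightarrow> 0) (at_right 0)"
      by (rule filterlim_compose[OF tendsto_power_div_exp_0 filterlim_inverse_at_top_right])
    moreover have "\<forall>\<^sub>F t in at_right 0. (inverse t) ^ k / exp (inverse t) = flat_exp k t"
      using eventually_at_right_less[of "0::real"]
      by eventually_elim (simp add: flat_exp_def exp_minus divide_inverse)
    ultimately show ?thesis by (rule Lim_transform_eventually)
  qed
  moreover have "(flat_exp k \<longlongrightarrow> 0) (at_left 0)"
  proof -
    have "\<forall>\<^sub>F t in at_left 0. 0 = flat_exp k t"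
      by (rule eventually_at_leftI[of "-1"]) (auto simp: flat_exp_def)
    thus ?thesis by (rule Lim_transform_eventually[OF tendsto_const])
  qed
  ultimately show ?thesis by (simp add: filterlim_at_split)
qed

lemma flat_exp_has_derivative: "(flat_exp k has_real_derivative (1 - real k * t) * flat_exp (k + 2) t) (at t)"
proof -
  consider "t > 0" | "t < 0" | "t = 0" by linarith
  thus ?thesis
  proof cases
    case 1
    have "((\<lambda>t. exp (- inverse t) * inverse t ^ k) has_real_derivative
        exp (- inverse t) * inverse t ^ 2 * inverse t ^ k +
        real k * (- inverse (t ^ 2) * inverse t ^ (k - 1)) * exp (- inverse t)) (at t)"
      using 1 by (auto intro!: derivative_eq_intros simp: power2_eq_square)
    moreover have "exp (- inverse t) * inverse t ^ 2 * inverse t ^ k +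
        real k * (- inverse (t ^ 2) * inverse t ^ (k - 1)) * exp (- inverse t) = (1 - real k * t) * flat_exp (k + 2) t"
      using 1 by (cases k) (auto simp: flat_exp_def power2_eq_square divide_simps, auto simp: algebra_simps)
    ultimately have "((\<lambda>t. exp (- inverse t) * inverse t ^ k) has_real_derivative (1 - real k * t) * flat_exp (k + 2) t) (at t)"
      by simp
    thus ?thesis
      by (rule has_field_derivative_transform_within_open[where S = "{0<..}"]) (use 1 in \<open>auto simp: flat_exp_def\<close>)
  next
    case 2
    have "((\<lambda>t. 0) has_real_derivative (1 - real k * t) * flat_exp (k + 2) t) (at t)"
      using 2 by (simp add: flat_exp_def)
    thus ?thesis
      by (rule has_field_derivative_transform_within_open[where S = "{..<0}"]) (use 2 in \<open>auto simp: flat_exp_def\<close>)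
  next
    \<comment> \<open>At 0 the difference quotient is the next member of the family, which tends to
      0 because the exponential beats every power of 1/t.\<close>
    case 3
    have "(flat_exp k h - flat_exp k 0) / h = flat_exp (Suc k) h" if "h \<noteq> 0" for h
      using that flat_exp_Suc[of k h] by (simp add: flat_exp_def)
    hence "((\<lambda>h. (flat_exp k h - flat_exp k 0) / h) \<longlongrightarrow> 0) (at 0)"
      using flat_exp_tendsto_0[of "Suc k"] by (subst tendsto_cong[where g = "flat_exp (Suc k)"])
        (auto simp: eventually_at_filter)
    thus ?thesis using 3 by (simp add: has_field_derivative_iff flat_exp_def)
  qed
qed

text \<open>Polynomials times \<open>flat_exp m\<close> of \<open>?\<rho>\<close> form a class
  closed under derivatives: since \<open>flat_exp m\<close> is the square of its argument times
  \<open>flat_exp (m + 2)\<close>, both terms of the product rule can be written with the index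
  \<open>m + 2\<close>. All members vanish outside a compact ball, which gives rapid decay.\<close>

lemma schwartz_bump:
  fixes a :: "real^'n::finite"
  shows "(\<lambda>x. of_real (flat_exp 0 (r\<^sup>2 - (norm (x - a))\<^sup>2)) :: complex) \<in> schwartz"
proof -
  let ?\<rho> = "\<lambda>x::real^'n. r\<^sup>2 - (norm (x - a))\<^sup>2"
  let ?h = "\<lambda>(p :: real^'n \<Rightarrow> complex) m x. p x * of_real (flat_exp m (?\<rho> x))"
  let ?C = "{?h p m | p m. polynomial_function p}"
  have \<rho>: "(?\<rho> has_derivative (\<lambda>h. - (2 * ((x - a) \<bullet> h)))) (at x)" for x
    unfolding power2_norm_eq_inner by (auto intro!: derivative_eq_intros simp: inner_commute)
  have \<rho>p: "real_polynomial_function ?\<rho>"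
  proof -
    have "(\<lambda>x::real^'n. (norm (x - a))\<^sup>2) = (\<lambda>x. \<Sum>i\<in>UNIV. (x $ i - a $ i) * (x $ i - a $ i))"
      by (simp add: power2_norm_eq_inner inner_vec_def)
    moreover have "real_polynomial_function (\<lambda>x. \<Sum>i\<in>UNIV. (x $ i - a $ i) * (x $ i - a $ i))"
      by (intro real_polynomial_function_sum real_polynomial_function.intros(4) real_polynomial_function_diff
        real_polynomial_function_coord real_polynomial_function.intros(2)) simp
    ultimately show ?thesis
      by (intro real_polynomial_function_diff real_polynomial_function.intros(2)) simp
  qed
  have d: "((\<lambda>x. of_real (flat_exp m (?\<rho> x)) :: complex) has_derivative
      (\<lambda>h. of_real ((1 - real m * ?\<rho> x) * flat_exp (m + 2) (?\<rho> x) * - (2 * ((x - a) \<bullet> h))))) (at x)" for m x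
    by (rule has_derivative_of_real)
      (rule has_derivative_compose[OF \<rho> flat_exp_has_derivative[THEN has_field_derivative_imp_has_derivative]])
  have nd: "(\<lambda>x. of_real (flat_exp m (?\<rho> x)) :: complex) differentiable at x" for m x
    using d differentiable_def by blast
  have "?h (\<lambda>x. 1) 0 \<in> schwartz"
  proof (rule schwartz_coinduct[of _ ?C])
    fix f i assume "f \<in> ?C"
    then obtain p m where f: "f = ?h p m" "polynomial_function p" by blast
    let ?q = "\<lambda>x. pderiv1 i p x * of_real (?\<rho> x * ?\<rho> x) +
      p x * of_real ((1 - real m * ?\<rho> x) * - (2 * (x $ i - a $ i)))"
    have "pderiv1 i f x = ?h ?q (m + 2) x" for x
    proof -
      have "pderiv1 i f x = p x * pderiv1 i (\<lambda>x. of_real (flat_exp m (?\<rho> x))) x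
          + pderiv1 i p x * of_real (flat_exp m (?\<rho> x))"
        unfolding f(1) by (rule pderiv1_mult[OF differentiable_at_polynomial_function[OF f(2)] nd])
      also have "pderiv1 i (\<lambda>x. of_real (flat_exp m (?\<rho> x)) :: complex) x =
          of_real ((1 - real m * ?\<rho> x) * flat_exp (m + 2) (?\<rho> x) * - (2 * (x $ i - a $ i)))"
        by (rule pderiv1_eqI[OF d]) (simp add: inner_axis)
      also have "flat_exp m (?\<rho> x) = ?\<rho> x * (?\<rho> x * flat_exp (m + 2) (?\<rho> x))"
        using flat_exp_Suc[of m "?\<rho> x"] flat_exp_Suc[of "Suc m" "?\<rho> x"] by simp
      finally show ?thesis by (simp only: of_real_mult) (simp only: ring_distribs mult_ac add_ac)
    qed
    hence "pderiv1 i f = ?h ?q (m + 2)" by blast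
    moreover have "polynomial_function ?q"
      by (intro polynomial_function_add polynomial_function_times polynomial_function_pderiv1 f \<rho>p
        polynomial_function_of_real real_polynomial_function.intros(4) real_polynomial_function_diff
        real_polynomial_function_minus real_polynomial_function.intros(2) real_polynomial_function_coord)
    ultimately show "pderiv1 i f \<in> ?C" by (intro CollectI exI[of _ ?q] exI[of _ "m + 2"] conjI)
  next
    fix f assume "f \<in> ?C"
    then obtain p m where f: "f = ?h p m" "polynomial_function p" by blast
    show diff: "f differentiable at x" for x
      unfolding f(1) by (intro differentiable_mult differentiable_at_polynomial_function f nd)
    show "rapid f"
      unfolding rapid_def
    proof
      fix k
      have "continuous_on (cball a \<bar>r\<bar>) (\<lambda>x. (1 + norm x) ^ k * norm (f x))"
        using diff by (intro continuous_intros)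
          (meson continuous_at_imp_continuous_on differentiable_imp_continuous_within)
      hence "bounded ((\<lambda>x. (1 + norm x) ^ k * norm (f x)) ` cball a \<bar>r\<bar>)"
        by (intro compact_imp_bounded compact_continuous_image) auto
      then obtain B where B: "\<And>x. x \<in> cball a \<bar>r\<bar> \<Longrightarrow> (1 + norm x) ^ k * norm (f x) \<le> B" "B > 0"
        unfolding bounded_pos by fastforce
      have "f x = 0" if "x \<notin> cball a \<bar>r\<bar>" for x
      proof -
        have "\<bar>r\<bar> < norm (x - a)" using that by (simp add: dist_norm norm_minus_commute)
        hence "r\<^sup>2 < (norm (x - a))\<^sup>2" by (metis abs_ge_zero power2_abs power_strict_mono zero_less_numeral)
        thus ?thesis by (simp add: f flat_exp_def)
      qed
      hence "(1 + norm x) ^ k * norm (f x) \<le> B" for x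
        using B by (cases "x \<in> cball a \<bar>r\<bar>") auto
      thus "\<exists>B. \<forall>x. (1 + norm x) ^ k * norm (f x) \<le> B" by blast
    qed
  next
    show "?h (\<lambda>x. 1) 0 \<in> ?C"
      by (intro CollectI exI[of _ "\<lambda>x. 1"] exI[of _ 0] conjI refl polynomial_function_const)
  qed
  thus ?thesis by simp
qed

section \<open>Continuous functions orthogonal to all bumps\<close>

lemma open_AE_notin_empty:
  fixes S :: "'a::euclidean_space set"
  assumes "open S" "AE x in lborel. x \<notin> S"
  shows "S = {}"
proof (rule ccontr)
  assume "S \<noteq> {}"
  then obtain a r where r: "r > 0" "ball a r \<subseteq> S" using assms(1) open_contains_ball by blast
  have "AE x in lborel. x \<notin> ball a r" using assms(2) by eventually_elim (use r in auto)
  hence "ball a r \<in> null_sets lborel" by (subst AE_iff_null_sets) auto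
  hence "measure lborel (ball a r) = 0" by (simp add: measure_def null_setsD1)
  thus False using content_ball_pos[OF r(1), of a] by simp
qed

text \<open>The fundamental lemma of the calculus of variations. If h(a) is not 0, the real part of
  cnj(h(a)) h is positive on a small ball around a; its product with the bump of that ball is
  nonnegative with integral 0, hence 0 almost everywhere, although it is positive inside the
  ball.\<close>

lemma eq_0_if_orthogonal_to_bumps:
  fixes h :: "real^'n::finite \<Rightarrow> complex"
  assumes "open U" and cont: "continuous_on U h" and a: "a \<in> U"
    and zero: "\<And>a r \<eta>. r > 0 \<Longrightarrow> cball a r \<subseteq> U \<Longrightarrow> \<eta> \<in> schwartz \<Longrightarrow>
      (\<And>x. x \<notin> cball a r \<Longrightarrow> \<eta> x = 0) \<Longrightarrow> (LINT x|lborel. h x * \<eta> x) = 0"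
  shows "h a = 0"
proof (rule ccontr)
  assume ha: "h a \<noteq> 0"
  let ?c = "cnj (h a)"
  let ?g = "\<lambda>x. Re (?c * h x)"
  have ga: "?g a > 0" using ha by (simp add: complex_neq_0 power2_eq_square)
  have contg: "continuous_on U ?g" by (intro continuous_intros cont)
  have "open {x\<in>U. ?g x > 0}"
  proof -
    have "open (?g -` {0<..} \<inter> U)"
      using contg continuous_on_open_vimage[OF \<open>open U\<close>, of ?g] open_greaterThan by blast
    moreover have "{x\<in>U. ?g x > 0} = ?g -` {0<..} \<inter> U" by auto
    ultimately show ?thesis by (simp only:)
  qed
  then obtain r where r: "r > 0" "cball a r \<subseteq> {x\<in>U. ?g x > 0}"
    using a ga open_contains_cball by (metis (no_types, lifting) mem_Collect_eq)
  let ?b = "\<lambda>x. flat_exp 0 (r\<^sup>2 - (norm (x - a))\<^sup>2)"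
  have b0: "?b x = 0" if "x \<notin> cball a r" for x
  proof -
    have "r < norm (x - a)" using that by (simp add: dist_norm norm_minus_commute)
    hence "r\<^sup>2 < (norm (x - a))\<^sup>2" using r by (intro power_strict_mono) auto
    thus ?thesis by (simp add: flat_exp_def)
  qed
  have b1: "?b x > 0" if "x \<in> ball a r" for x
  proof -
    have "norm (x - a) < r" using that by (simp add: dist_norm norm_minus_commute)
    hence "(norm (x - a))\<^sup>2 < r\<^sup>2" by (intro power_strict_mono) auto
    thus ?thesis by (simp add: flat_exp_def)
  qed
  have cb: "continuous_on UNIV (\<lambda>x. complex_of_real (?b x))" by (rule schwartz_continuous[OF schwartz_bump])
  have "integrable lborel (\<lambda>x. indicator (cball a r) x *\<^sub>R (h x * of_real (?b x)))"
    by (rule borel_integrable_compact)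
      (use r in \<open>auto intro!: continuous_intros continuous_on_subset[OF cont] continuous_on_subset[OF cb]\<close>)
  also have "(\<lambda>x. indicator (cball a r) x *\<^sub>R (h x * of_real (?b x))) = (\<lambda>x. h x * of_real (?b x))"
    using b0 by (auto simp: indicator_def fun_eq_iff)
  finally have int: "integrable lborel (\<lambda>x. ?c * (h x * of_real (?b x)))" by simp
  have "(LINT x|lborel. Re (?c * (h x * of_real (?b x)))) = Re (?c * (LINT x|lborel. h x * of_real (?b x)))"
    by (simp only: integral_Re[OF int] integral_mult_right_zero)
  also have "(LINT x|lborel. h x * of_real (?b x)) = 0"
    by (rule zero[of r a]) (use r b0 schwartz_bump in auto)
  finally have "(LINT x|lborel. Re (?c * (h x * of_real (?b x)))) = 0" by simp
  hence "(LINT x|lborel. ?g x * ?b x) = 0" by (simp add: algebra_simps)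
  moreover have "integrable lborel (\<lambda>x. ?g x * ?b x)"
    using integrable_Re[OF int] by (simp add: algebra_simps)
  moreover have "0 \<le> ?g x * ?b x" for x
  proof (cases "x \<in> cball a r")
    case True
    hence "?g x > 0" using r(2) by blast
    moreover have "?b x \<ge> 0" by (simp add: flat_exp_def)
    ultimately show ?thesis by (simp only: mult_nonneg_nonneg less_imp_le)
  qed (simp add: b0)
  ultimately have "AE x in lborel. ?g x * ?b x = 0" by (subst (asm) integral_nonneg_eq_0_iff_AE) auto
  hence "AE x in lborel. x \<notin> ball a r"
  proof eventually_elim
    case (elim x)
    show ?case
    proof
      assume x: "x \<in> ball a r"
      hence "?g x > 0" using r(2) ball_subset_cball by blast
      thus False using elim b1[OF x] by (simp only: mult_eq_0_iff) linarith
    qed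
  qed
  with open_ball have "ball a r = {}" by (rule open_AE_notin_empty)
  thus False using r(1) by simp
qed


section \<open>Schwartz functions as thick test functions\<close>

text \<open>Multiplication by i u_k is what the k-th partial derivative becomes under the Fourier
  transform; folding it over \<open>ds\<close> mirrors the fold in \<open>pderivs\<close>.\<close>

definition mult_coord :: "'n::finite \<Rightarrow> (real^'n \<Rightarrow> complex) \<Rightarrow> real^'n \<Rightarrow> complex" where
  "mult_coord k g u = \<i> * (of_real (u $ k) * g u)"

lemma mult_coord_commute: "mult_coord k (mult_coord l g) = mult_coord l (mult_coord k g)"
  by (simp add: mult_coord_def fun_eq_iff)

lemma schwartz_mult_coord: "g \<in> schwartz \<Longrightarrow> mult_coord k g \<in> schwartz"
  unfolding mult_coord_def[abs_def] by (intro schwartz_cmult schwartz_coord)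

lemma schwartz_foldr_mult_coord: "g \<in> schwartz \<Longrightarrow> foldr mult_coord ds g \<in> schwartz"
  by (induction ds) (auto intro: schwartz_mult_coord)

lemma pderivs_fourier:
  "g \<in> schwartz \<Longrightarrow> pderivs ds (fourier g) = fourier (foldr mult_coord ds g)"
proof (induction ds)
  case (Cons d ds)
  thus ?case
    using pderiv1_fourier[OF schwartz_foldr_mult_coord, of g d ds] by (simp add: mult_coord_def[abs_def])
qed simp

text \<open>The Taylor polynomials of \<open>fourier g\<close> at the origin, obtained by expanding the exponential.\<close>

definition taylor_term :: "nat \<Rightarrow> (real^'n::finite \<Rightarrow> complex) \<Rightarrow> real^'n \<Rightarrow> complex" where
  "taylor_term j g x = (LINT u|lborel. (\<i> * of_real (u \<bullet> x)) ^ j / fact j * g u)"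

lemma integrable_taylor_term:
  fixes g :: "real^'n::finite \<Rightarrow> complex"
  assumes g: "g \<in> schwartz"
  shows "integrable lborel (\<lambda>u. (\<i> * of_real (u \<bullet> x)) ^ j / fact j * g u)"
proof (rule Bochner_Integration.integrable_bound)
  have [measurable]: "g \<in> borel_measurable borel" by (rule schwartz_measurable[OF g])
  show "integrable lborel (\<lambda>u. norm x ^ j / fact j * (norm u ^ j * norm (g u)))"
    by (intro integrable_mult_right integrable_schwartz_power_norm g)
  show "(\<lambda>u. (\<i> * of_real (u \<bullet> x)) ^ j / fact j * g u) \<in> borel_measurable lborel" by measurable
  have "\<bar>u \<bullet> x\<bar> ^ j * norm (g u) / fact j \<le> (norm u * norm x) ^ j * norm (g u) / fact j" for u
    by (intro divide_right_mono mult_right_mono power_mono Cauchy_Schwarz_ineq2) auto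
  thus "AE u in lborel. norm ((\<i> * of_real (u \<bullet> x)) ^ j / fact j * g u) \<le>
      norm (norm x ^ j / fact j * (norm u ^ j * norm (g u)))"
    by (auto simp: norm_mult norm_divide norm_power power_mult_distrib mult_ac)
qed

lemma taylor_term_0: "taylor_term 0 g x = (LINT u|lborel. g u)"
  by (simp add: taylor_term_def)

lemma taylor_term_scaleR: "taylor_term j g (c *\<^sub>R x) = of_real (c ^ j) * taylor_term j g x"
proof -
  have "taylor_term j g (c *\<^sub>R x) = (LINT u|lborel. of_real (c ^ j) * ((\<i> * of_real (u \<bullet> x)) ^ j / fact j * g u))"
    unfolding taylor_term_def
    by (rule arg_cong[where f = "integral\<^sup>L lborel"]) (simp add: fun_eq_iff power_mult_distrib mult_ac)
  thus ?thesis by (simp only: integral_mult_right_zero taylor_term_def)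
qed

text \<open>One factor i u \<bullet> x of the power is expanded in coordinates and absorbed into g.
  The resulting recursion reduces polynomiality and derivatives of the Taylor terms to algebra,
  without differentiating under the integral.\<close>

lemma taylor_term_Suc:
  fixes g :: "real^'n::finite \<Rightarrow> complex"
  assumes g: "g \<in> schwartz"
  shows "of_nat (Suc j) * taylor_term (Suc j) g x = (\<Sum>k\<in>UNIV. of_real (x $ k) * taylor_term j (mult_coord k g) x)"
proof -
  have "of_nat (Suc j) * ((\<i> * of_real (u \<bullet> x)) ^ Suc j / fact (Suc j) * g u) =
      (\<Sum>k\<in>UNIV. of_real (x $ k) * ((\<i> * of_real (u \<bullet> x)) ^ j / fact j * mult_coord k g u))" for u
  proof -
    let ?t = "\<i> * complex_of_real (u \<bullet> x)"
    have "of_nat (Suc j) * (?t ^ Suc j / fact (Suc j) * g u) = ?t ^ j / fact j * g u * ?t"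
      by (simp add: field_simps del: of_nat_Suc)
    also have "A * g u * ?t = (\<Sum>k\<in>UNIV. of_real (x $ k) * (A * mult_coord k g u))" for A
      by (simp add: inner_vec_def sum_distrib_left mult_coord_def mult_ac)
    finally show ?thesis .
  qed
  hence "of_nat (Suc j) * taylor_term (Suc j) g x =
      (LINT u|lborel. (\<Sum>k\<in>UNIV. of_real (x $ k) * ((\<i> * of_real (u \<bullet> x)) ^ j / fact j * mult_coord k g u)))"
    unfolding taylor_term_def by (simp only: integral_mult_right_zero[symmetric])
  also have "\<dots> = (\<Sum>k\<in>UNIV. of_real (x $ k) * taylor_term j (mult_coord k g) x)"
    unfolding taylor_term_def
    by (subst Bochner_Integration.integral_sum)
      (auto intro!: integrable_mult_right integrable_taylor_term schwartz_mult_coord g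
        simp only: integral_mult_right_zero)
  finally show ?thesis .
qed

lemma taylor_term_Suc_divide:
  fixes g :: "real^'n::finite \<Rightarrow> complex"
  assumes g: "g \<in> schwartz"
  shows "taylor_term (Suc j) g =
    (\<lambda>x. inverse (of_nat (Suc j)) * (\<Sum>k\<in>UNIV. of_real (x $ k) * taylor_term j (mult_coord k g) x))"
  unfolding taylor_term_Suc[OF g, symmetric]
  by (simp add: fun_eq_iff del: of_nat_Suc)

lemma polynomial_function_taylor_term:
  fixes g :: "real^'n::finite \<Rightarrow> complex"
  assumes "g \<in> schwartz"
  shows "polynomial_function (taylor_term j g)"
  using assms
proof (induction j arbitrary: g)
  case 0
  show ?case unfolding taylor_term_0[abs_def] by (rule polynomial_function_const)
next
  case (Suc j)
  show ?case
    unfolding taylor_term_Suc_divide[OF Suc.prems]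
    by (intro polynomial_function_times polynomial_function_const polynomial_function_sum finite
      polynomial_function_coord Suc.IH schwartz_mult_coord Suc.prems)
qed

lemma pderiv1_taylor_term_0: "pderiv1 k (taylor_term 0 g) = (\<lambda>x. 0)"
  unfolding taylor_term_0[abs_def] by (simp add: pderiv1_const fun_eq_iff)

lemma pderiv1_sum:
  assumes "finite A" "\<And>a. a \<in> A \<Longrightarrow> f a differentiable at x"
  shows "pderiv1 i (\<lambda>x. \<Sum>a\<in>A. f a x) x = (\<Sum>a\<in>A. pderiv1 i (f a) x)"
  by (rule pderiv1_eqI[OF has_derivative_sum[of A f "\<lambda>a. frechet_derivative (f a) (at x)"]])
    (use assms frechet_derivative_works in \<open>auto simp: pderiv1_def\<close>)

text \<open>Induction through the recursion: the product rule leaves one undifferentiated term, and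
  by the induction hypothesis the remaining sum is again an instance of the recursion. In the step
  from j to j + 1 they make 1 + (j + 1) copies of the claimed term, which cancels the factor 1 / (j
  + 2).\<close>

lemma pderiv1_taylor_term_Suc:
  fixes g :: "real^'n::finite \<Rightarrow> complex"
  assumes "g \<in> schwartz"
  shows "pderiv1 k (taylor_term (Suc j) g) = taylor_term j (mult_coord k g)"
  using assms
proof (induction j arbitrary: g)
  have diff: "taylor_term j g differentiable at x" if "g \<in> schwartz" for g :: "real^'n \<Rightarrow> complex" and j x
    by (intro differentiable_at_polynomial_function polynomial_function_taylor_term that)
  have *: "pderiv1 k (taylor_term (Suc j) g) x = inverse (of_nat (Suc j)) *
      (taylor_term j (mult_coord k g) x + (\<Sum>l\<in>UNIV. of_real (x $ l) * pderiv1 k (taylor_term j (mult_coord l g)) x))"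
    if g: "g \<in> schwartz" for g :: "real^'n \<Rightarrow> complex" and j x
  proof -
    have d: "(\<lambda>x. of_real (x $ l) * taylor_term j (mult_coord l g) x) differentiable at x" for l
      by (intro differentiable_mult differentiable_coord diff schwartz_mult_coord g)
    have "pderiv1 k (\<lambda>x. of_real (x $ l) * taylor_term j (mult_coord l g) x) x =
        (if k = l then taylor_term j (mult_coord l g) x else 0) + of_real (x $ l) * pderiv1 k (taylor_term j (mult_coord l g)) x" for l
      by (subst pderiv1_mult[OF differentiable_coord diff[OF schwartz_mult_coord[OF g]]]) (simp add: pderiv1_coord)
    hence "(\<Sum>l\<in>UNIV. pderiv1 k (\<lambda>x. of_real (x $ l) * taylor_term j (mult_coord l g) x) x) =
        taylor_term j (mult_coord k g) x + (\<Sum>l\<in>UNIV. of_real (x $ l) * pderiv1 k (taylor_term j (mult_coord l g)) x)"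
      by (simp add: sum.distrib)
    thus ?thesis
      unfolding taylor_term_Suc_divide[OF g]
      by (subst pderiv1_cmult) (auto intro!: differentiable_sum d simp: pderiv1_sum d)
  qed
  {
    case 0
    show ?case by (simp add: fun_eq_iff *[OF 0] pderiv1_taylor_term_0)
  next
    case (Suc j)
    show ?case
    proof
      fix x
      have "(\<Sum>l\<in>UNIV. of_real (x $ l) * pderiv1 k (taylor_term (Suc j) (mult_coord l g)) x) =
          (\<Sum>l\<in>UNIV. of_real (x $ l) * taylor_term j (mult_coord l (mult_coord k g)) x)"
        by (simp only: Suc.IH[OF schwartz_mult_coord[OF Suc.prems]] mult_coord_commute[of k])
      also have "\<dots> = of_nat (Suc j) * taylor_term (Suc j) (mult_coord k g) x"
        by (simp only: taylor_term_Suc[OF schwartz_mult_coord[OF Suc.prems]])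
      finally have "pderiv1 k (taylor_term (Suc (Suc j)) g) x = inverse (of_nat (Suc (Suc j))) *
          (of_nat (Suc (Suc j)) * taylor_term (Suc j) (mult_coord k g) x)"
        by (simp only: *[OF Suc.prems] of_nat_Suc[of "Suc j"] distrib_right mult_1_left)
      thus "pderiv1 k (taylor_term (Suc (Suc j)) g) x = taylor_term (Suc j) (mult_coord k g) x"
        by (simp del: of_nat_Suc)
    qed
  }
qed

lemma pderivs_taylor_term:
  fixes g :: "real^'n::finite \<Rightarrow> complex"
  assumes g: "g \<in> schwartz"
  shows "pderivs ds (taylor_term j g) =
    (if length ds \<le> j then taylor_term (j - length ds) (foldr mult_coord ds g) else (\<lambda>x. 0))"
proof (induction ds)
  case (Cons d ds)
  consider "length ds < j" | "length ds = j" | "length ds > j" by linarith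
  thus ?case
  proof cases
    case 1
    hence "j - length ds = Suc (j - Suc (length ds))" by simp
    thus ?thesis using 1 Cons pderiv1_taylor_term_Suc[OF schwartz_foldr_mult_coord[OF g]] by simp
  next
    case 2
    thus ?thesis using Cons pderiv1_taylor_term_0 by simp
  next
    case 3
    thus ?thesis using Cons by (simp add: pderiv1_const_fun)
  qed
qed simp

lemma fourier_taylor_bound:
  fixes g :: "real^'n::finite \<Rightarrow> complex"
  assumes g: "g \<in> schwartz"
  shows "norm (fourier g x - (\<Sum>j<M. taylor_term j g x)) \<le>
    norm x ^ M / fact M * (LINT u|lborel. norm u ^ M * norm (g u))"
proof -
  \<comment> \<open>For M = 0 the sum is empty and the bound says that the exponential has modulus
    at most 1; otherwise it is the usual Taylor estimate of order M - 1.\<close>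
  have e: "norm (iexp t - (\<Sum>j<M. (\<i> * of_real t) ^ j / fact j)) \<le> \<bar>t\<bar> ^ M / fact M" for t
    by (cases M) (use iexp_approx1[of t] lessThan_Suc_atMost in \<open>auto simp del: fact_Suc power_Suc\<close>)
  let ?r = "\<lambda>u. g u * iexp (u \<bullet> x) - (\<Sum>j<M. (\<i> * of_real (u \<bullet> x)) ^ j / fact j * g u)"
  have i1: "integrable lborel (\<lambda>u. g u * iexp (u \<bullet> x))"
    by (intro integrable_iexp_mult integrable_schwartz g)
  have i2: "integrable lborel (\<lambda>u. \<Sum>j<M. (\<i> * of_real (u \<bullet> x)) ^ j / fact j * g u)"
    by (intro Bochner_Integration.integrable_sum integrable_taylor_term g)
  have "fourier g x - (\<Sum>j<M. taylor_term j g x) = (LINT u|lborel. ?r u)"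
    unfolding fourier_def taylor_term_def Bochner_Integration.integral_diff[OF i1 i2]
    by (subst Bochner_Integration.integral_sum) (rule integrable_taylor_term[OF g], rule refl)
  hence "norm (fourier g x - (\<Sum>j<M. taylor_term j g x)) \<le> (LINT u|lborel. norm (?r u))"
    by (simp only: integral_norm_bound)
  also have "\<dots> \<le> (LINT u|lborel. norm x ^ M / fact M * (norm u ^ M * norm (g u)))"
  proof (rule integral_mono)
    show "integrable lborel (\<lambda>u. norm (?r u))"
      by (intro integrable_norm Bochner_Integration.integrable_diff i1 i2)
    show "integrable lborel (\<lambda>u. norm x ^ M / fact M * (norm u ^ M * norm (g u)))"
      by (intro integrable_mult_right integrable_schwartz_power_norm g)
    fix u
    have "?r u = (iexp (u \<bullet> x) - (\<Sum>j<M. (\<i> * of_real (u \<bullet> x)) ^ j / fact j)) * g u"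
      by (simp only: left_diff_distrib sum_distrib_right mult.commute[of "g u" "iexp (u \<bullet> x)"])
    hence "norm (?r u) \<le> \<bar>u \<bullet> x\<bar> ^ M / fact M * norm (g u)"
      by (simp only: norm_mult) (intro mult_right_mono e norm_ge_zero)
    also have "\<dots> \<le> (norm u * norm x) ^ M / fact M * norm (g u)"
      by (intro mult_right_mono divide_right_mono power_mono Cauchy_Schwarz_ineq2) auto
    finally show "norm (?r u) \<le> norm x ^ M / fact M * (norm u ^ M * norm (g u))"
      by (simp add: power_mult_distrib mult_ac)
  qed
  finally show ?thesis by simp
qed

section \<open>The Taylor expansion as a thick expansion\<close>

lemma sphere_smooth_taylor_term:
  fixes g :: "real^'n::finite \<Rightarrow> complex"
  assumes g: "g \<in> schwartz"
  shows "taylor_term j g \<in> sphere_smooth"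
  unfolding sphere_smooth_def
proof
  show "smooth_on (- {0}) (\<lambda>x. taylor_term j g (sgn x))"
  proof (rule smooth_on_cong[OF smooth_on_polynomial_over_norm_power[OF polynomial_function_taylor_term[OF g]]])
    show "taylor_term j g x * of_real (inverse (norm x) ^ j) = taylor_term j g (sgn x)" for x
      unfolding sgn_div_norm taylor_term_scaleR by (simp add: mult.commute)
  qed
qed

lemma thick_term_taylor_term:
  fixes g :: "real^'n::finite \<Rightarrow> complex"
  shows "thick_term (\<lambda>j. taylor_term (nat j) g) (int j) = taylor_term j g"
proof
  fix x :: "real^'n"
  have "taylor_term j g x = taylor_term j g (norm x *\<^sub>R sgn x)"
    by (cases "x = 0") (auto simp: sgn_div_norm)
  also have "\<dots> = of_real (norm x ^ j) * taylor_term j g (sgn x)" by (rule taylor_term_scaleR)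
  finally show "thick_term (\<lambda>j. taylor_term (nat j) g) (int j) x = taylor_term j g x"
    by (simp add: thick_term_def mult.commute)
qed

text \<open>Differentiating \<open>fourier g\<close> along \<open>ds\<close> gives the transform of
  another Schwartz function \<open>?g\<close>, and differentiating the Taylor terms of g gives those
  of \<open>?g\<close> with index lowered by the length of \<open>ds\<close>. So the termwise
  derivative is once more a Taylor polynomial, and \<open>fourier_taylor_bound\<close> applies to
  every \<open>ds\<close>.\<close>

lemma thick_expansion_schwartz:
  fixes g :: "real^'n::finite \<Rightarrow> complex"
  assumes g: "g \<in> schwartz"
  shows "thick_expansion 0 (\<lambda>j. taylor_term (nat j) g) ((fourier g)(0 := 0))"
  unfolding thick_expansion_def
proof (intro conjI allI impI sphere_smooth_taylor_term g)
  fix ds :: "'n list" and N :: int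
  let ?a = "\<lambda>j. taylor_term (nat j) g"
  let ?g = "foldr mult_coord ds g"
  let ?l = "length ds"
  \<comment> \<open>The truncation to 0 matters when N is below the length of \<open>ds\<close>:
    then no term survives differentiation, and the comparison function |x| to a negative power is at
    least 1 near the origin.\<close>
  let ?M = "nat (N - int ?l)"
  let ?C = "1 / fact ?M * (LINT u|lborel. norm u ^ ?M * norm (?g u))"
  have g': "?g \<in> schwartz" by (rule schwartz_foldr_mult_coord[OF g])
  let ?D = "\<lambda>x. pderivs ds ((fourier g)(0 := 0)) x - (\<Sum>j\<in>{0..<N}. pderivs ds (thick_term ?a j) x)"
  have tt: "thick_term ?a j = taylor_term (nat j) g" if "0 \<le> j" for j
    using thick_term_taylor_term[of g "nat j"] that by simp
  have sum: "(\<Sum>j\<in>{0..<N}. pderivs ds (thick_term ?a j) x) = (\<Sum>j<?M. taylor_term j ?g x)" for x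
  proof -
    have "(\<Sum>j\<in>{0..<N}. pderivs ds (thick_term ?a j) x) = (\<Sum>j<nat N. pderivs ds (taylor_term j g) x)"
      by (rule sum.reindex_bij_witness[of _ int nat]) (auto simp: tt)
    also have "\<dots> = (\<Sum>j\<in>{j. j < nat N \<and> ?l \<le> j}. taylor_term (j - ?l) ?g x)"
      unfolding pderivs_taylor_term[OF g]
      by (rule sum.mono_neutral_cong_right) auto
    also have "\<dots> = (\<Sum>j<?M. taylor_term j ?g x)"
      by (rule sum.reindex_bij_witness[of _ "\<lambda>j. j + ?l" "\<lambda>j. j - ?l"]) auto
    finally show ?thesis .
  qed
  have ev: "\<forall>\<^sub>F x :: real^'n in at 0. x \<noteq> 0 \<and> norm x < 1"
    unfolding eventually_at by (intro exI[of _ 1]) auto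
  show "(\<lambda>x. norm (?D x))
      \<in> O[at 0](\<lambda>x. norm x powi (N - int ?l))"
  proof (rule landau_o.big_mono[THEN landau_o.big.trans])
    show "\<forall>\<^sub>F x in at 0. norm (norm (?D x))
        \<le> norm (?C * norm x powi (N - int ?l))"
      using ev
    proof eventually_elim
      case (elim x)
      hence x: "x \<noteq> 0" "norm x < 1" by auto
      have "pderivs ds ((fourier g)(0 := 0)) x = pderivs ds (fourier g) x"
        by (rule pderivs_cong_open[of "- {0}"]) (use x in auto)
      hence "norm (?D x) \<le> ?C * norm x ^ ?M"
        using fourier_taylor_bound[OF g', of x ?M] unfolding sum pderivs_fourier[OF g] by (simp add: mult_ac)
      also have "norm x ^ ?M \<le> norm x powi (N - int ?l)"
      proof (cases "N \<ge> int ?l")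
        case True
        thus ?thesis by (simp add: power_int_def)
      next
        case False
        hence "1 \<le> inverse (norm x) ^ nat (int ?l - N)" using x by (intro one_le_power) (simp add: field_simps)
        thus ?thesis using False by (simp add: power_int_def)
      qed
      hence "?C * norm x ^ ?M \<le> ?C * norm x powi (N - int ?l)"
        by (intro mult_left_mono mult_nonneg_nonneg integral_nonneg_AE) auto
      finally show ?case by simp
    qed
    show "(\<lambda>x. ?C * norm x powi (N - int ?l)) \<in> O[at 0](\<lambda>x. norm x powi (N - int ?l))"
      by simp
  qed
qed

lemma schwartz_subset_thick_test:
  fixes f :: "real^'n::finite \<Rightarrow> complex"
  assumes f: "f \<in> schwartz"
  shows "f(0 := 0) \<in> thick_test"
proof -
  obtain g where g: "g \<in> schwartz" "fourier g = f" using fourier_surj[OF f] by metis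
  have "f(0 := 0) \<in> thick_step 0"
    unfolding thick_step_def
  proof (intro CollectI conjI allI)
    show "smooth_on (- {0}) (f(0 := 0))"
      by (rule smooth_on_cong[of _ f]) (use f in \<open>auto simp: schwartz_def intro: smooth_on_subset\<close>)
    show "\<exists>a. thick_expansion 0 a (f(0 := 0))" using thick_expansion_schwartz[OF g(1)] g(2) by auto
    fix k ds
    have "(\<lambda>x. (1 + norm x) ^ k * norm (pderivs ds (f(0 := 0)) x)) ` {x. 1 \<le> norm x} \<subseteq>
        (\<lambda>x. (1 + norm x) ^ k * norm (pderivs ds f x)) ` UNIV"
    proof (rule image_subsetI)
      fix x :: "real^'n" assume "x \<in> {x. 1 \<le> norm x}"
      hence "pderivs ds (f(0 := 0)) x = pderivs ds f x"
        by (intro pderivs_cong_open[of "- {0}"]) auto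
      thus "(1 + norm x) ^ k * norm (pderivs ds (f(0 := 0)) x) \<in> (\<lambda>x. (1 + norm x) ^ k * norm (pderivs ds f x)) ` UNIV"
        by simp
    qed
    thus "bounded ((\<lambda>x. (1 + norm x) ^ k * norm (pderivs ds (f(0 := 0)) x)) ` {x. 1 \<le> norm x})"
      using f bounded_subset unfolding schwartz_def by blast
  qed simp
  thus ?thesis by (auto simp: thick_test_def)
qed

section \<open>Hadamard finite parts\<close>

lemma powr_ln_ratio_tendsto_0:
  fixes \<alpha> \<beta> \<alpha>' \<beta>' :: real
  assumes "\<alpha> < \<alpha>' \<or> (\<alpha> = \<alpha>' \<and> \<beta> < \<beta>')"
  shows "((\<lambda>s. (s powr \<alpha> * ln s powr \<beta>) / (s powr \<alpha>' * ln s powr \<beta>')) \<longlongrightarrow> 0) at_top"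
proof -
  have ev: "\<forall>\<^sub>F s in at_top. (s powr (\<alpha> - \<alpha>') * ln s powr (\<beta> - \<beta>')) =
      (s powr \<alpha> * ln s powr \<beta>) / (s powr \<alpha>' * ln s powr \<beta>')"
    using eventually_gt_at_top[of "1::real"] by eventually_elim (simp add: powr_diff)
  have "((\<lambda>s. s powr (\<alpha> - \<alpha>') * ln s powr (\<beta> - \<beta>')) \<longlongrightarrow> 0) at_top"
  proof (cases "\<alpha> < \<alpha>'")
    case True
    define d where "d = \<alpha>' - \<alpha>"
    define b where "b = \<beta> - \<beta>'"
    have "d > 0" using True by (simp add: d_def)
    hence "((\<lambda>s. s powr (- d) * ln s powr b) \<longlongrightarrow> 0) at_top" by real_asymp
    thus ?thesis by (simp add: d_def b_def)
  next
    case False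
    define d where "d = \<beta>' - \<beta>"
    have "d > 0" using False assms by (simp add: d_def)
    hence "((\<lambda>s. ln s powr (- d)) \<longlongrightarrow> 0) at_top" by real_asymp
    moreover have "\<forall>\<^sub>F s in at_top. ln s powr (- d) = s powr (\<alpha> - \<alpha>') * ln s powr (\<beta> - \<beta>')"
      using eventually_gt_at_top[of "1::real"]
      by eventually_elim (use False assms in \<open>simp add: d_def\<close>)
    ultimately show ?thesis by (rule Lim_transform_eventually)
  qed
  thus ?thesis using ev by (rule Lim_transform_eventually)
qed

text \<open>The functions \<open>s powr \<alpha> * ln s powr \<beta>\<close> are totally ordered by growth; dividing by the
  largest one that occurs with a non-zero coefficient isolates that coefficient.\<close>

lemma powr_ln_combination_tendsto_0:
  fixes \<kappa> :: "real \<times> real \<Rightarrow> complex"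
  assumes I: "finite I" "\<And>\<alpha> \<beta>. (\<alpha>, \<beta>) \<in> I \<Longrightarrow> \<alpha> \<ge> 0 \<and> \<beta> \<ge> 0"
    and lim: "((\<lambda>s. \<Sum>(\<alpha>, \<beta>)\<in>I. \<kappa> (\<alpha>, \<beta>) * of_real (s powr \<alpha> * ln s powr \<beta>)) \<longlongrightarrow> 0) at_top"
    and i: "i \<in> I"
  shows "\<kappa> i = 0"
proof (rule ccontr)
  assume "\<kappa> i \<noteq> 0"
  define J where "J = {i\<in>I. \<kappa> i \<noteq> 0}"
  have "i \<in> J" using i \<open>\<kappa> i \<noteq> 0\<close> by (simp add: J_def)
  hence "J \<noteq> {}" by blast
  moreover have "J \<subseteq> I" by (auto simp: J_def)
  ultimately have J: "finite J" "J \<noteq> {}" "J \<subseteq> I" using I(1) finite_subset by blast+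
  define a where "a = Max (fst ` J)"
  have "a \<in> fst ` J" unfolding a_def using J by (intro Max_in) auto
  define K where "K = {b. (a, b) \<in> J}"
  have K: "finite K" "K \<noteq> {}"
  proof -
    have "K \<subseteq> snd ` J" by (force simp: K_def)
    thus "finite K" using J(1) finite_surj by blast
    show "K \<noteq> {}" using \<open>a \<in> fst ` J\<close> by (auto simp: K_def)
  qed
  define b where "b = Max K"
  have ab: "(a, b) \<in> J" using Max_in[OF K] by (auto simp: b_def K_def)
  have max: "\<alpha> < a \<or> (\<alpha> = a \<and> \<beta> < b)" if "(\<alpha>, \<beta>) \<in> J" "(\<alpha>, \<beta>) \<noteq> (a, b)" for \<alpha> \<beta>
  proof -
    have "fst (\<alpha>, \<beta>) \<le> a" unfolding a_def using J that by (intro Max_ge) blast+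
    moreover have "\<beta> \<le> b" if "\<alpha> = a"
      unfolding b_def using K(1) \<open>(\<alpha>, \<beta>) \<in> J\<close> that by (intro Max_ge) (auto simp: K_def)
    ultimately show ?thesis using that by force
  qed
  let ?m = "\<lambda>s. s powr a * ln s powr b"
  let ?S = "\<lambda>s. \<Sum>(\<alpha>, \<beta>)\<in>I. \<kappa> (\<alpha>, \<beta>) * of_real (s powr \<alpha> * ln s powr \<beta>)"
  have ratio: "((\<lambda>s. \<kappa> (\<alpha>, \<beta>) * of_real ((s powr \<alpha> * ln s powr \<beta>) / ?m s)) \<longlongrightarrow>
      (if (\<alpha>, \<beta>) = (a, b) then \<kappa> (a, b) else 0)) at_top" if "(\<alpha>, \<beta>) \<in> J" for \<alpha> \<beta>
  proof (cases "(\<alpha>, \<beta>) = (a, b)")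
    case True
    have "\<forall>\<^sub>F s in at_top. \<kappa> (a, b) = \<kappa> (\<alpha>, \<beta>) * of_real ((s powr \<alpha> * ln s powr \<beta>) / ?m s)"
      using eventually_gt_at_top[of "1::real"] by eventually_elim (use True in simp)
    from Lim_transform_eventually[OF tendsto_const this] show ?thesis by (simp only: True refl if_True)
  next
    case False
    have "((\<lambda>s. complex_of_real ((s powr \<alpha> * ln s powr \<beta>) / ?m s)) \<longlongrightarrow> of_real 0) at_top"
      by (intro tendsto_of_real powr_ln_ratio_tendsto_0 max that False)
    from tendsto_mult_right_zero[OF this[unfolded of_real_0], of "\<kappa> (\<alpha>, \<beta>)"] show ?thesis using False by auto
  qed
  have "((\<lambda>s. \<Sum>(\<alpha>, \<beta>)\<in>J. \<kappa> (\<alpha>, \<beta>) * of_real ((s powr \<alpha> * ln s powr \<beta>) / ?m s)) \<longlongrightarrow>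
      (\<Sum>(\<alpha>, \<beta>)\<in>J. if (\<alpha>, \<beta>) = (a, b) then \<kappa> (a, b) else 0)) at_top"
    by (rule tendsto_sum) (use ratio in auto)
  also have "(\<Sum>(\<alpha>, \<beta>)\<in>J. if (\<alpha>, \<beta>) = (a, b) then \<kappa> (a, b) else 0) = \<kappa> (a, b)"
    using J(1) ab by (simp only: case_prod_unfold prod.collapse) simp
  also have "(\<lambda>s. \<Sum>(\<alpha>, \<beta>)\<in>J. \<kappa> (\<alpha>, \<beta>) * of_real ((s powr \<alpha> * ln s powr \<beta>) / ?m s)) = (\<lambda>s. ?S s / of_real (?m s))"
  proof
    fix s
    have "?S s = (\<Sum>(\<alpha>, \<beta>)\<in>J. \<kappa> (\<alpha>, \<beta>) * of_real (s powr \<alpha> * ln s powr \<beta>))"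
      by (rule sum.mono_neutral_right) (use I(1) J in \<open>auto simp: J_def\<close>)
    thus "(\<Sum>(\<alpha>, \<beta>)\<in>J. \<kappa> (\<alpha>, \<beta>) * of_real ((s powr \<alpha> * ln s powr \<beta>) / ?m s)) = ?S s / of_real (?m s)"
      by (simp add: sum_divide_distrib case_prod_unfold)
  qed
  finally have lim1: "((\<lambda>s. ?S s / of_real (?m s)) \<longlongrightarrow> \<kappa> (a, b)) at_top" .
  \<comment> \<open>The dominating function is at least 1 for s > e because its exponents are
    nonnegative, so dividing by it keeps the limit 0.\<close>
  have "((\<lambda>s. ?S s / of_real (?m s)) \<longlongrightarrow> 0) at_top"
  proof (rule Lim_null_comparison)
    show "((\<lambda>s. norm (?S s)) \<longlongrightarrow> 0) at_top" using lim tendsto_norm_zero by blast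
    show "\<forall>\<^sub>F s in at_top. norm (?S s / of_real (?m s)) \<le> norm (?S s)"
      using eventually_gt_at_top[of "exp (1::real)"]
    proof eventually_elim
      case (elim s)
      have "s > 1" using elim exp_gt_one[of "1::real"] by linarith
      moreover have "ln s > 1" using elim \<open>s > 1\<close> ln_less_cancel_iff[of "exp 1" s] by simp
      moreover have "a \<ge> 0" "b \<ge> 0" using I(2) ab J by blast+
      ultimately have "1 * 1 \<le> ?m s" by (intro mult_mono ge_one_powr_ge_zero) auto
      hence "norm (?S s) / ?m s \<le> norm (?S s) / 1" by (intro divide_left_mono) auto
      thus ?case using \<open>1 * 1 \<le> ?m s\<close> by (simp only: norm_divide norm_of_real)
    qed
  qed
  hence "\<kappa> (a, b) = 0" using lim1 tendsto_unique trivial_limit_at_top_linorder by blast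
  thus False using ab by (simp add: J_def)
qed

text \<open>After the substitution s = 1/\<epsilon>, subtracting two representations leaves a
  combination of the functions \<open>s powr \<alpha> * ln s powr \<beta>\<close> that tends to 0.
  The difference of the two finite parts is its coefficient at the exponent (0, 0).\<close>

lemma has_finite_part_unique:
  assumes "has_finite_part g c" "has_finite_part g c'"
  shows "c = c'"
proof -
  have *: "\<exists>I (\<kappa> :: real \<times> real \<Rightarrow> complex). finite I \<and> (0, 0) \<notin> I \<and> (\<forall>(\<alpha>, \<beta>)\<in>I. \<alpha> \<ge> 0 \<and> \<beta> \<ge> 0) \<and>
      ((\<lambda>s. g (inverse s) - (\<Sum>(\<alpha>, \<beta>)\<in>I. \<kappa> (\<alpha>, \<beta>) * of_real (s powr \<alpha> * ln s powr \<beta>))) \<longlongrightarrow> c) at_top"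
    if hfp: "has_finite_part g c" for c
  proof -
    obtain I and \<kappa> :: "real \<times> real \<Rightarrow> complex" where I: "finite I"
      "\<forall>(\<alpha>, \<beta>)\<in>I. (\<alpha> > 0 \<and> \<beta> \<ge> 0) \<or> (\<alpha> = 0 \<and> \<beta> > 0)"
      "((\<lambda>\<epsilon>. g \<epsilon> - (\<Sum>(\<alpha>, \<beta>)\<in>I. \<kappa> (\<alpha>, \<beta>) * of_real (\<epsilon> powr (- \<alpha>) * \<bar>ln \<epsilon>\<bar> powr \<beta>))) \<longlongrightarrow> c) (at_right 0)"
      using hfp unfolding has_finite_part_def by blast
    have "((\<lambda>s. g (inverse s) - (\<Sum>(\<alpha>, \<beta>)\<in>I. \<kappa> (\<alpha>, \<beta>) *
        of_real (inverse s powr (- \<alpha>) * \<bar>ln (inverse s)\<bar> powr \<beta>))) \<longlongrightarrow> c) at_top"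
      using I(3) unfolding filterlim_at_right_to_top .
    moreover have "\<forall>\<^sub>F s in at_top. g (inverse s) - (\<Sum>(\<alpha>, \<beta>)\<in>I. \<kappa> (\<alpha>, \<beta>) *
        of_real (inverse s powr (- \<alpha>) * \<bar>ln (inverse s)\<bar> powr \<beta>)) =
        g (inverse s) - (\<Sum>(\<alpha>, \<beta>)\<in>I. \<kappa> (\<alpha>, \<beta>) * of_real (s powr \<alpha> * ln s powr \<beta>))"
      using eventually_gt_at_top[of "1::real"]
    proof eventually_elim
      case (elim s)
      hence "inverse s powr (- \<alpha>) = s powr \<alpha>" "\<bar>ln (inverse s)\<bar> = ln s" for \<alpha>
        by (simp_all add: powr_def ln_inverse)
      thus ?case by (simp only:)
    qed
    ultimately have "((\<lambda>s. g (inverse s) - (\<Sum>(\<alpha>, \<beta>)\<in>I. \<kappa> (\<alpha>, \<beta>) * of_real (s powr \<alpha> * ln s powr \<beta>))) \<longlongrightarrow> c) at_top"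
      by (rule Lim_transform_eventually)
    moreover have "(0, 0) \<notin> I" "\<forall>(\<alpha>, \<beta>)\<in>I. \<alpha> \<ge> 0 \<and> \<beta> \<ge> 0" using I(2) by force+
    ultimately show ?thesis using I(1) by blast
  qed
  let ?e = "\<lambda>(\<alpha>, \<beta>) s. complex_of_real (s powr \<alpha> * ln s powr \<beta>)"
  let ?R = "\<lambda>I \<kappa> s. g (inverse s) - (\<Sum>(\<alpha>, \<beta>)\<in>I. \<kappa> (\<alpha>, \<beta>) * ?e (\<alpha>, \<beta>) s)"
  obtain I \<kappa> where I: "finite I" "(0, 0) \<notin> I" "\<forall>(\<alpha>, \<beta>)\<in>I. \<alpha> \<ge> 0 \<and> \<beta> \<ge> 0"
    and l1: "(?R I \<kappa> \<longlongrightarrow> c) at_top"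
    using *[OF assms(1)] by auto
  obtain I' \<kappa>' where I': "finite I'" "(0, 0) \<notin> I'" "\<forall>(\<alpha>, \<beta>)\<in>I'. \<alpha> \<ge> 0 \<and> \<beta> \<ge> 0"
    and l2: "(?R I' \<kappa>' \<longlongrightarrow> c') at_top"
    using *[OF assms(2)] by auto
  let ?K = "insert (0, 0) (I \<union> I')"
  \<comment> \<open>The pair (0, 0) is excluded from both index sets, so its coefficient is exactly
    c - c'.\<close>
  define k where "k i = (if i \<in> I then \<kappa> i else 0) - (if i \<in> I' then \<kappa>' i else 0) + (if i = (0, 0) then c - c' else 0)" for i
  have S: "(\<Sum>i\<in>?K. (if i \<in> J then h i else 0) * ?e i s) = (\<Sum>(\<alpha>, \<beta>)\<in>J. h (\<alpha>, \<beta>) * ?e (\<alpha>, \<beta>) s)"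
    if "J \<subseteq> ?K" for J h s
  proof -
    have "(\<Sum>i\<in>?K. (if i \<in> J then h i else 0) * ?e i s) = (\<Sum>i\<in>J. h i * ?e i s)"
      by (rule sum.mono_neutral_cong_right) (use that I(1) I'(1) in auto)
    thus ?thesis by (simp add: case_prod_unfold)
  qed
  have "\<forall>\<^sub>F s in at_top. ?R I' \<kappa>' s -
      ?R I \<kappa> s - (c' - c) = (\<Sum>i\<in>?K. k i * ?e i s)"
    using eventually_gt_at_top[of "1::real"]
  proof eventually_elim
    case (elim s)
    have "(\<Sum>i\<in>?K. k i * ?e i s) = (\<Sum>i\<in>?K. (if i \<in> I then \<kappa> i else 0) * ?e i s) -
        (\<Sum>i\<in>?K. (if i \<in> I' then \<kappa>' i else 0) * ?e i s) + (\<Sum>i\<in>?K. (if i = (0, 0) then c - c' else 0) * ?e i s)"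
      unfolding k_def by (simp only: distrib_right left_diff_distrib sum.distrib sum_subtractf)
    also have "(\<Sum>i\<in>?K. (if i = (0, 0) then c - c' else 0) * ?e i s) = (\<Sum>i\<in>{(0, 0)}. (c - c') * ?e i s)"
      by (rule sum.mono_neutral_cong_right) (use I(1) I'(1) in auto)
    also have "\<dots> = c - c'" using elim by simp
    finally show ?case by (subst (asm) (1 2) S) auto
  qed
  moreover have "((\<lambda>s. ?R I' \<kappa>' s -
      ?R I \<kappa> s - (c' - c)) \<longlongrightarrow> c' - c - (c' - c)) at_top"
    by (intro tendsto_diff l1 l2 tendsto_const)
  ultimately have "((\<lambda>s. \<Sum>i\<in>?K. k i * ?e i s) \<longlongrightarrow> c' - c - (c' - c)) at_top"
    by (rule Lim_transform_eventually[rotated])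
  hence "((\<lambda>s. \<Sum>(\<alpha>, \<beta>)\<in>?K. k (\<alpha>, \<beta>) * of_real (s powr \<alpha> * ln s powr \<beta>)) \<longlongrightarrow> 0) at_top"
    by (simp only: case_prod_unfold prod.collapse diff_self)
  hence "k (0, 0) = 0"
    by (rule powr_ln_combination_tendsto_0[rotated 2]) (use I I' in auto)
  thus ?thesis using I(2) I'(2) by (simp add: k_def)
qed

section \<open>Finite parts that are ordinary integrals\<close>

lemma Pf_eqI:
  assumes "\<psi> \<in> schwartz" "((\<lambda>\<epsilon>. LINT x:{x. \<epsilon> < norm x}|lborel. \<phi> x * \<psi> x) \<longlongrightarrow> c) (at_right 0)"
  shows "Pf \<phi> \<psi> = c"
proof -
  \<comment> \<open>A genuine limit is a finite part with the empty set of discarded terms.\<close>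
  have "has_finite_part (\<lambda>\<epsilon>. LINT x:{x. \<epsilon> < norm x}|lborel. \<phi> x * \<psi> x) c"
    unfolding has_finite_part_def by (intro exI[of _ "{}"]) (use assms(2) in simp)
  thus ?thesis
    using assms(1) has_finite_part_unique by (simp add: Pf_def) (rule the_equality)
qed

lemma Pf_integrable:
  fixes \<phi> \<psi> :: "real^'n::finite \<Rightarrow> complex"
  assumes \<psi>: "\<psi> \<in> schwartz" and int: "integrable lborel (\<lambda>x. \<phi> x * \<psi> x)"
  shows "Pf \<phi> \<psi> = (LINT x|lborel. \<phi> x * \<psi> x)"
proof (rule Pf_eqI[OF \<psi>])
  let ?f = "\<lambda>x. \<phi> x * \<psi> x"
  have [measurable]: "?f \<in> borel_measurable borel" using borel_measurable_integrable[OF int] by simp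
  \<comment> \<open>In the variable s = 1/\<epsilon> this is dominated convergence at infinity; the
    origin, the only point never reached by the domains, is a null set.\<close>
  have "((\<lambda>s. LINT x|lborel. indicator {x. inverse s < norm x} x *\<^sub>R ?f x) \<longlongrightarrow> (LINT x|lborel. ?f x)) at_top"
  proof (rule integral_dominated_convergence_at_top[where w = "\<lambda>x. norm (?f x)"])
    show "AE x in lborel. ((\<lambda>s. indicator {x. inverse s < norm x} x *\<^sub>R ?f x) \<longlongrightarrow> ?f x) at_top"
      using AE_lborel_singleton[of 0]
    proof eventually_elim
      case (elim x)
      have "\<forall>\<^sub>F s in at_top. ?f x = indicator {x. inverse s < norm x} x *\<^sub>R ?f x"
        using eventually_gt_at_top[of "max 0 (inverse (norm x))"]
      proof eventually_elim
        case (elim s)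
        hence "inverse s < inverse (inverse (norm x))"
          using \<open>x \<noteq> 0\<close> by (intro less_imp_inverse_less) auto
        thus ?case by simp
      qed
      thus ?case by (rule Lim_transform_eventually[OF tendsto_const])
    qed
    show "integrable lborel (\<lambda>x. norm (?f x))" using int by simp
    show "\<forall>\<^sub>F s in at_top. AE x in lborel. norm (indicator {x. inverse s < norm x} x *\<^sub>R ?f x) \<le> norm (?f x)"
      by (intro always_eventually allI AE_I2) (simp add: indicator_def)
  qed measurable
  thus "((\<lambda>\<epsilon>. LINT x:{x. \<epsilon> < norm x}|lborel. ?f x) \<longlongrightarrow> (LINT x|lborel. ?f x)) (at_right 0)"
    unfolding filterlim_at_right_to_top set_lebesgue_integral_def .
qed

lemma Pf_vanishing_near_0:
  fixes \<phi> \<psi> :: "real^'n::finite \<Rightarrow> complex"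
  assumes \<psi>: "\<psi> \<in> schwartz" and \<delta>: "\<delta> > 0" "\<And>x. norm x < \<delta> \<Longrightarrow> \<psi> x = 0"
  shows "Pf \<phi> \<psi> = (LINT x|lborel. \<phi> x * \<psi> x)"
proof (rule Pf_eqI[OF \<psi>])
  have "\<forall>\<^sub>F \<epsilon> in at_right 0. (LINT x|lborel. \<phi> x * \<psi> x) = (LINT x:{x. \<epsilon> < norm x}|lborel. \<phi> x * \<psi> x)"
    unfolding eventually_at_right_field
  proof (intro exI[of _ \<delta>] conjI allI impI \<delta>(1))
    fix \<epsilon> assume "0 < \<epsilon>" "\<epsilon> < \<delta>"
    hence "indicator {x. \<epsilon> < norm x} x *\<^sub>R (\<phi> x * \<psi> x) = \<phi> x * \<psi> x" for x
      using \<delta>(2)[of x] by (auto simp: indicator_def)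
    thus "(LINT x|lborel. \<phi> x * \<psi> x) = (LINT x:{x. \<epsilon> < norm x}|lborel. \<phi> x * \<psi> x)"
      by (simp add: set_lebesgue_integral_def)
  qed
  thus "((\<lambda>\<epsilon>. LINT x:{x. \<epsilon> < norm x}|lborel. \<phi> x * \<psi> x) \<longlongrightarrow> (LINT x|lborel. \<phi> x * \<psi> x)) (at_right 0)"
    by (rule Lim_transform_eventually[OF tendsto_const])
qed

section \<open>Orthogonal projection to spherical harmonics\<close>

text \<open>Finite dimension is expressed as containment in the span of a list, so that orthogonal
  projections can be built by induction on that list.\<close>

primrec lspan :: "('a \<Rightarrow> complex) list \<Rightarrow> ('a \<Rightarrow> complex) set" where
  "lspan [] = {\<lambda>x. 0}"
| "lspan (b # bs) = {\<lambda>x. d * b x + f x | d f. f \<in> lspan bs}"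

lemma lspan_zero: "(\<lambda>x. 0) \<in> lspan bs"
proof (induction bs)
  case (Cons b bs)
  thus ?case by (auto intro!: exI[of _ 0] exI[of _ "\<lambda>x. 0"])
qed simp

lemma lspan_add: "f \<in> lspan bs \<Longrightarrow> g \<in> lspan bs \<Longrightarrow> (\<lambda>x. f x + g x) \<in> lspan bs"
proof (induction bs arbitrary: f g)
  case (Cons b bs)
  then obtain c d f' g' where fg: "f = (\<lambda>x. c * b x + f' x)" "g = (\<lambda>x. d * b x + g' x)"
    "f' \<in> lspan bs" "g' \<in> lspan bs" by auto
  have "(\<lambda>x. f x + g x) = (\<lambda>x. (c + d) * b x + (f' x + g' x))"
    by (simp add: fg algebra_simps)
  moreover have "(\<lambda>x. f' x + g' x) \<in> lspan bs" by (rule Cons.IH[OF fg(3,4)])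
  ultimately show ?case unfolding lspan.simps by (intro CollectI exI conjI)
qed simp

lemma lspan_cmult: "f \<in> lspan bs \<Longrightarrow> (\<lambda>x. c * f x) \<in> lspan bs"
proof (induction bs arbitrary: f)
  case (Cons b bs)
  then obtain d f' where f: "f = (\<lambda>x. d * b x + f' x)" "f' \<in> lspan bs" by auto
  have "(\<lambda>x. c * f x) = (\<lambda>x. (c * d) * b x + c * f' x)" by (simp add: f algebra_simps)
  moreover have "(\<lambda>x. c * f' x) \<in> lspan bs" by (rule Cons.IH[OF f(2)])
  ultimately show ?case unfolding lspan.simps by (intro CollectI exI conjI)
qed simp

lemma lspan_append1: "f \<in> lspan bs \<Longrightarrow> f \<in> lspan (bs @ cs)"
proof (induction bs arbitrary: f)
  case Nil
  thus ?case by (simp add: lspan_zero)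
next
  case (Cons b bs)
  then obtain d f' where "f = (\<lambda>x. d * b x + f' x)" "f' \<in> lspan bs" by auto
  thus ?case using Cons.IH[of f'] by auto
qed

lemma lspan_append2: "f \<in> lspan cs \<Longrightarrow> f \<in> lspan (bs @ cs)"
proof (induction bs)
  case (Cons b bs)
  thus ?case by (auto intro!: exI[of _ 0] exI[of _ f])
qed simp

lemma lspan_map_mult: "f \<in> lspan bs \<Longrightarrow> (\<lambda>x. m x * f x) \<in> lspan (map (\<lambda>b x. m x * b x) bs)"
proof (induction bs arbitrary: f)
  case (Cons b bs)
  then obtain d f' where f: "f = (\<lambda>x. d * b x + f' x)" "f' \<in> lspan bs" by auto
  have "(\<lambda>x. m x * f x) = (\<lambda>x. d * (m x * b x) + m x * f' x)" by (simp add: f algebra_simps)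
  moreover have "(\<lambda>x. m x * f' x) \<in> lspan (map (\<lambda>b x. m x * b x) bs)" by (rule Cons.IH[OF f(2)])
  ultimately show ?case unfolding list.map lspan.simps by (intro CollectI exI conjI)
qed simp

lemma lspan_sum:
  assumes "finite A" "\<And>a. a \<in> A \<Longrightarrow> f a \<in> lspan bs"
  shows "(\<lambda>x. \<Sum>a\<in>A. f a x) \<in> lspan bs"
  using assms by (induction A rule: finite_induct) (auto simp: lspan_zero intro: lspan_add)

definition fun_subspace :: "('a \<Rightarrow> complex) set \<Rightarrow> bool" where
  "fun_subspace V \<longleftrightarrow> (\<lambda>x. 0) \<in> V \<and> (\<forall>f\<in>V. \<forall>g\<in>V. \<forall>c. (\<lambda>x. f x + c * g x) \<in> V)"

lemma fun_subspaceD: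
  assumes "fun_subspace V"
  shows "(\<lambda>x. 0) \<in> V" "f \<in> V \<Longrightarrow> g \<in> V \<Longrightarrow> (\<lambda>x. f x + c * g x) \<in> V"
    "f \<in> V \<Longrightarrow> g \<in> V \<Longrightarrow> (\<lambda>x. f x - g x) \<in> V" "f \<in> V \<Longrightarrow> (\<lambda>x. c * f x) \<in> V"
proof -
  show z: "(\<lambda>x. 0) \<in> V" and c: "\<And>f g c. f \<in> V \<Longrightarrow> g \<in> V \<Longrightarrow> (\<lambda>x. f x + c * g x) \<in> V"
    using assms by (auto simp: fun_subspace_def)
  show "f \<in> V \<Longrightarrow> g \<in> V \<Longrightarrow> (\<lambda>x. f x - g x) \<in> V" using c[of f g "-1"] by simp
  show "f \<in> V \<Longrightarrow> (\<lambda>x. c * f x) \<in> V" using c[OF z, of f c] by simp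
qed

lemma fun_subspace_lspan: "fun_subspace (lspan bs)"
  unfolding fun_subspace_def by (auto intro: lspan_zero lspan_add lspan_cmult)

lemma fun_subspace_Int: "fun_subspace V \<Longrightarrow> fun_subspace W \<Longrightarrow> fun_subspace (V \<inter> W)"
  unfolding fun_subspace_def by auto

text \<open>Gram-Schmidt by induction on the generators: if V is not already contained in the span
  of the shorter list, its intersection with that span has codimension one, and a vector
  \<open>w\<close> orthogonal to the intersection completes it. The form is only semidefinite, since
  functions that vanish on the sphere have square 0; \<open>pos\<close> states the part of
  Cauchy-Schwarz that handles such vectors.\<close>

lemma orthogonal_projection_exists:
  fixes ip :: "('a \<Rightarrow> complex) \<Rightarrow> ('a \<Rightarrow> complex) \<Rightarrow> complex"
  assumes X: "fun_subspace X"
    and lin: "\<And>f g h c. f \<in> X \<Longrightarrow> g \<in> X \<Longrightarrow> h \<in> X \<Longrightarrow> ip (\<lambda>x. f x + c * g x) h = ip f h + c * ip g h"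
    and sym: "\<And>f g. f \<in> X \<Longrightarrow> g \<in> X \<Longrightarrow> ip g f = cnj (ip f g)"
    and pos: "\<And>f g. f \<in> X \<Longrightarrow> g \<in> X \<Longrightarrow> ip f f = 0 \<Longrightarrow> ip f g = 0"
    and V: "fun_subspace V" "V \<subseteq> X" "V \<subseteq> lspan bs" and A: "A \<in> X"
  shows "\<exists>Y\<in>V. \<forall>Z\<in>V. ip (\<lambda>x. A x - Y x) Z = 0"
  using V A
proof (induction bs arbitrary: V A)
  have X0: "(\<lambda>x. 0) \<in> X" by (rule fun_subspaceD[OF X])
  have lin2: "ip h (\<lambda>x. f x + c * g x) = ip h f + cnj c * ip h g" if "f \<in> X" "g \<in> X" "h \<in> X" for f g h c
  proof -
    have "(\<lambda>x. f x + c * g x) \<in> X" using that by (intro fun_subspaceD(2)[OF X])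
    hence "ip h (\<lambda>x. f x + c * g x) = cnj (ip (\<lambda>x. f x + c * g x) h)" by (rule sym[OF _ that(3)])
    also have "\<dots> = cnj (ip f h) + cnj c * cnj (ip g h)" by (simp only: lin[OF that] complex_cnj_add complex_cnj_mult)
    finally show ?thesis by (simp only: sym[OF that(1,3)] sym[OF that(2,3)])
  qed
  {
    case Nil
    have "ip (\<lambda>x. A x - 0) (\<lambda>x. 0) = 0"
      using lin2[OF X0 X0 Nil.prems(4), of 1] by simp
    thus ?case using Nil fun_subspaceD(1)[OF Nil.prems(1)] by (intro bexI[of _ "\<lambda>x. 0"]) auto
  next
    case (Cons b bs)
    let ?V = "V \<inter> lspan bs"
    have V': "fun_subspace ?V" "?V \<subseteq> X" "?V \<subseteq> lspan bs"
      using Cons.prems by (auto intro: fun_subspace_Int fun_subspace_lspan)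
    show ?case
    proof (cases "V \<subseteq> lspan bs")
      case True
      thus ?thesis using Cons by blast
    next
      case False
      then obtain v where v: "v \<in> V" "v \<notin> lspan bs" by blast
      hence vX: "v \<in> X" using Cons.prems by blast
      obtain P where P: "P \<in> ?V" "\<And>Z. Z \<in> ?V \<Longrightarrow> ip (\<lambda>x. v x - P x) Z = 0"
        using Cons.IH[OF V' vX] by blast
      define w where "w = (\<lambda>x. v x - P x)"
      have w: "w \<in> V" "w \<notin> lspan bs"
      proof -
        show "w \<in> V" unfolding w_def using v P by (intro fun_subspaceD(3)[OF Cons.prems(1)]) auto
        show "w \<notin> lspan bs"
        proof
          assume "w \<in> lspan bs"
          hence "(\<lambda>x. w x + 1 * P x) \<in> lspan bs" using P(1) by (intro fun_subspaceD(2)[OF fun_subspace_lspan]) auto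
          thus False using v(2) by (simp add: w_def)
        qed
      qed
      have wX: "w \<in> X" using w Cons.prems by blast
      have w0: "ip w Z = 0" if "Z \<in> ?V" for Z using P(2)[OF that] by (simp add: w_def)
      have w0': "ip Z w = 0" if "Z \<in> ?V" for Z using sym[OF wX, of Z] w0[OF that] that V'(2) by auto
      have "w \<in> lspan (b # bs)" using w Cons.prems by blast
      then obtain c w' where cw: "w = (\<lambda>x. c * b x + w' x)" "w' \<in> lspan bs" by auto
      have "c \<noteq> 0" using cw w(2) by auto
      have decomp: "\<exists>t z. z \<in> ?V \<and> Z = (\<lambda>x. z x + t * w x)" if Z: "Z \<in> V" for Z
      proof -
        have "Z \<in> lspan (b # bs)" using Z Cons.prems by blast
        then obtain d z where z: "Z = (\<lambda>x. d * b x + z x)" "z \<in> lspan bs" by auto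
        \<comment> \<open>The coefficient d / c eliminates the generator \<open>b\<close>, leaving
          an element of the shorter span.\<close>
        define y where "y = (\<lambda>x. Z x + (- (d / c)) * w x)"
        have "y \<in> V" unfolding y_def by (intro fun_subspaceD(2)[OF Cons.prems(1)] Z w)
        moreover have "y = (\<lambda>x. z x + (- (d / c)) * w' x)"
          using \<open>c \<noteq> 0\<close> by (simp add: y_def z cw fun_eq_iff field_simps)
        hence "y \<in> lspan bs" using fun_subspaceD(2)[OF fun_subspace_lspan z(2) cw(2)] by metis
        moreover have "Z = (\<lambda>x. y x + (d / c) * w x)" by (simp add: y_def)
        ultimately show ?thesis by blast
      qed
      obtain Y0 where Y0: "Y0 \<in> ?V" "\<And>Z. Z \<in> ?V \<Longrightarrow> ip (\<lambda>x. A x - Y0 x) Z = 0"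
        using Cons.IH[OF V' Cons.prems(4)] by blast
      \<comment> \<open>When \<open>ip w w\<close> is 0 any value of t would do, because
        \<open>pos\<close> then forces \<open>ip R w\<close> to vanish.\<close>
      define t where "t = ip A w / ip w w"
      define R where "R = (\<lambda>x. A x - Y0 x)"
      have RX: "R \<in> X" unfolding R_def using Y0 V' Cons.prems by (intro fun_subspaceD(3)[OF X]) auto
      have Rw: "ip R w = ip A w"
        using lin[of A Y0 w "-1"] w0'[OF Y0(1)] Y0(1) V'(2) Cons.prems wX by (auto simp: R_def)
      have orth_w: "ip (\<lambda>x. R x + (- t) * w x) w = 0"
      proof (cases "ip w w = 0")
        case True
        hence "ip w R = 0" using pos[OF wX RX] by simp
        hence "ip R w = 0" using sym[OF wX RX] by simp
        thus ?thesis using lin[OF RX wX wX, of "-t"] True by simp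
      next
        case False
        thus ?thesis using lin[OF RX wX wX, of "-t"] by (simp add: Rw t_def)
      qed
      have orth: "ip (\<lambda>x. R x + (- t) * w x) Z = 0" if Z: "Z \<in> V" for Z
      proof -
        obtain s z where z: "z \<in> ?V" "Z = (\<lambda>x. z x + s * w x)" using decomp[OF Z] by blast
        have zX: "z \<in> X" using z V' by blast
        have "(\<lambda>x. R x + (- t) * w x) \<in> X" by (intro fun_subspaceD(2)[OF X] RX wX)
        hence "ip (\<lambda>x. R x + (- t) * w x) Z = ip (\<lambda>x. R x + (- t) * w x) z + cnj s * ip (\<lambda>x. R x + (- t) * w x) w"
          unfolding z(2) by (rule lin2[OF zX wX])
        also have "ip (\<lambda>x. R x + (- t) * w x) z = 0"
          using lin[OF RX wX zX, of "-t"] w0[OF z(1)] Y0(2)[OF z(1)] by (simp add: R_def)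
        finally show ?thesis using orth_w by simp
      qed
      show ?thesis
      proof (rule bexI[of _ "\<lambda>x. Y0 x + t * w x"])
        show "(\<lambda>x. Y0 x + t * w x) \<in> V"
          using Y0(1) w by (intro fun_subspaceD(2)[OF Cons.prems(1)]) auto
        show "\<forall>Z\<in>V. ip (\<lambda>x. A x - (Y0 x + t * w x)) Z = 0"
          using orth by (simp add: R_def diff_diff_eq)
      qed
    qed
  }
qed

section \<open>Homogeneous polynomials and solid harmonics\<close>

lemma hom_poly_polynomial: "p \<in> hom_poly k \<Longrightarrow> polynomial_function p"
  by (simp add: hom_poly_def)

lemma hom_poly_scaleR: "p \<in> hom_poly k \<Longrightarrow> p (c *\<^sub>R x) = of_real (c ^ k) * p x"
  by (simp add: hom_poly_def)

lemma hom_poly_pderiv1: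
  fixes p :: "real^'n::finite \<Rightarrow> complex"
  assumes p: "p \<in> hom_poly (Suc k)"
  shows "pderiv1 i p \<in> hom_poly k"
  unfolding hom_poly_def
proof (intro CollectI conjI allI)
  have pp: "polynomial_function p" by (rule hom_poly_polynomial[OF p])
  show pd: "polynomial_function (pderiv1 i p)" by (rule polynomial_function_pderiv1[OF pp])
  fix c :: real and x :: "real^'n"
  have nz: "pderiv1 i p (c *\<^sub>R x) = of_real (c ^ k) * pderiv1 i p x" if c: "c \<noteq> 0" for c
  proof -
    have d: "p differentiable at y" for y by (rule differentiable_at_polynomial_function[OF pp])
    have "((\<lambda>x. p (0 + c *\<^sub>R x)) has_derivative (\<lambda>h. frechet_derivative p (at (0 + c *\<^sub>R x)) (c *\<^sub>R h))) (at x)"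
      by (rule has_derivative_affine_comp[OF d])
    hence "pderiv1 i (\<lambda>x. p (0 + c *\<^sub>R x)) x = c *\<^sub>R pderiv1 i p (c *\<^sub>R x)"
      by (rule pderiv1_eqI) (simp add: pderiv1_def linear_frechet_derivative[OF d] linear_scale)
    moreover have "(\<lambda>x. p (0 + c *\<^sub>R x)) = (\<lambda>x. of_real (c ^ Suc k) * p x)"
      using hom_poly_scaleR[OF p] by simp
    ultimately have "c *\<^sub>R pderiv1 i p (c *\<^sub>R x) = of_real (c ^ Suc k) * pderiv1 i p x"
      using pderiv1_cmult[OF d] by metis
    thus ?thesis using c by (simp add: scaleR_conv_of_real)
  qed
  show "pderiv1 i p (c *\<^sub>R x) = of_real (c ^ k) * pderiv1 i p x"
  proof (cases "c = 0")
    case True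
    \<comment> \<open>The chain rule leaves a factor c that can be cancelled only for c different
      from 0; the value at c = 0 follows by continuity of both sides.\<close>
    have lim1: "((\<lambda>c. pderiv1 i p (c *\<^sub>R x)) \<longlongrightarrow> pderiv1 i p (0 *\<^sub>R x)) (at 0)"
      using continuous_on_polymonial_function[OF pd, of UNIV]
      by (intro continuous_on_tendsto_compose[of UNIV "pderiv1 i p"] tendsto_intros) auto
    have lim2: "((\<lambda>c. of_real (c ^ k) * pderiv1 i p x) \<longlongrightarrow> of_real (0 ^ k) * pderiv1 i p x) (at 0)"
      by (intro tendsto_intros)
    have "\<forall>\<^sub>F c in at 0. pderiv1 i p (c *\<^sub>R x) = of_real (c ^ k) * pderiv1 i p x"
      unfolding eventually_at_filter using nz by simp
    from tendsto_unique[OF at_neq_bot Lim_transform_eventually[OF lim1 this] lim2]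
    show ?thesis unfolding True .
  qed (rule nz)
qed

text \<open>Both sides are the derivative of c \<mapsto> p(c x) at c = 1, computed by the chain rule
  and from homogeneity.\<close>

lemma hom_poly_euler:
  fixes p :: "real^'n::finite \<Rightarrow> complex"
  assumes p: "p \<in> hom_poly k"
  shows "(\<Sum>i\<in>UNIV. of_real (x $ i) * pderiv1 i p x) = of_nat k * p x"
proof -
  have d: "p differentiable at y" for y by (rule differentiable_at_polynomial_function[OF hom_poly_polynomial[OF p]])
  have "((\<lambda>c. c *\<^sub>R x) has_derivative (\<lambda>h. h *\<^sub>R x)) (at 1)" by (auto intro!: derivative_eq_intros)
  moreover have "(\<Sum>k\<in>UNIV. (h *\<^sub>R x) $ k *\<^sub>R pderiv1 k p (1 *\<^sub>R x)) =
      h *\<^sub>R (\<Sum>i\<in>UNIV. of_real (x $ i) * pderiv1 i p x)" for h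
    by (simp add: scaleR_conv_of_real[where 'a = complex] sum_distrib_left mult.assoc)
  ultimately have "((\<lambda>c. p (c *\<^sub>R x)) has_derivative (\<lambda>h. h *\<^sub>R (\<Sum>i\<in>UNIV. of_real (x $ i) * pderiv1 i p x))) (at 1)"
    using has_derivative_compose[OF _ has_derivative_pderiv1[OF d], of "\<lambda>c. c *\<^sub>R x" "\<lambda>h. h *\<^sub>R x" 1 UNIV]
    by (simp only:)
  hence 1: "((\<lambda>c. p (c *\<^sub>R x)) has_vector_derivative (\<Sum>i\<in>UNIV. of_real (x $ i) * pderiv1 i p x)) (at 1)"
    by (simp add: has_vector_derivative_def)
  have "((\<lambda>c. c ^ k) has_real_derivative of_nat k) (at 1)" by (auto intro!: derivative_eq_intros)
  hence "((\<lambda>c. c ^ k *\<^sub>R p x) has_vector_derivative of_nat k *\<^sub>R p x) (at 1)"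
    by (intro has_vector_derivative_scaleR[THEN has_vector_derivative_eq_rhs]) (auto intro: has_vector_derivative_const)
  hence "((\<lambda>c. p (c *\<^sub>R x)) has_vector_derivative of_nat k * p x) (at 1)"
    by (simp add: hom_poly_scaleR[OF p] scaleR_conv_of_real[where 'a = complex])
  with 1 show ?thesis by (rule vector_derivative_unique_at)
qed

text \<open>Euler's identity writes a polynomial of degree k + 1 as a combination of coordinates
  times its partial derivatives, which have degree k. Products of the coordinates with generators
  for degree k therefore generate degree k + 1.\<close>

lemma hom_poly_finite_dim: "\<exists>bs. (hom_poly k :: (real^'n::finite \<Rightarrow> complex) set) \<subseteq> lspan bs"
proof (induction k)
  case 0
  have "p \<in> lspan [\<lambda>x. 1]" if p: "p \<in> hom_poly 0" for p :: "real^'n \<Rightarrow> complex"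
  proof -
    have "p = (\<lambda>x. p 0 * 1 + 0)"
    proof
      fix x
      show "p x = p 0 * 1 + 0" using hom_poly_scaleR[OF p, of 0 x] by simp
    qed
    thus ?thesis unfolding lspan.simps by (intro CollectI exI conjI) auto
  qed
  thus ?case by blast
next
  case (Suc k)
  then obtain bs where bs: "(hom_poly k :: (real^'n \<Rightarrow> complex) set) \<subseteq> lspan bs" by blast
  let ?m = "\<lambda>i :: 'n. map (\<lambda>b x. of_real (x $ i) * b x) bs"
  have *: "f \<in> lspan (concat (map ?m is))" if "i \<in> set is" "f \<in> lspan (?m i)" for i f and "is" :: "'n list"
    using that by (induction "is") (auto intro: lspan_append1 lspan_append2)
  obtain is' :: "'n list" where is': "set is' = UNIV" using finite_list[OF finite] by blast
  have "p \<in> lspan (concat (map ?m is'))" if p: "p \<in> hom_poly (Suc k)" for p :: "real^'n \<Rightarrow> complex"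
  proof -
    have "(\<lambda>x. \<Sum>i\<in>UNIV. of_real (x $ i) * pderiv1 i p x) \<in> lspan (concat (map ?m is'))"
    proof (intro lspan_sum finite)
      fix i
      have "pderiv1 i p \<in> lspan bs" using hom_poly_pderiv1[OF p] bs by blast
      from lspan_map_mult[OF this] show "(\<lambda>x. of_real (x $ i) * pderiv1 i p x) \<in> lspan (concat (map ?m is'))"
        by (intro *[of i]) (simp_all add: is')
    qed
    from lspan_cmult[OF this, of "inverse (of_nat (Suc k))"]
    have "(\<lambda>x. inverse (of_nat (Suc k)) * (of_nat (Suc k) * p x)) \<in> lspan (concat (map ?m is'))"
      by (simp only: hom_poly_euler[OF p])
    moreover have "(\<lambda>x. inverse (of_nat (Suc k)) * (of_nat (Suc k) * p x)) = p"
      by (simp add: fun_eq_iff mult.assoc[symmetric] del: of_nat_Suc)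
    ultimately show ?thesis by (simp only:)
  qed
  thus ?case by blast
qed

text \<open>Elements of \<open>spherical_harmonics\<close> are \<open>undefined\<close> off the
  sphere, so pointwise linear combinations of them are not controlled there. Linear algebra is done
  with the polynomials themselves.\<close>

definition solid_harmonics :: "nat \<Rightarrow> (real^'n::finite \<Rightarrow> complex) set" where
  "solid_harmonics k = {p \<in> hom_poly k. harmonic p}"

lemma spherical_harmonics_eq: "spherical_harmonics k = (\<lambda>p. restrict p (sphere 0 1)) ` solid_harmonics k"
  by (auto simp: spherical_harmonics_def solid_harmonics_def)

lemma solid_harmonics_continuous:
  fixes p :: "real^'n::finite \<Rightarrow> complex"
  shows "p \<in> solid_harmonics k \<Longrightarrow> continuous_on A p"
  by (auto simp: solid_harmonics_def intro: continuous_on_polymonial_function hom_poly_polynomial)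

lemma fun_subspace_solid_harmonics: "fun_subspace (solid_harmonics k :: (real^'n::finite \<Rightarrow> complex) set)"
  unfolding fun_subspace_def
proof (intro conjI ballI allI)
  show "(\<lambda>x. 0) \<in> (solid_harmonics k :: (real^'n \<Rightarrow> complex) set)"
    by (simp add: solid_harmonics_def hom_poly_def harmonic_def pderiv1_const_fun)
  fix f g :: "real^'n \<Rightarrow> complex" and c
  assume f: "f \<in> solid_harmonics k" and g: "g \<in> solid_harmonics k"
  hence pf: "polynomial_function f" and pg: "polynomial_function g"
    by (auto simp: solid_harmonics_def hom_poly_def)
  have d: "pderiv1 i (\<lambda>x. f x + c * g x) = (\<lambda>x. pderiv1 i f x + c * pderiv1 i g x)"
    if "polynomial_function f" "polynomial_function g" for i and f g :: "real^'n \<Rightarrow> complex"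
  proof
    fix x
    note fd = differentiable_at_polynomial_function[OF that(1), where a = x and S = UNIV]
    note gd = differentiable_at_polynomial_function[OF that(2), where a = x and S = UNIV]
    show "pderiv1 i (\<lambda>x. f x + c * g x) x = pderiv1 i f x + c * pderiv1 i g x"
      by (subst pderiv1_add[OF fd differentiable_mult[OF differentiable_const gd]]) (simp add: pderiv1_cmult[OF gd])
  qed
  have "pderivs [i, i] (\<lambda>x. f x + c * g x) x = pderivs [i, i] f x + c * pderivs [i, i] g x" for i x
    using pf pg by (simp add: d polynomial_function_pderiv1)
  hence "harmonic (\<lambda>x. f x + c * g x)"
    using f g unfolding harmonic_def solid_harmonics_def by (simp add: sum.distrib flip: sum_distrib_left)
  moreover have "(\<lambda>x. f x + c * g x) \<in> hom_poly k"
    using f g pf pg unfolding solid_harmonics_def hom_poly_def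
    by (auto intro!: polynomial_function_add polynomial_function_times simp: algebra_simps)
  ultimately show "(\<lambda>x. f x + c * g x) \<in> solid_harmonics k" by (simp add: solid_harmonics_def)
qed

section \<open>Integration over the sphere\<close>

lemma sphere_set_integrable:
  fixes g :: "real^'n::finite \<Rightarrow> complex"
  assumes g: "continuous_on (sphere 0 1) g"
  shows "set_integrable lborel (ball 0 1) (\<lambda>x. g (sgn x))"
proof -
  have "compact (g ` sphere 0 1)" by (intro compact_continuous_image g) simp
  hence "bounded (g ` sphere 0 1)" by (rule compact_imp_bounded)
  then obtain B where "\<forall>v\<in>sphere 0 1. norm (g v) \<le> B" by (auto simp: bounded_iff)
  hence B: "norm (g v) \<le> B" if "norm v = 1" for v using that by simp
  have "continuous_on (ball 0 1 - {0}) (\<lambda>x::real^'n. g (sgn x))"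
    by (intro continuous_on_compose2[OF g] continuous_intros) (auto simp: norm_sgn split: if_splits)
  hence m: "(\<lambda>x. indicator (ball 0 1 - {0}) x *\<^sub>R g (sgn x)) \<in> borel_measurable (borel :: (real^'n) measure)"
    by (intro borel_measurable_continuous_on_indicator) auto
  have "(\<lambda>x. indicator (ball 0 1) x *\<^sub>R g (sgn x)) =
      (\<lambda>x. indicator (ball 0 1 - {0}) x *\<^sub>R g (sgn x) + indicator {0} x *\<^sub>R g 0)"
    by (auto simp: fun_eq_iff indicator_def)
  moreover have "(\<lambda>x. indicator (ball 0 1 - {0}) x *\<^sub>R g (sgn x) + indicator {0} x *\<^sub>R g 0) \<in> borel_measurable (borel :: (real^'n) measure)"
    using m by measurable
  ultimately have m': "(\<lambda>x. indicator (ball 0 1) x *\<^sub>R g (sgn x)) \<in> borel_measurable (borel :: (real^'n) measure)"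
    by simp
  show ?thesis
    unfolding set_integrable_def
  \<comment> \<open>The direction \<open>sgn 0\<close> is 0 and not on the sphere, hence the
    separate bound by the norm of \<open>g 0\<close>.\<close>
  proof (rule integrableI_bounded_set[where A = "ball 0 1" and B = "max B (norm (g 0))"])
    show "emeasure lborel (ball 0 1 :: (real^'n) set) < \<infinity>"
      using emeasure_bounded_finite[of "ball 0 1 :: (real^'n) set"] by simp
    show "AE x in lborel. x \<in> ball 0 1 \<longrightarrow> norm (indicator (ball 0 1) x *\<^sub>R g (sgn x)) \<le> max B (norm (g 0))"
    proof (intro AE_I2 impI)
      fix x :: "real^'n"
      show "norm (indicator (ball 0 1) x *\<^sub>R g (sgn x)) \<le> max B (norm (g 0))"
        using B[of "sgn x"] norm_ge_zero[of "g 0"] by (cases "x = 0") (auto simp: norm_sgn indicator_def le_max_iff_disj)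
    qed
    show "(\<lambda>x. indicator (ball 0 1) x *\<^sub>R g (sgn x)) \<in> borel_measurable lborel" using m' by simp
  qed (auto simp: indicator_def)
qed

lemma sphere_integral_cong:
  fixes f g :: "real^'n::finite \<Rightarrow> complex"
  assumes "continuous_on (sphere 0 1) f" "\<And>v. v \<in> sphere 0 1 \<Longrightarrow> f v = g v"
  shows "sphere_integral f = sphere_integral g"
proof -
  have g: "continuous_on (sphere 0 1) g" using assms continuous_on_cong by metis
  have "AE x :: real^'n in lborel. indicator (ball 0 1) x *\<^sub>R f (sgn x) = indicator (ball 0 1) x *\<^sub>R g (sgn x)"
    using AE_lborel_singleton[of 0] by eventually_elim (simp add: assms(2) norm_sgn)
  hence "(LINT x:ball 0 1|lborel. f (sgn x)) = (LINT x:ball 0 1|lborel. g (sgn x))"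
    unfolding set_lebesgue_integral_def
    by (intro integral_cong_AE)
      (use sphere_set_integrable[OF assms(1)] sphere_set_integrable[OF g] in
        \<open>auto simp: set_integrable_def dest: borel_measurable_integrable\<close>)
  thus ?thesis by (simp add: sphere_integral_def)
qed

lemma sphere_integral_add_cmult:
  fixes f g :: "real^'n::finite \<Rightarrow> complex"
  assumes "continuous_on (sphere 0 1) f" "continuous_on (sphere 0 1) g"
  shows "sphere_integral (\<lambda>v. f v + c * g v) = sphere_integral f + c * sphere_integral g"
  using sphere_set_integrable[OF assms(1)] sphere_set_integrable[OF assms(2)]
  by (simp add: sphere_integral_def set_integral_add algebra_simps)

lemma sphere_integral_cnj: "sphere_integral (\<lambda>v. cnj (f v)) = cnj (sphere_integral f)"
proof -
  have *: "(\<lambda>x. indicat_real (ball 0 1) x *\<^sub>R cnj (f (sgn x))) = (\<lambda>x. cnj (indicat_real (ball 0 1) x *\<^sub>R f (sgn x)))"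
    by (simp add: fun_eq_iff)
  show ?thesis
    unfolding sphere_integral_def set_lebesgue_integral_def
    by (simp only: * Bochner_Integration.integral_cnj complex_cnj_mult complex_cnj_of_nat)
qed

text \<open>The degree 0 extension of |d|^2 is nonnegative with integral 0 over the ball, so it
  vanishes almost everywhere; the set where d is nonzero is open in the punctured ball and must be
  empty.\<close>

lemma sphere_integral_cmod_square_eq_0:
  fixes d :: "real^'n::finite \<Rightarrow> complex"
  assumes d: "continuous_on (sphere 0 1) d" and zero: "sphere_integral (\<lambda>v. d v * cnj (d v)) = 0"
    and v: "v \<in> sphere 0 1"
  shows "d v = 0"
proof (rule ccontr)
  assume dv: "d v \<noteq> 0"
  let ?f = "\<lambda>x::real^'n. indicat_real (ball 0 1) x * (norm (d (sgn x)))\<^sup>2"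
  have e: "indicat_real (ball 0 1) x *\<^sub>R (d (sgn x) * cnj (d (sgn x))) = complex_of_real (?f x)" for x
    by (simp only: scaleR_conv_of_real complex_norm_square[symmetric] of_real_mult)
  have "continuous_on (sphere 0 1) (\<lambda>v. d v * cnj (d v))" by (intro continuous_intros d)
  from sphere_set_integrable[OF this]
  have "integrable lborel (\<lambda>x. complex_of_real (?f x))"
    unfolding set_integrable_def e .
  hence int: "integrable lborel ?f" by (simp only: complex_of_real_integrable_eq)
  have "complex_of_real (LINT x|lborel. ?f x) = 0"
    using zero unfolding sphere_integral_def set_lebesgue_integral_def e integral_complex_of_real by simp
  hence "(LINT x|lborel. ?f x) = 0" by simp
  hence AE: "AE x in lborel. ?f x = 0" using integral_nonneg_eq_0_iff_AE[OF int] by simp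
  let ?U = "ball 0 1 - {0 :: real^'n}"
  have "continuous_on ?U (\<lambda>x. d (sgn x))"
    by (intro continuous_on_compose2[OF d] continuous_intros) (auto simp: norm_sgn split: if_splits)
  hence "open ((\<lambda>x. d (sgn x)) -` (- {0}) \<inter> ?U)"
    using continuous_on_open_vimage[of ?U "\<lambda>x. d (sgn x)"] open_Compl[of "{0::complex}"] by (auto simp: open_delete)
  moreover have "AE x in lborel. x \<notin> (\<lambda>x. d (sgn x)) -` (- {0}) \<inter> ?U"
    using AE by eventually_elim auto
  ultimately have "(\<lambda>x. d (sgn x)) -` (- {0}) \<inter> ?U = {}" by (rule open_AE_notin_empty)
  \<comment> \<open>The point v lies on the boundary of the ball; half of it lies inside and has the
    same direction.\<close>
  moreover have "(1/2) *\<^sub>R v \<in> (\<lambda>x. d (sgn x)) -` (- {0}) \<inter> ?U"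
    using v dv by (auto simp: sgn_div_norm)
  ultimately show False by blast
qed

lemma continuous_on_sphere_subspace:
  "fun_subspace {f :: real^'n::finite \<Rightarrow> complex. continuous_on (sphere 0 1) f}"
  unfolding fun_subspace_def by (auto intro!: continuous_intros)

section \<open>Components in the spaces of spherical harmonics\<close>

lemma spherical_harmonics_orthogonal_iff:
  fixes A p :: "real^'n::finite \<Rightarrow> complex"
  assumes A: "continuous_on (sphere 0 1) A" and p: "p \<in> solid_harmonics k"
  shows "(\<forall>Z\<in>spherical_harmonics k. sphere_integral (\<lambda>v. (A v - restrict p (sphere 0 1) v) * cnj (Z v)) = 0) \<longleftrightarrow>
    (\<forall>z\<in>solid_harmonics k. sphere_integral (\<lambda>v. (A v - p v) * cnj (z v)) = 0)"
proof -
  have "sphere_integral (\<lambda>v. (A v - p v) * cnj (z v)) =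
      sphere_integral (\<lambda>v. (A v - restrict p (sphere 0 1) v) * cnj (restrict z (sphere 0 1) v))"
    if z: "z \<in> solid_harmonics k" for z
    by (rule sphere_integral_cong)
      (auto intro!: continuous_intros A solid_harmonics_continuous[OF p] solid_harmonics_continuous[OF z])
  thus ?thesis by (simp add: spherical_harmonics_eq)
qed

text \<open>The difference d of two candidates is a solid harmonic itself. Testing both
  orthogonality relations with d and subtracting gives a vanishing integral of |d|^2 over the
  sphere.\<close>

lemma sph_component_eqI:
  fixes A p :: "real^'n::finite \<Rightarrow> complex"
  assumes A: "continuous_on (sphere 0 1) A" and p: "p \<in> solid_harmonics k"
    and orth: "\<And>z. z \<in> solid_harmonics k \<Longrightarrow> sphere_integral (\<lambda>v. (A v - p v) * cnj (z v)) = 0"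
  shows "sph_component k A = restrict p (sphere 0 1)"
  unfolding sph_component_def
proof (rule the_equality)
  show "restrict p (sphere 0 1) \<in> spherical_harmonics k \<and>
    (\<forall>Z\<in>spherical_harmonics k. sphere_integral (\<lambda>v. (A v - restrict p (sphere 0 1) v) * cnj (Z v)) = 0)"
    using orth spherical_harmonics_orthogonal_iff[OF A p] p by (auto simp: spherical_harmonics_eq)
  fix Y assume Y: "Y \<in> spherical_harmonics k \<and>
    (\<forall>Z\<in>spherical_harmonics k. sphere_integral (\<lambda>v. (A v - Y v) * cnj (Z v)) = 0)"
  then obtain q where q: "q \<in> solid_harmonics k" "Y = restrict q (sphere 0 1)" by (auto simp: spherical_harmonics_eq)
  have orth': "sphere_integral (\<lambda>v. (A v - q v) * cnj (z v)) = 0" if "z \<in> solid_harmonics k" for z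
    using Y spherical_harmonics_orthogonal_iff[OF A q(1)] that unfolding q(2) by blast
  define d where "d = (\<lambda>x. p x - q x)"
  have d: "d \<in> solid_harmonics k"
    unfolding d_def by (rule fun_subspaceD(3)[OF fun_subspace_solid_harmonics p q(1)])
  note cont = A solid_harmonics_continuous[OF p] solid_harmonics_continuous[OF q(1)] solid_harmonics_continuous[OF d]
  have "(\<lambda>v. d v * cnj (d v)) = (\<lambda>v. (A v - q v) * cnj (d v) + (-1) * ((A v - p v) * cnj (d v)))"
    by (simp add: d_def fun_eq_iff algebra_simps)
  hence "sphere_integral (\<lambda>v. d v * cnj (d v)) =
      sphere_integral (\<lambda>v. (A v - q v) * cnj (d v)) + (-1) * sphere_integral (\<lambda>v. (A v - p v) * cnj (d v))"
    by (simp only:) (rule sphere_integral_add_cmult; intro continuous_intros cont)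
  hence "sphere_integral (\<lambda>v. d v * cnj (d v)) = 0" using orth[OF d] orth'[OF d] by simp
  hence "d v = 0" if "v \<in> sphere 0 1" for v
    using that by (intro sphere_integral_cmod_square_eq_0[OF cont(4)])
  thus "Y = restrict p (sphere 0 1)" unfolding q(2) by (auto simp: d_def restrict_def fun_eq_iff)
qed

lemma sph_component_solid_harmonic:
  fixes A :: "real^'n::finite \<Rightarrow> complex"
  assumes A: "continuous_on (sphere 0 1) A"
  obtains p where "p \<in> solid_harmonics k" "sph_component k A = restrict p (sphere 0 1)"
proof -
  let ?ip = "\<lambda>f g :: real^'n \<Rightarrow> complex. sphere_integral (\<lambda>v. f v * cnj (g v))"
  let ?X = "{f :: real^'n \<Rightarrow> complex. continuous_on (sphere 0 1) f}"
  obtain bs where bs: "(hom_poly k :: (real^'n \<Rightarrow> complex) set) \<subseteq> lspan bs" using hom_poly_finite_dim by blast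
  have "\<exists>Y\<in>solid_harmonics k. \<forall>Z\<in>solid_harmonics k. ?ip (\<lambda>x. A x - Y x) Z = 0"
  proof (rule orthogonal_projection_exists[where X = ?X and bs = bs])
    fix f g h :: "real^'n \<Rightarrow> complex" and c
    assume fgh: "f \<in> ?X" "g \<in> ?X" "h \<in> ?X"
    have "sphere_integral (\<lambda>v. f v * cnj (h v) + c * (g v * cnj (h v))) = ?ip f h + c * ?ip g h"
      using fgh by (intro sphere_integral_add_cmult) (auto intro!: continuous_intros)
    thus "?ip (\<lambda>x. f x + c * g x) h = ?ip f h + c * ?ip g h" by (simp add: algebra_simps)
  next
    fix f g :: "real^'n \<Rightarrow> complex"
    assume fg: "f \<in> ?X" "g \<in> ?X"
    show "?ip g f = cnj (?ip f g)" unfolding sphere_integral_cnj[symmetric] by (simp add: mult.commute)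
    assume "?ip f f = 0"
    hence "f v = 0" if "v \<in> sphere 0 1" for v using sphere_integral_cmod_square_eq_0 fg(1) that by blast
    hence "?ip f g = sphere_integral (\<lambda>v :: real^'n. 0)"
      using fg by (intro sphere_integral_cong) (auto intro!: continuous_intros)
    thus "?ip f g = 0" by (simp add: sphere_integral_def set_lebesgue_integral_def)
  qed (use A bs in \<open>auto simp: solid_harmonics_def intro: continuous_on_sphere_subspace
      fun_subspace_solid_harmonics[unfolded solid_harmonics_def] continuous_on_polymonial_function hom_poly_polynomial\<close>)
  thus ?thesis using that sph_component_eqI[OF A] by blast
qed

lemma sph_component_cong:
  fixes A B :: "real^'n::finite \<Rightarrow> complex"
  assumes A: "continuous_on (sphere 0 1) A" and AB: "\<And>v. v \<in> sphere 0 1 \<Longrightarrow> A v = B v"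
  shows "sph_component k A = sph_component k B"
proof -
  have "sphere_integral (\<lambda>v. (A v - Y v) * cnj (Z v)) = sphere_integral (\<lambda>v. (B v - Y v) * cnj (Z v))"
    if YZ: "Y \<in> spherical_harmonics k" "Z \<in> spherical_harmonics k" for Y Z
  proof -
    obtain y z where yz: "Y = restrict y (sphere 0 1)" "y \<in> solid_harmonics k"
      "Z = restrict z (sphere 0 1)" "z \<in> solid_harmonics k"
      using YZ unfolding spherical_harmonics_eq by blast
    have "continuous_on (sphere 0 1) (\<lambda>v. (A v - y v) * cnj (z v))"
      by (intro continuous_intros A solid_harmonics_continuous[OF yz(2)] solid_harmonics_continuous[OF yz(4)])
    hence "continuous_on (sphere 0 1) (\<lambda>v. (A v - Y v) * cnj (Z v))"
      by (rule continuous_on_eq) (simp add: yz)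
    thus ?thesis by (rule sphere_integral_cong) (simp add: AB)
  qed
  hence "(Y \<in> spherical_harmonics k \<and> (\<forall>Z\<in>spherical_harmonics k. sphere_integral (\<lambda>v. (A v - Y v) * cnj (Z v)) = 0)) \<longleftrightarrow>
      (Y \<in> spherical_harmonics k \<and> (\<forall>Z\<in>spherical_harmonics k. sphere_integral (\<lambda>v. (B v - Y v) * cnj (Z v)) = 0))" for Y
    by auto
  thus ?thesis unfolding sph_component_def by (simp only:)
qed

lemma sph_component_zero:
  fixes v :: "real^'n::finite"
  assumes "v \<in> sphere 0 1"
  shows "sph_component k (\<lambda>v. 0) v = 0"
proof -
  have "sph_component k (\<lambda>v. 0) = restrict (\<lambda>v::real^'n. 0) (sphere 0 1)"
    by (rule sph_component_eqI)
      (auto intro: fun_subspaceD(1)[OF fun_subspace_solid_harmonics] simp: sphere_integral_def set_lebesgue_integral_def)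
  thus ?thesis using assms by simp
qed

lemma sphere_smooth_continuous:
  fixes A :: "real^'n::finite \<Rightarrow> complex"
  assumes "A \<in> sphere_smooth"
  shows "continuous_on (sphere 0 1) A"
proof -
  have "continuous_on (- {0}) (\<lambda>x. A (sgn x))"
    using assms by (auto simp: sphere_smooth_def intro: smooth_on_continuous)
  hence "continuous_on (sphere 0 1) (\<lambda>x. A (sgn x))" by (rule continuous_on_subset) auto
  thus ?thesis by (rule continuous_on_eq) (simp add: sgn_div_norm)
qed

lemma zero_in_D_sph: "(\<lambda>v. 0) \<in> D_sph q"
proof -
  have "(\<lambda>v. 0) \<in> (sphere_smooth :: (real^'n::finite \<Rightarrow> complex) set)"
    by (simp add: sphere_smooth_def smooth_on_def pderivs_zero open_Compl)
  thus ?thesis by (simp add: D_sph_def sphere_smooth_wo_def sph_component_zero)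
qed

section \<open>The polynomial part\<close>

lemma filterlim_scaleR_at_infinity:
  fixes v :: "'a::real_normed_vector"
  assumes "norm v = 1"
  shows "filterlim (\<lambda>s. s *\<^sub>R v) at_infinity at_top"
proof (rule filterlim_at_infinity_conv_norm_at_top[THEN iffD2])
  have "\<forall>\<^sub>F s :: real in at_top. s = norm (s *\<^sub>R v)"
    using eventually_gt_at_top[of "0::real"] by eventually_elim (simp add: assms)
  from filterlim_mono_eventually[OF filterlim_ident order_refl order_refl this]
  show "filterlim (\<lambda>s. norm (s *\<^sub>R v)) at_top at_top" .
qed

text \<open>Along a fixed direction the nonnegative powers, with their logarithms, approximate the
  function up to O((1 + ln s) / s). This is the form in which coefficients can be compared.\<close>

lemma W_expansion_ray:
  fixes v :: "real^'n::finite"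
  assumes W: "W_expansion Q A P \<Phi>" and v: "v \<in> sphere 0 1"
  shows "((\<lambda>s. \<Phi> (s *\<^sub>R v) - (\<Sum>q\<le>Q. (A (int q) v + P (int q) v * of_real (ln s)) * of_real (s ^ q))) \<longlongrightarrow> 0) at_top"
proof -
  have nv: "norm v = 1" using v by simp
  \<comment> \<open>The choice N = -1 keeps exactly the terms of index 0 to Q.\<close>
  have "(\<lambda>u. norm (pderivs [] \<Phi> u - (\<Sum>q\<in>{-1<..int Q}. pderivs [] (W_term A P q) u)))
      \<in> O[at_infinity](\<lambda>u. norm u powi (-1 - int (length ([] :: 'n list))) * (1 + ln (norm u)))"
    using W unfolding W_expansion_def by blast
  hence "(\<lambda>u. norm (\<Phi> u - (\<Sum>q\<in>{-1<..int Q}. W_term A P q u)))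
      \<in> O[at_infinity](\<lambda>u. norm u powi (-1) * (1 + ln (norm u)))" by simp
  from landau_o.big.compose[OF this filterlim_scaleR_at_infinity[OF nv]]
  have "(\<lambda>s. norm (\<Phi> (s *\<^sub>R v) - (\<Sum>q\<in>{-1<..int Q}. W_term A P q (s *\<^sub>R v))))
      \<in> O[at_top](\<lambda>s. norm (s *\<^sub>R v) powi (-1) * (1 + ln (norm (s *\<^sub>R v))))" .
  also have "(\<lambda>s. norm (s *\<^sub>R v) powi (-1) * (1 + ln (norm (s *\<^sub>R v)))) \<in> O[at_top](\<lambda>s. (1 + ln s) / s)"
  proof (rule landau_o.big_mono)
    show "\<forall>\<^sub>F s in at_top. norm (norm (s *\<^sub>R v) powi (-1) * (1 + ln (norm (s *\<^sub>R v)))) \<le> norm ((1 + ln s) / s)"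
      using eventually_gt_at_top[of "0::real"]
      by eventually_elim (simp add: nv divide_inverse mult.commute)
  qed
  also have "(\<lambda>s::real. (1 + ln s) / s) \<in> o[at_top](\<lambda>s. 1)" by real_asymp
  finally have "((\<lambda>s. norm (\<Phi> (s *\<^sub>R v) - (\<Sum>q\<in>{-1<..int Q}. W_term A P q (s *\<^sub>R v)))) \<longlongrightarrow> 0) at_top"
    by (drule_tac smalloD_tendsto) simp
  hence lim: "((\<lambda>s. \<Phi> (s *\<^sub>R v) - (\<Sum>q\<in>{-1<..int Q}. W_term A P q (s *\<^sub>R v))) \<longlongrightarrow> 0) at_top"
    by (rule tendsto_norm_zero_cancel)
  have "\<forall>\<^sub>F s in at_top. \<Phi> (s *\<^sub>R v) - (\<Sum>q\<in>{-1<..int Q}. W_term A P q (s *\<^sub>R v)) =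
      \<Phi> (s *\<^sub>R v) - (\<Sum>q\<le>Q. (A (int q) v + P (int q) v * of_real (ln s)) * of_real (s ^ q))"
    using eventually_gt_at_top[of "0::real"]
  proof eventually_elim
    case (elim s)
    have "sgn (s *\<^sub>R v) = v" using elim by (simp add: sgn_scaleR sgn_div_norm nv)
    hence "W_term A P (int q) (s *\<^sub>R v) = (A (int q) v + P (int q) v * of_real (ln s)) * of_real (s ^ q)" for q
      using elim by (simp add: W_term_def nv)
    moreover have "(\<Sum>q\<in>{-1<..int Q}. W_term A P q (s *\<^sub>R v)) = (\<Sum>q\<le>Q. W_term A P (int q) (s *\<^sub>R v))"
      by (rule sum.reindex_bij_witness[of _ int nat]) auto
    ultimately show ?case by (simp only:)
  qed
  with lim show ?thesis by (rule Lim_transform_eventually)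
qed

text \<open>An instance of \<open>powr_ln_combination_tendsto_0\<close> with exponent pairs (q, e),
  where e in {0, 1} says whether the logarithm occurs; \<open>\<kappa>\<close> recovers q from its
  real value by the floor function.\<close>

lemma polynomial_log_tendsto_0:
  fixes a b :: "nat \<Rightarrow> complex"
  assumes lim: "((\<lambda>s. \<Sum>q\<le>M. (a q + b q * of_real (ln s)) * of_real (s ^ q)) \<longlongrightarrow> 0) at_top" and q: "q \<le> M"
  shows "a q = 0"
proof -
  let ?h = "\<lambda>(q, e). (real q, real e)"
  let ?J = "{..M} \<times> {0, 1 :: nat}"
  define \<kappa> where "\<kappa> = (\<lambda>(\<alpha> :: real, \<beta> :: real). if \<beta> = 0 then a (nat \<lfloor>\<alpha>\<rfloor>) else b (nat \<lfloor>\<alpha>\<rfloor>))"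
  have inj: "inj_on ?h ?J" by (auto simp: inj_on_def)
  have "\<forall>\<^sub>F s in at_top. (\<Sum>q\<le>M. (a q + b q * of_real (ln s)) * of_real (s ^ q)) =
      (\<Sum>(\<alpha>, \<beta>)\<in>?h ` ?J. \<kappa> (\<alpha>, \<beta>) * of_real (s powr \<alpha> * ln s powr \<beta>))"
    using eventually_gt_at_top[of "1::real"]
  proof eventually_elim
    case (elim s)
    have "(\<Sum>(\<alpha>, \<beta>)\<in>?h ` ?J. \<kappa> (\<alpha>, \<beta>) * of_real (s powr \<alpha> * ln s powr \<beta>)) =
        (\<Sum>(q, e)\<in>?J. \<kappa> (real q, real e) * of_real (s powr real q * ln s powr real e))"
      by (subst sum.reindex[OF inj]) (simp add: case_prod_unfold)
    also have "\<dots> = (\<Sum>q\<le>M. \<Sum>e\<in>{0, 1}. \<kappa> (real q, real e) * of_real (s powr real q * ln s powr real e))"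
      by (rule sum.cartesian_product[symmetric])
    also have "\<dots> = (\<Sum>q\<le>M. (a q + b q * of_real (ln s)) * of_real (s ^ q))"
      by (rule sum.cong) (use elim in \<open>auto simp: \<kappa>_def powr_realpow algebra_simps\<close>)
    finally show ?case by (rule sym)
  qed
  with lim have "((\<lambda>s. \<Sum>(\<alpha>, \<beta>)\<in>?h ` ?J. \<kappa> (\<alpha>, \<beta>) * of_real (s powr \<alpha> * ln s powr \<beta>)) \<longlongrightarrow> 0) at_top"
    by (rule Lim_transform_eventually)
  hence "\<kappa> (?h (q, 0)) = 0"
    by (rule powr_ln_combination_tendsto_0[rotated 2]) (use q in \<open>auto intro!: image_eqI[of _ _ "(q, 0)"]\<close>)
  thus ?thesis by (simp add: \<kappa>_def)
qed

text \<open>Two expansions may have different lengths, so both are padded with zeros up to a common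
  degree before they are subtracted along a ray. The conditionals say that a coefficient present on
  one side only must vanish.\<close>

lemma W_expansion_unique:
  fixes v :: "real^'n::finite"
  assumes W: "W_expansion Q A P \<Phi>" and W': "W_expansion Q' A' P' \<Phi>" and v: "v \<in> sphere 0 1"
  shows "(if q \<le> Q then A (int q) v else 0) = (if q \<le> Q' then A' (int q) v else 0)"
proof -
  let ?c = "\<lambda>Q (A :: int \<Rightarrow> real^'n \<Rightarrow> complex) q. if q \<le> Q then A (int q) v else 0"
  define M where "M = max q (max Q Q')"
  have QM: "Q \<le> M" "Q' \<le> M" by (auto simp: M_def)
  have pad: "(\<Sum>q\<le>Q. (A (int q) v + P (int q) v * of_real (ln s)) * of_real (s ^ q)) =
      (\<Sum>q\<le>M. (?c Q A q + ?c Q P q * of_real (ln s)) * of_real (s ^ q))"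
    if "Q \<le> M" for Q A P and s :: real
    by (rule sum.mono_neutral_cong_left) (use that in auto)
  have "((\<lambda>s. (\<Phi> (s *\<^sub>R v) - (\<Sum>q\<le>M. (?c Q' A' q + ?c Q' P' q * of_real (ln s)) * of_real (s ^ q))) -
      (\<Phi> (s *\<^sub>R v) - (\<Sum>q\<le>M. (?c Q A q + ?c Q P q * of_real (ln s)) * of_real (s ^ q)))) \<longlongrightarrow> 0 - 0) at_top"
    by (intro tendsto_diff W_expansion_ray[OF W v, unfolded pad[OF QM(1)]] W_expansion_ray[OF W' v, unfolded pad[OF QM(2)]])
  also have "(\<lambda>s. (\<Phi> (s *\<^sub>R v) - (\<Sum>q\<le>M. (?c Q' A' q + ?c Q' P' q * of_real (ln s)) * of_real (s ^ q))) -
      (\<Phi> (s *\<^sub>R v) - (\<Sum>q\<le>M. (?c Q A q + ?c Q P q * of_real (ln s)) * of_real (s ^ q)))) =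
    (\<lambda>s. \<Sum>q\<le>M. ((?c Q A q - ?c Q' A' q) + (?c Q P q - ?c Q' P' q) * of_real (ln s)) * of_real (s ^ q))"
  proof (rule ext, goal_cases)
    case (1 s)
    have "(x - y) - (x - z) = z - y" for x y z :: complex by simp
    hence "(x - sum f A) - (x - sum g A) = (\<Sum>q\<in>A. g q - f q)" 
      for x :: complex and f g and A :: "nat set"
      by (simp only: sum_subtractf)
    thus ?case by (simp only:) (intro sum.cong refl, simp only: left_diff_distrib distrib_right, simp)
  qed
  finally have "((\<lambda>s. \<Sum>q\<le>M. ((?c Q A q - ?c Q' A' q) + (?c Q P q - ?c Q' P' q) * of_real (ln s)) * of_real (s ^ q)) \<longlongrightarrow> 0) at_top"
    by simp
  hence "?c Q A q - ?c Q' A' q = 0" by (rule polynomial_log_tendsto_0) (simp add: M_def)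
  thus ?thesis by simp
qed

lemma W_expansion_sphere_smooth:
  fixes A :: "int \<Rightarrow> real^'n::finite \<Rightarrow> complex"
  assumes "W_expansion Q A P \<Phi>" "q \<le> Q"
  shows "A (int q) \<in> sphere_smooth"
proof -
  have "int CARD('n) > 0" by simp
  hence "int q \<le> int Q" "int q > - int CARD('n)" using assms(2) by linarith+
  moreover have "\<forall>q\<le>int Q. if q > - int CARD('n) then A q \<in> sphere_smooth else A q \<in> D_sph q"
    using assms(1) unfolding W_expansion_def by blast
  ultimately show ?thesis by presburger
qed

section \<open>The polynomial part is a polynomial\<close>

lemma pol_coeff_cong:
  fixes A B :: "real^'n::finite \<Rightarrow> complex"
  assumes "continuous_on (sphere 0 1) A" "\<And>v. v \<in> sphere 0 1 \<Longrightarrow> A v = B v"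
  shows "pol_coeff q A = pol_coeff q B"
  using sph_component_cong[OF assms] by (simp add: pol_coeff_def fun_eq_iff)

lemma pol_coeff_zero: "v \<in> sphere 0 1 \<Longrightarrow> pol_coeff q (\<lambda>v. 0) v = 0"
  by (simp add: pol_coeff_def sph_component_zero)

text \<open>The component of degree k is the restriction of a solid harmonic of degree k.
  Multiplying it by |x|^(q-k), a polynomial since q - k is even, raises the degree of homogeneity to
  q without changing the values on the sphere.\<close>

lemma pol_coeff_extends_to_polynomial:
  fixes A :: "real^'n::finite \<Rightarrow> complex"
  assumes A: "continuous_on (sphere 0 1) A"
  obtains p where "polynomial_function p"
    "\<And>s v. s > 0 \<Longrightarrow> v \<in> sphere 0 1 \<Longrightarrow> p (s *\<^sub>R v) = of_real (s ^ q) * pol_coeff q A v"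
proof -
  have "\<exists>p. p \<in> solid_harmonics k \<and> sph_component k A = restrict p (sphere 0 1)" for k
    by (rule sph_component_solid_harmonic[OF A, of k]) blast
  then obtain h where h: "\<And>k. h k \<in> solid_harmonics k" "\<And>k. sph_component k A = restrict (h k) (sphere 0 1)"
    by metis
  let ?K = "{k. k \<le> q \<and> even (q - k)}"
  let ?p = "\<lambda>x. \<Sum>k\<in>?K. of_real (((norm x)\<^sup>2) ^ ((q - k) div 2)) * h k x"
  have hp: "h k \<in> hom_poly k" for k using h(1)[of k] by (simp add: solid_harmonics_def)
  have "polynomial_function ?p"
    by (intro polynomial_function_sum polynomial_function_times polynomial_function_of_real
      real_polynomial_function_power real_polynomial_function_norm_square hom_poly_polynomial[OF hp]) simp
  moreover have "?p (s *\<^sub>R v) = of_real (s ^ q) * pol_coeff q A v" if s: "s > 0" and v: "v \<in> sphere 0 1" for s v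
  proof -
    have "of_real (((norm (s *\<^sub>R v))\<^sup>2) ^ ((q - k) div 2)) * h k (s *\<^sub>R v) = of_real (s ^ q) * sph_component k A v"
      if k: "k \<in> ?K" for k
    proof -
      have "((norm (s *\<^sub>R v))\<^sup>2) ^ ((q - k) div 2) = s ^ (2 * ((q - k) div 2))"
        using s v by (simp add: power_mult)
      also have "2 * ((q - k) div 2) = q - k" using k by (intro dvd_mult_div_cancel) blast
      finally have "of_real (((norm (s *\<^sub>R v))\<^sup>2) ^ ((q - k) div 2)) * h k (s *\<^sub>R v) =
          of_real (s ^ (q - k) * s ^ k) * h k v"
        by (simp add: hom_poly_scaleR[OF hp])
      also have "s ^ (q - k) * s ^ k = s ^ q" using k by (simp flip: power_add)
      finally show ?thesis using v s by (simp add: h(2))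
    qed
    thus ?thesis unfolding pol_coeff_def sum_distrib_left by (intro sum.cong) auto
  qed
  ultimately show thesis using that by blast
qed

lemma polynomial_eqI_punctured:
  fixes p q :: "real^'n::finite \<Rightarrow> complex"
  assumes "polynomial_function p" "polynomial_function q" "\<And>x. x \<noteq> 0 \<Longrightarrow> p x = q x"
  shows "p = q"
proof
  fix x
  have lim: "(f \<longlongrightarrow> f 0) (at 0)" if "polynomial_function f" for f :: "real^'n \<Rightarrow> complex"
    using continuous_on_polymonial_function[OF that, of UNIV] by (simp add: continuous_on)
  have "\<forall>\<^sub>F x in at 0. p x = q x" unfolding eventually_at_filter using assms(3) by simp
  from tendsto_unique[OF at_neq_bot Lim_transform_eventually[OF lim[OF assms(1)] this] lim[OF assms(2)]]
  have "p 0 = q 0" .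
  thus "p x = q x" using assms(3) by (cases "x = 0") auto
qed

text \<open>Any competing polynomial comes with an expansion of its own, whose coefficients agree on
  the sphere with those of the given one. The two polynomials thus agree off the origin, and by
  continuity everywhere.\<close>

lemma pol_part_eqI:
  fixes p :: "real^'n::finite \<Rightarrow> complex"
  assumes p: "polynomial_function p" and W: "W_expansion Q A P \<Phi>"
    and eq: "\<And>s v. s > 0 \<Longrightarrow> v \<in> sphere 0 1 \<Longrightarrow> p (s *\<^sub>R v) = (\<Sum>q\<le>Q. of_real (s ^ q) * pol_coeff q (A (int q)) v)"
  shows "pol_part \<Phi> = p"
  unfolding pol_part_def
proof (rule the_equality)
  show "polynomial_function p \<and> (\<exists>Q A P. W_expansion Q A P \<Phi> \<and> (\<forall>s>0. \<forall>v\<in>sphere 0 1.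
      p (s *\<^sub>R v) = (\<Sum>q\<le>Q. of_real (s ^ q) * pol_coeff q (A (int q)) v)))"
    using assms by blast
  fix p' assume "polynomial_function p' \<and> (\<exists>Q A P. W_expansion Q A P \<Phi> \<and> (\<forall>s>0. \<forall>v\<in>sphere 0 1.
      p' (s *\<^sub>R v) = (\<Sum>q\<le>Q. of_real (s ^ q) * pol_coeff q (A (int q)) v)))"
  then obtain Q' A' P' where p': "polynomial_function p'" and W': "W_expansion Q' A' P' \<Phi>"
    and eq': "\<And>s v. s > 0 \<Longrightarrow> v \<in> sphere 0 1 \<Longrightarrow> p' (s *\<^sub>R v) = (\<Sum>q\<le>Q'. of_real (s ^ q) * pol_coeff q (A' (int q)) v)"
    by blast
  define M where "M = max Q Q'"
  have QM: "Q \<le> M" "Q' \<le> M" by (auto simp: M_def)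
  let ?c = "\<lambda>Q (A :: int \<Rightarrow> real^'n \<Rightarrow> complex) q v. if q \<le> Q then A (int q) v else 0"
  have pad: "(\<Sum>q\<le>Q. of_real (s ^ q) * pol_coeff q (A (int q)) v) = (\<Sum>q\<le>M. of_real (s ^ q) * pol_coeff q (?c Q A q) v)"
    if "Q \<le> M" "v \<in> sphere 0 1" for Q A v and s :: real
    by (rule sum.mono_neutral_cong_left) (use that pol_coeff_zero in auto)
  have coeff: "pol_coeff q (?c Q A q) = pol_coeff q (?c Q' A' q)" for q
  proof (rule pol_coeff_cong)
    show "continuous_on (sphere 0 1) (?c Q A q)"
      using sphere_smooth_continuous[OF W_expansion_sphere_smooth[OF W, of q]] by (cases "q \<le> Q") auto
  qed (rule W_expansion_unique[OF W W'])
  show "p' = p"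
  proof (rule polynomial_eqI_punctured[OF p' p])
    fix x :: "real^'n" assume x: "x \<noteq> 0"
    have n: "norm x > 0" and sg: "sgn x \<in> sphere 0 1" using x by (auto simp: norm_sgn)
    have "p (norm x *\<^sub>R sgn x) = p' (norm x *\<^sub>R sgn x)"
      by (simp only: eq[OF n sg] eq'[OF n sg] pad[OF QM(1) sg] pad[OF QM(2) sg] coeff)
    thus "p' x = p x" using x by (simp add: sgn_div_norm)
  qed
qed

text \<open>Guarantees that the definite description in \<open>pol_part\<close> denotes for every
  element of \<open>W_pre\<close>, so that what \<open>proj_W\<close> subtracts really is a
  polynomial.\<close>

lemma polynomial_function_pol_part:
  fixes \<Phi> :: "real^'n::finite \<Rightarrow> complex"
  assumes "\<Phi> \<in> W_pre"
  shows "polynomial_function (pol_part \<Phi>)"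
proof -
  obtain Q A P where W: "W_expansion Q A P \<Phi>" using assms by (auto simp: W_pre_def W_pre_step_def)
  have "\<exists>p. polynomial_function p \<and> (\<forall>s>0. \<forall>v\<in>sphere 0 1. p (s *\<^sub>R v) = of_real (s ^ q) * pol_coeff q (A (int q)) v)"
    if "q \<le> Q" for q
    using pol_coeff_extends_to_polynomial[OF sphere_smooth_continuous[OF W_expansion_sphere_smooth[OF W that]], of q]
    by metis
  then obtain p where p: "\<And>q. q \<le> Q \<Longrightarrow> polynomial_function (p q)"
    "\<And>q s v. q \<le> Q \<Longrightarrow> s > 0 \<Longrightarrow> v \<in> sphere 0 1 \<Longrightarrow> p q (s *\<^sub>R v) = of_real (s ^ q) * pol_coeff q (A (int q)) v"
    by metis
  have poly: "polynomial_function (\<lambda>x. \<Sum>q\<le>Q. p q x)" by (intro polynomial_function_sum p) auto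
  have "pol_part \<Phi> = (\<lambda>x. \<Sum>q\<le>Q. p q x)" by (rule pol_part_eqI[OF poly W]) (simp add: p)
  thus ?thesis using poly by simp
qed

section \<open>Schwartz functions inside W\<close>

lemma W_expansion_schwartz:
  fixes \<psi> :: "real^'n::finite \<Rightarrow> complex"
  assumes \<psi>: "\<psi> \<in> schwartz"
  shows "W_expansion 0 (\<lambda>q v. 0) (\<lambda>q v. 0) \<psi>"
  unfolding W_expansion_def
proof (intro conjI allI ballI impI)
  show "(\<lambda>v::real^'n. 0) \<in> sphere_poly (nat q)" for q
    by (auto simp: sphere_poly_def hom_poly_def intro!: bexI[of _ "\<lambda>x. 0"])
  show "if - int CARD('n) < q then (\<lambda>v::real^'n. 0) \<in> sphere_smooth else (\<lambda>v::real^'n. 0) \<in> D_sph q" for q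
    using zero_in_D_sph[of q] zero_in_D_sph[of "-1"] by (auto simp: D_sph_def sphere_smooth_wo_def split: if_splits)
  fix ds :: "'n list" and N :: int
  have z: "pderivs ds (W_term (\<lambda>q v. 0) (\<lambda>q v. 0) q) = (\<lambda>u. 0)" for q
  proof -
    have "W_term (\<lambda>q v. 0) (\<lambda>q v. 0) q = (\<lambda>u::real^'n. 0)" by (simp add: W_term_def fun_eq_iff)
    thus ?thesis by (simp add: pderivs_zero)
  qed
  let ?D = "\<lambda>u. pderivs ds \<psi> u - (\<Sum>q\<in>{N<..int 0}. pderivs ds (W_term (\<lambda>q v. 0) (\<lambda>q v. 0) q) u)"
  let ?e = "N - int (length ds)"
  \<comment> \<open>Decay of this order matches the comparison function when its exponent is
    negative; for a nonnegative exponent boundedness is enough and k is 0.\<close>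
  define k where "k = nat (- ?e)"
  obtain B where B: "B > 0" "\<And>x. (1 + norm x) ^ k * norm (pderivs ds \<psi> x) \<le> B"
    using rapidD[OF schwartz_rapid[OF schwartz_pderivs[OF \<psi>]]] by blast
  show "(\<lambda>u. norm (?D u))
      \<in> O[at_infinity](\<lambda>u. norm u powi ?e * (1 + ln (norm u)))"
  proof (rule landau_o.bigI[OF B(1)])
    have "\<forall>\<^sub>F u :: real^'n in at_infinity. 1 \<le> norm u"
      unfolding eventually_at_infinity by blast
    thus "\<forall>\<^sub>F u in at_infinity. norm (norm (?D u))
        \<le> B * norm (norm u powi ?e * (1 + ln (norm u)))"
    proof eventually_elim
      case (elim u)
      have pos: "norm u ^ k > 0" using elim by (intro zero_less_power) linarith
      have "norm u ^ k * norm (pderivs ds \<psi> u) \<le> (1 + norm u) ^ k * norm (pderivs ds \<psi> u)"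
        by (intro mult_right_mono power_mono) auto
      also have "\<dots> \<le> B" by (rule B(2))
      finally have "norm (pderivs ds \<psi> u) \<le> B * inverse (norm u ^ k)"
        using pos by (simp add: field_simps)
      also have "\<dots> \<le> B * (norm u powi ?e * (1 + ln (norm u)))"
      proof (rule mult_left_mono)
        have "inverse (norm u ^ k) * 1 \<le> norm u powi ?e * (1 + ln (norm u))"
        proof (rule mult_mono)
          show "inverse (norm u ^ k) \<le> norm u powi ?e"
          proof (cases "?e \<ge> 0")
            case True
            thus ?thesis using elim by (simp add: k_def power_int_def one_le_power)
          next
            case False
            thus ?thesis by (simp add: k_def power_int_def power_inverse)
          qed
        qed (use elim in auto)
        thus "inverse (norm u ^ k) \<le> norm u powi ?e * (1 + ln (norm u))" by simp
      qed (use B in simp)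
      also have "\<dots> \<le> B * norm (norm u powi ?e * (1 + ln (norm u)))"
        using B(1) by (intro mult_left_mono) auto
      finally show ?case by (simp add: z)
    qed
  qed
qed

lemma schwartz_subset_W_pre: "\<psi> \<in> schwartz \<Longrightarrow> \<psi> \<in> W_pre"
  using W_expansion_schwartz by (auto simp: W_pre_def W_pre_step_def schwartz_def)

lemma pol_part_schwartz:
  assumes "\<psi> \<in> schwartz"
  shows "pol_part \<psi> = (\<lambda>x. 0)"
  by (rule pol_part_eqI[OF polynomial_function_const W_expansion_schwartz[OF assms]]) (simp add: pol_coeff_zero)

lemma schwartz_subset_W_space: "\<psi> \<in> schwartz \<Longrightarrow> \<psi> \<in> W_space"
  by (simp add: W_space_def schwartz_subset_W_pre pol_part_schwartz)


section \<open>The Fourier transform of thick test functions extends that of Schwartz functions\<close>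

text \<open>These are the functions on which a polynomial cannot be seen: the set is stable under
  multiplication by polynomials, and for positive \<delta> the integral of a member, being its
  transform at 0, vanishes. This expresses by Schwartz functions alone that the transform of a
  polynomial is supported at the origin.\<close>

definition schwartz_gap :: "real \<Rightarrow> (real^'n::finite \<Rightarrow> complex) set" where
  "schwartz_gap \<delta> = {\<xi> \<in> schwartz. \<forall>x. norm x < \<delta> \<longrightarrow> fourier \<xi> x = 0}"

lemma schwartz_gap_add: "f \<in> schwartz_gap \<delta> \<Longrightarrow> g \<in> schwartz_gap \<delta> \<Longrightarrow> (\<lambda>x. f x + g x) \<in> schwartz_gap \<delta>"
  by (simp add: schwartz_gap_def schwartz_add fourier_add integrable_schwartz)

lemma schwartz_gap_cmult: "f \<in> schwartz_gap \<delta> \<Longrightarrow> (\<lambda>x. c * f x) \<in> schwartz_gap \<delta>"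
  by (simp add: schwartz_gap_def schwartz_cmult fourier_cmult)

lemma schwartz_gap_sum:
  assumes "finite A" "A \<noteq> {}" "\<And>a. a \<in> A \<Longrightarrow> f a \<in> schwartz_gap \<delta>"
  shows "(\<lambda>x. \<Sum>a\<in>A. f a x) \<in> schwartz_gap \<delta>"
  using assms by (induction A rule: finite_ne_induct) (auto intro: schwartz_gap_add)

text \<open>Up to the factor i, multiplication by a coordinate differentiates the transform, and the
  derivative of a function vanishing on an open ball vanishes there too.\<close>

lemma schwartz_gap_coord:
  fixes f :: "real^'n::finite \<Rightarrow> complex"
  assumes f: "f \<in> schwartz_gap \<delta>"
  shows "(\<lambda>x. of_real (x $ j) * f x) \<in> schwartz_gap \<delta>"
proof -
  have fS: "f \<in> schwartz" using f by (simp add: schwartz_gap_def)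
  have "fourier (\<lambda>x. of_real (x $ j) * f x) x = 0" if x: "norm x < \<delta>" for x
  proof -
    have "pderiv1 j (fourier f) x = pderiv1 j (\<lambda>x. 0) x"
      by (rule pderiv1_cong_open[of "ball 0 \<delta>"]) (use f x in \<open>auto simp: schwartz_gap_def\<close>)
    hence "fourier (\<lambda>x. \<i> * (of_real (x $ j) * f x)) x = 0"
      unfolding pderiv1_fourier[OF fS] pderiv1_const .
    thus ?thesis unfolding fourier_cmult by simp
  qed
  thus ?thesis using schwartz_coord[OF fS] by (simp add: schwartz_gap_def)
qed

lemma schwartz_gap_real_polynomial:
  fixes f :: "real^'n::finite \<Rightarrow> complex"
  assumes "real_polynomial_function p" "f \<in> schwartz_gap \<delta>"
  shows "(\<lambda>x. of_real (p x) * f x) \<in> schwartz_gap \<delta>"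
  using assms
proof (induction arbitrary: f)
  case (linear h)
  have h_eq: "h x = (\<Sum>j\<in>UNIV. x $ j * h (axis j 1))" for x
  proof -
    have "h x = h (\<Sum>j\<in>UNIV. x $ j *\<^sub>R axis j 1)"
      by (simp add: basis_expansion flip: scalar_mult_eq_scaleR)
    thus ?thesis using linear(1) by (simp add: bounded_linear.linear linear_sum linear_scale)
  qed
  have "(\<lambda>x. of_real (h x) * f x) = (\<lambda>x. \<Sum>j\<in>UNIV. of_real (h (axis j 1)) * (of_real (x $ j) * f x))"
    by (rule ext, subst h_eq) (simp add: sum_distrib_left sum_distrib_right mult_ac)
  moreover have "(\<lambda>x. \<Sum>j\<in>UNIV. of_real (h (axis j 1)) * (of_real (x $ j) * f x)) \<in> schwartz_gap \<delta>"
    by (rule schwartz_gap_sum) (simp_all only: finite UNIV_not_empty not_False_eq_True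
      schwartz_gap_cmult schwartz_gap_coord linear(2))
  ultimately show ?case by (simp only:)
next
  case (const c)
  thus ?case by (rule schwartz_gap_cmult)
next
  case (add p q)
  thus ?case using schwartz_gap_add[of "\<lambda>x. of_real (p x) * f x" \<delta> "\<lambda>x. of_real (q x) * f x"]
    by (simp add: distrib_right)
next
  case (mult p q)
  thus ?case using mult.IH(1)[OF mult.IH(2)[OF mult.prems]] by (simp add: mult.assoc)
qed

lemma schwartz_gap_polynomial:
  fixes f :: "real^'n::finite \<Rightarrow> complex"
  assumes p: "polynomial_function p" and f: "f \<in> schwartz_gap \<delta>"
  shows "(\<lambda>x. p x * f x) \<in> schwartz_gap \<delta>"
proof -
  have "(\<lambda>x. p x * f x) = (\<lambda>x. of_real (Re (p x)) * f x + \<i> * (of_real (Im (p x)) * f x))"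
  proof
    fix x
    show "p x * f x = of_real (Re (p x)) * f x + \<i> * (of_real (Im (p x)) * f x)"
      by (subst complex_eq[of "p x"]) (simp only: distrib_right mult.assoc)
  qed
  moreover have "(\<lambda>x. of_real (Re (p x)) * f x + \<i> * (of_real (Im (p x)) * f x)) \<in> schwartz_gap \<delta>"
    using p unfolding polynomial_function_complex_iff
    by (simp only: schwartz_gap_add schwartz_gap_cmult schwartz_gap_real_polynomial f)
  ultimately show ?thesis by (simp only:)
qed

lemma integral_schwartz_gap:
  assumes "f \<in> schwartz_gap \<delta>" "\<delta> > 0"
  shows "(LINT x|lborel. f x) = 0"
proof -
  have "fourier f 0 = 0" using assms by (simp add: schwartz_gap_def)
  thus ?thesis by (simp add: fourier_def)
qed

section \<open>The graph of the thick Fourier transform at Schwartz functions\<close>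

lemma schwartz_bounded:
  assumes "f \<in> schwartz"
  obtains B where "\<And>x. norm (f x) \<le> B"
  using rapidD[OF schwartz_rapid[OF assms], of 0] by auto

lemma integrable_schwartz_mult:
  fixes f g :: "real^'n::finite \<Rightarrow> complex"
  assumes f: "f \<in> schwartz" and g: "g \<in> schwartz"
  shows "integrable lborel (\<lambda>x. f x * g x)"
proof -
  obtain B where B: "\<And>x. norm (f x) \<le> B" using schwartz_bounded[OF f] by blast
  have [measurable]: "f \<in> borel_measurable borel" "g \<in> borel_measurable borel"
    using f g by (auto intro: schwartz_measurable)
  have "integrable lborel (\<lambda>x. of_real B * g x)" by (intro integrable_mult_right integrable_schwartz g)
  thus ?thesis
  proof (rule Bochner_Integration.integrable_bound)
    show "AE x in lborel. norm (f x * g x) \<le> norm (of_real B * g x)"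
    proof (rule AE_I2)
      fix x
      have "norm (f x) * norm (g x) \<le> \<bar>B\<bar> * norm (g x)" using B[of x] by (intro mult_right_mono) auto
      thus "norm (f x * g x) \<le> norm (of_real B * g x)" by (simp add: norm_mult)
    qed
  qed measurable
qed

text \<open>For an integrable product the finite part is the integral, which does not see the
  changed value at the origin; the rest is the multiplication formula.\<close>

lemma fourier_tempered_Pf_schwartz:
  fixes \<psi> :: "real^'n::finite \<Rightarrow> complex"
  assumes \<psi>: "\<psi> \<in> schwartz"
  shows "fourier_tempered (Pf (\<psi>(0 := 0))) = regular_dist (fourier \<psi>)"
  unfolding fourier_tempered_def regular_dist_def
proof (rule restrict_ext)
  fix \<xi> :: "real^'n \<Rightarrow> complex" assume \<xi>: "\<xi> \<in> schwartz"
  have F: "fourier \<xi> \<in> schwartz" by (rule schwartz_fourier[OF \<xi>])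
  have [measurable]: "\<psi> \<in> borel_measurable borel" "fourier \<xi> \<in> borel_measurable borel"
    using \<psi> F by (auto intro: schwartz_measurable)
  have ae: "AE x in lborel. \<psi> x * fourier \<xi> x = (\<psi>(0 := 0)) x * fourier \<xi> x"
    using AE_lborel_singleton[of 0] by eventually_elim simp
  have m: "(\<lambda>x. (\<psi>(0 := 0)) x * fourier \<xi> x) \<in> borel_measurable lborel"
    unfolding fun_upd_def by measurable
  have int: "integrable lborel (\<lambda>x. (\<psi>(0 := 0)) x * fourier \<xi> x)"
    by (rule integrable_cong_AE[OF _ m ae, THEN iffD1, OF _ integrable_schwartz_mult[OF \<psi> F]]) measurable
  have "Pf (\<psi>(0 := 0)) (fourier \<xi>) = (LINT x|lborel. (\<psi>(0 := 0)) x * fourier \<xi> x)"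
    by (rule Pf_integrable[OF F int])
  also have "\<dots> = (LINT x|lborel. \<psi> x * fourier \<xi> x)"
    by (rule integral_cong_AE[symmetric, OF _ m ae]) measurable
  also have "\<dots> = (LINT x|lborel. fourier \<psi> x * \<xi> x)"
    by (rule fourier_multiplication[symmetric]) (intro integrable_schwartz \<psi> \<xi>)+
  finally show "Pf (\<psi>(0 := 0)) (fourier \<xi>) = (LINT x|lborel. fourier \<psi> x * \<xi> x)" .
qed

lemma thick_fourier_graph_schwartz:
  fixes \<psi> :: "real^'n::finite \<Rightarrow> complex"
  assumes \<psi>: "\<psi> \<in> schwartz"
  shows "(\<psi>(0 := 0), fourier \<psi>) \<in> thick_fourier_graph"
proof -
  have F: "fourier \<psi> \<in> schwartz" by (rule schwartz_fourier[OF \<psi>])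
  have "proj_W (fourier \<psi>) = fourier \<psi>" by (simp add: proj_W_def pol_part_schwartz[OF F])
  thus ?thesis
    unfolding thick_fourier_graph_def
    using schwartz_subset_thick_test[OF \<psi>] schwartz_subset_W_pre[OF F] fourier_tempered_Pf_schwartz[OF \<psi>]
    by (intro CollectI exI[of _ "\<psi>(0 := 0)"] exI[of _ "fourier \<psi>"]) simp
qed

lemma integrable_mult_supported:
  fixes h \<eta> :: "real^'n::finite \<Rightarrow> complex"
  assumes "continuous_on (cball a r) h" "\<eta> \<in> schwartz" "\<And>x. x \<notin> cball a r \<Longrightarrow> \<eta> x = 0"
  shows "integrable lborel (\<lambda>x. h x * \<eta> x)"
proof -
  have "integrable lborel (\<lambda>x. indicator (cball a r) x *\<^sub>R (h x * \<eta> x))"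
    by (intro borel_integrable_compact compact_cball continuous_on_mult assms(1) schwartz_continuous[OF assms(2)])
  also have "(\<lambda>x. indicator (cball a r) x *\<^sub>R (h x * \<eta> x)) = (\<lambda>x. h x * \<eta> x)"
    using assms(3) by (auto simp: indicator_def fun_eq_iff)
  finally show ?thesis .
qed

text \<open>Any other representative of the transformed distribution is continuous and has the same
  integrals against bumps, so it equals \<open>fourier \<psi>\<close>, whose polynomial part is
  0.\<close>

lemma thick_fourier_graph_right_unique:
  fixes \<psi> :: "real^'n::finite \<Rightarrow> complex"
  assumes \<psi>: "\<psi> \<in> schwartz" and graph: "(\<psi>(0 := 0), \<Psi>) \<in> thick_fourier_graph"
  shows "\<Psi> = fourier \<psi>"
proof -
  obtain \<Phi> where \<Phi>: "\<Phi> \<in> W_pre" "\<Psi> = proj_W \<Phi>" "fourier_tempered (Pf (\<psi>(0 := 0))) = regular_dist \<Phi>"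
    using graph by (auto simp: thick_fourier_graph_def)
  have F: "fourier \<psi> \<in> schwartz" by (rule schwartz_fourier[OF \<psi>])
  have cont: "continuous_on A \<Phi>" for A
    using \<Phi>(1) smooth_on_continuous continuous_on_subset by (fastforce simp: W_pre_def W_pre_step_def)
  have "\<Phi> a - fourier \<psi> a = 0" for a
  proof (rule eq_0_if_orthogonal_to_bumps[of UNIV "\<lambda>x. \<Phi> x - fourier \<psi> x"])
    show "continuous_on UNIV (\<lambda>x. \<Phi> x - fourier \<psi> x)"
      by (intro continuous_intros cont schwartz_continuous F)
    fix a :: "real^'n" and r \<eta>
    assume \<eta>: "\<eta> \<in> schwartz" "\<And>x. x \<notin> cball a r \<Longrightarrow> \<eta> x = 0"
    have "regular_dist \<Phi> \<eta> = regular_dist (fourier \<psi>) \<eta>"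
      using \<Phi>(3) fourier_tempered_Pf_schwartz[OF \<psi>] by simp
    hence "(LINT x|lborel. \<Phi> x * \<eta> x) = (LINT x|lborel. fourier \<psi> x * \<eta> x)"
      using \<eta>(1) by (simp add: regular_dist_def)
    moreover have "integrable lborel (\<lambda>x. \<Phi> x * \<eta> x)" by (rule integrable_mult_supported[OF cont \<eta>])
    moreover have "integrable lborel (\<lambda>x. fourier \<psi> x * \<eta> x)" by (rule integrable_schwartz_mult[OF F \<eta>(1)])
    ultimately show "(LINT x|lborel. (\<Phi> x - fourier \<psi> x) * \<eta> x) = 0"
      by (simp add: left_diff_distrib)
  qed auto
  hence "\<Phi> = fourier \<psi>" by (simp add: fun_eq_iff)
  thus ?thesis using \<Phi>(2) by (simp add: proj_W_def pol_part_schwartz[OF F])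
qed

lemma thick_fourier_graph_left_unique:
  fixes g :: "real^'n::finite \<Rightarrow> complex"
  assumes g: "g \<in> schwartz" and graph: "(\<phi>, fourier g) \<in> thick_fourier_graph"
  shows "\<phi> = g(0 := 0)"
proof -
  obtain \<Phi> where \<phi>: "\<phi> \<in> thick_test" and \<Phi>: "\<Phi> \<in> W_pre" "fourier g = proj_W \<Phi>"
    and eq: "fourier_tempered (Pf \<phi>) = regular_dist \<Phi>"
    using graph by (auto simp: thick_fourier_graph_def)
  have \<phi>0: "\<phi> 0 = 0" and cont: "continuous_on (- {0}) \<phi>"
    using \<phi> smooth_on_continuous by (auto simp: thick_test_def thick_step_def)
  have F: "fourier g \<in> schwartz" by (rule schwartz_fourier[OF g])
  have p: "polynomial_function (pol_part \<Phi>)" by (rule polynomial_function_pol_part[OF \<Phi>(1)])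
  have \<Phi>_eq: "\<Phi> x = fourier g x + pol_part \<Phi> x" for x using \<Phi>(2) by (simp add: proj_W_def)
  have "\<phi> a - g a = 0" if a: "a \<noteq> 0" for a
  proof (rule eq_0_if_orthogonal_to_bumps[of "- {0}" "\<lambda>x. \<phi> x - g x"])
    show "continuous_on (- {0}) (\<lambda>x. \<phi> x - g x)"
      by (intro continuous_intros cont schwartz_continuous g)
    fix b :: "real^'n" and r \<eta>
    assume b: "r > 0" "cball b r \<subseteq> - {0}" and \<eta>: "\<eta> \<in> schwartz" "\<And>x. x \<notin> cball b r \<Longrightarrow> \<eta> x = 0"
    \<comment> \<open>The distance from the origin to the ball that carries
      \<open>\<eta>\<close>.\<close>
    define \<delta> where "\<delta> = norm b - r"
    have "0 \<notin> cball b r" using b(2) by blast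
    hence \<delta>: "\<delta> > 0" by (simp add: \<delta>_def)
    have \<eta>0: "\<eta> x = 0" if "norm x < \<delta>" for x
      using \<eta>(2)[of x] norm_triangle_ineq2[of b x] that by (auto simp: \<delta>_def dist_norm)
    \<comment> \<open>The transformed distribution is evaluated at \<open>\<xi>\<close>, so that
      \<open>Pf \<phi>\<close> acts on \<open>\<eta>\<close>, which vanishes near the singularity of
      \<open>\<phi>\<close>.\<close>
    obtain \<xi> where \<xi>: "\<xi> \<in> schwartz" "fourier \<xi> = \<eta>" using fourier_surj[OF \<eta>(1)] by metis
    have gap: "\<xi> \<in> schwartz_gap \<delta>" using \<xi> \<eta>0 by (simp add: schwartz_gap_def)
    note gap' = schwartz_gap_polynomial[OF p gap]
    have "(LINT x|lborel. \<phi> x * \<eta> x) = fourier_tempered (Pf \<phi>) \<xi>"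
      using Pf_vanishing_near_0[OF \<eta>(1) \<delta> \<eta>0] \<xi> by (simp add: fourier_tempered_def)
    also have "\<dots> = (LINT x|lborel. fourier g x * \<xi> x + pol_part \<Phi> x * \<xi> x)"
      unfolding eq using \<xi>(1) by (simp add: regular_dist_def \<Phi>_eq distrib_right)
    also have "\<dots> = (LINT x|lborel. fourier g x * \<xi> x) + (LINT x|lborel. pol_part \<Phi> x * \<xi> x)"
      using gap' by (intro Bochner_Integration.integral_add integrable_schwartz_mult F \<xi> integrable_schwartz)
        (simp add: schwartz_gap_def)
    also have "(LINT x|lborel. pol_part \<Phi> x * \<xi> x) = 0" by (rule integral_schwartz_gap[OF gap' \<delta>])
    also have "(LINT x|lborel. fourier g x * \<xi> x) = (LINT x|lborel. g x * \<eta> x)"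
      using fourier_multiplication[OF integrable_schwartz[OF g] integrable_schwartz[OF \<xi>(1)]] \<xi>(2) by simp
    finally have "(LINT x|lborel. \<phi> x * \<eta> x) = (LINT x|lborel. g x * \<eta> x)" by simp
    moreover have "integrable lborel (\<lambda>x. \<phi> x * \<eta> x)"
      by (rule integrable_mult_supported[OF continuous_on_subset[OF cont b(2)] \<eta>])
    moreover have "integrable lborel (\<lambda>x. g x * \<eta> x)" by (rule integrable_schwartz_mult[OF g \<eta>(1)])
    ultimately show "(LINT x|lborel. (\<phi> x - g x) * \<eta> x) = 0"
      by (simp add: left_diff_distrib)
  qed (use a in \<open>auto simp: open_Compl\<close>)
  \<comment> \<open>At the origin both functions have the conventional value 0.\<close>
  thus ?thesis using \<phi>0 by (auto simp: fun_eq_iff)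
qed

section \<open>Values of the transforms of test functions and the two identities\<close>

lemma thick_fourier_test_schwartz:
  fixes \<psi> :: "real^'n::finite \<Rightarrow> complex"
  assumes "\<psi> \<in> schwartz"
  shows "thick_fourier_test (\<psi>(0 := 0)) = fourier \<psi>"
  unfolding thick_fourier_test_def
  by (rule the_equality, rule thick_fourier_graph_schwartz[OF assms], rule thick_fourier_graph_right_unique[OF assms])

text \<open>The reflection and the constant in \<open>W_fourier_test\<close> turn the inverse
  transform of \<open>\<psi>\<close> into its transform by the inversion formula; only the dummy
  value at the origin remains as a difference.\<close>

lemma W_fourier_test_schwartz:
  fixes \<psi> :: "real^'n::finite \<Rightarrow> complex"
  assumes "\<psi> \<in> schwartz"
  shows "W_fourier_test \<psi> = (fourier \<psi>)(0 := 0)"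
proof -
  obtain g where g: "g \<in> schwartz" "fourier g = \<psi>"
    "\<And>x. fourier \<psi> x = of_real ((2 * pi) ^ CARD('n)) * g (- x)"
    using fourier_surj[OF assms] by metis
  have "thick_fourier_test_inv \<psi> = g(0 := 0)"
    unfolding thick_fourier_test_inv_def g(2)[symmetric]
    by (rule the_equality, rule thick_fourier_graph_schwartz[OF g(1)], rule thick_fourier_graph_left_unique[OF g(1)])
  hence "W_fourier_test \<psi> x = ((fourier \<psi>)(0 := 0)) x" for x by (simp add: W_fourier_test_def g(3))
  thus ?thesis by (rule ext)
qed

theorem mainTheorem2:
  assumes "2 \<le> CARD('n::finite)"
  shows "(\<forall>f \<in> (thick_dual :: ((real^'n \<Rightarrow> complex) \<Rightarrow> complex) set).
            proj_W_tempered (thick_fourier f) = fourier_tempered (proj_thick_tempered f)) \<and>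
         (\<forall>F \<in> (W_dual :: ((real^'n \<Rightarrow> complex) \<Rightarrow> complex) set).
            proj_thick_tempered (W_fourier F) = fourier_tempered (proj_W_tempered F))"
proof (intro conjI ballI)
  fix f :: "(real^'n \<Rightarrow> complex) \<Rightarrow> complex"
  \<comment> \<open>Both sides are extensional on \<open>schwartz\<close>, and at \<psi> both
    evaluate \<open>f\<close> at \<open>(fourier \<psi>)(0 := 0)\<close>.\<close>
  show "proj_W_tempered (thick_fourier f) = fourier_tempered (proj_thick_tempered f)"
    unfolding proj_W_tempered_def fourier_tempered_def proj_thick_tempered_def thick_fourier_def
    by (rule restrict_ext) (simp add: schwartz_subset_W_space schwartz_fourier W_fourier_test_schwartz)
next
  fix F :: "(real^'n \<Rightarrow> complex) \<Rightarrow> complex"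
  \<comment> \<open>At \<psi> both sides evaluate \<open>F\<close> at \<open>fourier \<psi>\<close>:
    on the left as the transform of \<open>\<psi>(0 := 0)\<close>, on the right by duality.\<close>
  show "proj_thick_tempered (W_fourier F) = fourier_tempered (proj_W_tempered F)"
    unfolding proj_W_tempered_def fourier_tempered_def proj_thick_tempered_def W_fourier_def
    by (rule restrict_ext) (simp add: schwartz_subset_thick_test schwartz_fourier thick_fourier_test_schwartz)
qed

end
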